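(* Let $\mathfrak m=\mathfrak m(V,W,\beta)$ be a real extended translation algebra with $\dim V=1$ and let $\mathfrak g$ be its maximal transitive prolongation. Then exactly one of the following two cases occurs: - If $\mathrm{sign}\,V=(1,0)$, then $N$ is an arbitrary positive integer, $\mathfrak m=\mathfrak n_N(\mathbb R)$, and $\mathfrak g=\mathfrak c_N(\mathbb R)$. - If $\mathrm{sign}\,V=(0,1)$, then $N$ is even, $\mathfrak m=\mathfrak n_{N/2}(\mathbb R)$, and $\mathfrak g=\mathfrak c_{N/2}(\mathbb R)$.
   Context: Let $V\neq0$ be a finite-dimensional real vector space with a nondegenerate, possibly indefinite, symmetric bilinear form $(\cdot,\cdot)$; its signature $(p,q)$ means $p$ positive and $q$ negative directions. The Clifford algebra $C\!\ell(V)$ has product satisfying $vu+uv=-2(v,u)\mathbf 1$ for $v,u\in V$. Let $W\ne0$ be a finite-dimensional $C\!\ell(V)$-module, with action written $c\cdot s$. $N\ge1$ denotes the number of irreducible $C\!\ell(V)$-components of $W$, counted with multiplicity. The Lie algebra $\mathfrak{so}(V)$ acts on $V$ in the defining way and on $W$ by the spin representation, i.e. the endomorphism $w\mapsto (v,w)u-(u,w)v$ acts on $W$ as $\frac14(vu-uv)\in C\!\ell(V)$ (for $\dim V=1$, $\mathfrak{so}(V)=0$). Let $\beta$ be a nondegenerate bilinear form on $W$ such that: (B1) $\beta$ is $\mathfrak{so}(V)$-invariant; (B2) $\beta$ is symmetric (put $\epsilon=-1$) or skew-symmetric (put $\epsilon=1$); (B3) $\beta(v\cdot s,t)=\epsilon\beta(s,v\cdot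 t)$ for all $v\in V$, $s,t\in W$. The (real) extended translation algebra $\mathfrak m=\mathfrak m(V,W,\beta)$ is the graded Lie algebra $\mathfrak m=\mathfrak m_{-2}+\mathfrak m_{-1}$, $\mathfrak m_{-2}=V$, $\mathfrak m_{-1}=W$, whose only nonzero bracket $W\times W\to V$ is given by $([s,t],v)=\beta(v\cdot s,t)$. The maximal transitive prolongation of $\mathfrak m$ is the (unique) graded Lie algebra $\mathfrak g=\sum_{p\in\mathbb Z}\mathfrak g_p$ such that (1) each $\mathfrak g_p$ is finite-dimensional; (2) the negatively graded part of $\mathfrak g$ is $\mathfrak m$ ($\mathfrak g_p=\mathfrak m_p$ for $p=-1,-2$ and $\mathfrak g_p=0$ for $p<-2$); (3) for all $p\ge0$, $X\in\mathfrak g_p$ with $[X,\mathfrak g_{-1}]=0$ implies $X=0$; (4) $\mathfrak g$ is maximal: any graded Lie algebra $\mathfrak g'$ satisfying (1)-(3) admits an injective graded Lie algebra homomorphism $\mathfrak g'\to\mathfrak g$. $\mathfrak c_\ell(\mathbb R)$ denotes the infinite-dimensional real contact algebra in dimension $2\ell+1$: the graded Lie algebra of polynomial vector fields on $\mathbb R^{2\ell+1}$ (coordinates $x_i,y_i,z$, $1\le i\le\ell$) preserving the contact distribution $\ker(dz-\sum_i y_i\,dx_i)$, graded by giving $x_i,y_i$ weight $1$, $z$ weight $2$, $\partial_{x_i},\partial_{y_i}$ weight $-1$ and $\partial_z$ weight $-2$. $\mathfrak n_\ell(\mathbb R)$ denotes its negatively graded part (the Heisenberg algebra of dimension $2\ell+1$,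 with one-dimensional degree $-2$ part). Equality means isomorphism of graded Lie algebras. "$N$ is an arbitrary positive integer" means that every positive integer occurs as a value of $N$. *)

theory Defs
  imports "HOL-Analysis.Analysis" "HOL-Library.Function_Algebras"
begin

text \<open>
  Vector spaces are linear subspaces of an ambient type of class real_vector, so that their
  dimension can vary inside a formula. Real-valued functions carry the pointwise structure.
\<close>

instantiation "fun" :: (type, scaleR) scaleR
begin

definition scaleR_fun :: "real \<Rightarrow> ('a \<Rightarrow> 'b) \<Rightarrow> 'a \<Rightarrow> 'b"
  where "scaleR_fun r f = (\<lambda>x. r *\<^sub>R f x)"

instance ..

end

instance "fun" :: (type, real_vector) real_vector
  by standard
    (simp_all add: scaleR_fun_def plus_fun_def fun_eq_iff scaleR_add_right scaleR_add_left)

definition fd_subspace :: "'a::real_vector set \<Rightarrow> bool"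
  where "fd_subspace S \<longleftrightarrow> (\<exists>B. finite B \<and> span B = S)"

definition bilinear_on ::
    "'a::real_vector set \<Rightarrow> 'b::real_vector set \<Rightarrow> ('a \<Rightarrow> 'b \<Rightarrow> 'c::real_vector) \<Rightarrow> bool"
  where "bilinear_on S T f \<longleftrightarrow>
    (\<forall>x\<in>S. \<forall>x'\<in>S. \<forall>y\<in>T. f (x + x') y = f x y + f x' y) \<and>
    (\<forall>x\<in>S. \<forall>y\<in>T. \<forall>y'\<in>T. f x (y + y') = f x y + f x y') \<and>
    (\<forall>r. \<forall>x\<in>S. \<forall>y\<in>T. f (r *\<^sub>R x) y = r *\<^sub>R f x y \<and> f x (r *\<^sub>R y) = r *\<^sub>R f x y)"

definition nondegenerate_on :: "'a::real_vector set \<Rightarrow> ('a \<Rightarrow> 'a \<Rightarrow> real) \<Rightarrow> bool"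
  where "nondegenerate_on S f \<longleftrightarrow>
    (\<forall>x\<in>S. (\<forall>y\<in>S. f x y = 0) \<longrightarrow> x = 0) \<and> (\<forall>y\<in>S. (\<forall>x\<in>S. f x y = 0) \<longrightarrow> y = 0)"

text \<open>Internal direct sum of a (possibly infinite) family of subspaces.\<close>

definition independent_family :: "'i set \<Rightarrow> ('i \<Rightarrow> 'a::real_vector set) \<Rightarrow> bool"
  where "independent_family I S \<longleftrightarrow>
    (\<forall>J x. finite J \<longrightarrow> J \<subseteq> I \<longrightarrow> (\<forall>i\<in>J. x i \<in> S i) \<longrightarrow> (\<Sum>i\<in>J. x i) = 0 \<longrightarrow> (\<forall>i\<in>J. x i = 0))"


section \<open>Clifford modules and extended translation algebras\<close>

definition pseudo_euclidean :: "'v::real_vector set \<Rightarrow> ('v \<Rightarrow> 'v \<Rightarrow> real) \<Rightarrow> bool"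
  where "pseudo_euclidean V b \<longleftrightarrow> fd_subspace V \<and> V \<noteq> {0} \<and> bilinear_on V V b \<and>
    (\<forall>v\<in>V. \<forall>u\<in>V. b v u = b u v) \<and> nondegenerate_on V b"

definition has_signature :: "'v::real_vector set \<Rightarrow> ('v \<Rightarrow> 'v \<Rightarrow> real) \<Rightarrow> nat \<times> nat \<Rightarrow> bool"
  where "has_signature V b pq \<longleftrightarrow> (\<exists>B. finite B \<and> independent B \<and> span B = V \<and>
    (\<forall>e\<in>B. \<forall>f\<in>B. e \<noteq> f \<longrightarrow> b e f = 0) \<and> (\<forall>e\<in>B. b e e \<noteq> 0) \<and>
    card {e\<in>B. b e e > 0} = fst pq \<and> card {e\<in>B. b e e < 0} = snd pq)"

text \<open>
  The Clifford algebra is the unital associative algebra generated by V subject to linearity in V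
  and to the relations vu + uv = -2(v,u)1. A module over it is therefore given by the action of
  the generators, c v s being the action of v on s; a submodule is a linear subspace stable under
  all v in V.
\<close>

definition clifford_module ::
    "'v::real_vector set \<Rightarrow> ('v \<Rightarrow> 'v \<Rightarrow> real) \<Rightarrow> 'w::real_vector set \<Rightarrow> ('v \<Rightarrow> 'w \<Rightarrow> 'w) \<Rightarrow> bool"
  where "clifford_module V b W c \<longleftrightarrow> subspace W \<and> bilinear_on V W c \<and>
    (\<forall>v\<in>V. \<forall>s\<in>W. c v s \<in> W) \<and>
    (\<forall>v\<in>V. \<forall>u\<in>V. \<forall>s\<in>W. c v (c u s) + c u (c v s) = (- 2 * b v u) *\<^sub>R s)"

definition clifford_submodule ::
    "'v set \<Rightarrow> ('v \<Rightarrow> 'w \<Rightarrow> 'w) \<Rightarrow> 'w::real_vector set \<Rightarrow> 'w set \<Rightarrow> bool"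
  where "clifford_submodule V c W S \<longleftrightarrow> subspace S \<and> S \<subseteq> W \<and> (\<forall>v\<in>V. \<forall>s\<in>S. c v s \<in> S)"

definition irreducible_submodule ::
    "'v set \<Rightarrow> ('v \<Rightarrow> 'w \<Rightarrow> 'w) \<Rightarrow> 'w::real_vector set \<Rightarrow> 'w set \<Rightarrow> bool"
  where "irreducible_submodule V c W S \<longleftrightarrow> clifford_submodule V c W S \<and> S \<noteq> {0} \<and>
    (\<forall>T. clifford_submodule V c W T \<longrightarrow> T \<subseteq> S \<longrightarrow> T = {0} \<or> T = S)"

definition num_irreducible_components ::
    "'v set \<Rightarrow> ('v \<Rightarrow> 'w \<Rightarrow> 'w) \<Rightarrow> 'w::real_vector set \<Rightarrow> nat"
  where "num_irreducible_components V c W = (THE n. \<exists>S :: nat \<Rightarrow> 'w set.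
    (\<forall>i<n. irreducible_submodule V c W (S i)) \<and> independent_family {..<n} S \<and>
    span (\<Union>i<n. S i) = W)"

text \<open>
  The endomorphisms w \<mapsto> (v,w)u - (u,w)v span so(V), and spin_act c v u is the action of such an
  endomorphism on W; so(V)-invariance of \<beta> thus amounts to invariance under all spin_act c v u.
\<close>

definition spin_act :: "('v \<Rightarrow> 'w \<Rightarrow> 'w::real_vector) \<Rightarrow> 'v \<Rightarrow> 'v \<Rightarrow> 'w \<Rightarrow> 'w"
  where "spin_act c v u s = (1/4) *\<^sub>R (c v (c u s) - c u (c v s))"

definition so_invariant ::
    "'v set \<Rightarrow> 'w::real_vector set \<Rightarrow> ('v \<Rightarrow> 'w \<Rightarrow> 'w) \<Rightarrow> ('w \<Rightarrow> 'w \<Rightarrow> real) \<Rightarrow> bool"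
  where "so_invariant V W c \<beta> \<longleftrightarrow> (\<forall>v\<in>V. \<forall>u\<in>V. \<forall>s\<in>W. \<forall>t\<in>W.
    \<beta> (spin_act c v u s) t + \<beta> s (spin_act c v u t) = 0)"

definition extended_translation_data ::
    "'v::real_vector set \<Rightarrow> ('v \<Rightarrow> 'v \<Rightarrow> real) \<Rightarrow> 'w::real_vector set \<Rightarrow>
     ('v \<Rightarrow> 'w \<Rightarrow> 'w) \<Rightarrow> ('w \<Rightarrow> 'w \<Rightarrow> real) \<Rightarrow> bool"
  where "extended_translation_data V b W c \<beta> \<longleftrightarrow>
    pseudo_euclidean V b \<and>
    fd_subspace W \<and> W \<noteq> {0} \<and> clifford_module V b W c \<and>
    bilinear_on W W \<beta> \<and> nondegenerate_on W \<beta> \<and>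
    so_invariant V W c \<beta> \<and>
    (\<exists>\<epsilon>. (\<epsilon> = -1 \<and> (\<forall>s\<in>W. \<forall>t\<in>W. \<beta> s t = \<beta> t s) \<or>
          \<epsilon> = 1 \<and> (\<forall>s\<in>W. \<forall>t\<in>W. \<beta> s t = - \<beta> t s)) \<and>
         (\<forall>v\<in>V. \<forall>s\<in>W. \<forall>t\<in>W. \<beta> (c v s) t = \<epsilon> * \<beta> s (c v t)))"


section \<open>Graded Lie algebras\<close>

record 'a graded_lie =
  grade :: "int \<Rightarrow> 'a set"
  lie_br :: "'a \<Rightarrow> 'a \<Rightarrow> 'a"

text \<open>The underlying space is the sum of the homogeneous components.\<close>

definition lie_space :: "'a::real_vector graded_lie \<Rightarrow> 'a set"
  where "lie_space L = span (\<Union>p. grade L p)"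

definition graded_lie_algebra :: "'a::real_vector graded_lie \<Rightarrow> bool"
  where "graded_lie_algebra L \<longleftrightarrow>
    (\<forall>p. subspace (grade L p)) \<and> independent_family UNIV (grade L) \<and>
    bilinear_on (lie_space L) (lie_space L) (lie_br L) \<and>
    (\<forall>x\<in>lie_space L. lie_br L x x = 0) \<and>
    (\<forall>x\<in>lie_space L. \<forall>y\<in>lie_space L. \<forall>z\<in>lie_space L.
      lie_br L x (lie_br L y z) + lie_br L y (lie_br L z x) + lie_br L z (lie_br L x y) = 0) \<and>
    (\<forall>p q. \<forall>x\<in>grade L p. \<forall>y\<in>grade L q. lie_br L x y \<in> grade L (p + q))"

text \<open>
  Morphisms are taken linear on the whole ambient types. This is no restriction, because every
  linear map on a subspace extends; only the values on lie_space L matter.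
\<close>

definition graded_lie_hom ::
    "'a::real_vector graded_lie \<Rightarrow> 'b::real_vector graded_lie \<Rightarrow> ('a \<Rightarrow> 'b) \<Rightarrow> bool"
  where "graded_lie_hom L M \<phi> \<longleftrightarrow> linear \<phi> \<and> (\<forall>p. \<phi> ` grade L p \<subseteq> grade M p) \<and>
    (\<forall>x\<in>lie_space L. \<forall>y\<in>lie_space L. \<phi> (lie_br L x y) = lie_br M (\<phi> x) (\<phi> y))"

definition graded_lie_iso ::
    "'a::real_vector graded_lie \<Rightarrow> 'b::real_vector graded_lie \<Rightarrow> bool"
  where "graded_lie_iso L M \<longleftrightarrow>
    (\<exists>\<phi>. graded_lie_hom L M \<phi> \<and> bij_betw \<phi> (lie_space L) (lie_space M))"

definition negative_part :: "'a::real_vector graded_lie \<Rightarrow> 'a graded_lie"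
  where "negative_part L = L\<lparr>grade := (\<lambda>p. if p < 0 then grade L p else {0})\<rparr>"

definition translation_bracket ::
    "'v set \<Rightarrow> ('v \<Rightarrow> 'v \<Rightarrow> real) \<Rightarrow> ('v \<Rightarrow> 'w \<Rightarrow> 'w) \<Rightarrow> ('w \<Rightarrow> 'w \<Rightarrow> real) \<Rightarrow> 'w \<Rightarrow> 'w \<Rightarrow> 'v"
  where "translation_bracket V b c \<beta> s t = (THE x. x \<in> V \<and> (\<forall>v\<in>V. b x v = \<beta> (c v s) t))"

definition extended_translation_algebra ::
    "'v::real_vector set \<Rightarrow> ('v \<Rightarrow> 'v \<Rightarrow> real) \<Rightarrow> 'w::real_vector set \<Rightarrow>
     ('v \<Rightarrow> 'w \<Rightarrow> 'w) \<Rightarrow> ('w \<Rightarrow> 'w \<Rightarrow> real) \<Rightarrow> ('v \<times> 'w) graded_lie"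
  where "extended_translation_algebra V b W c \<beta> =
    \<lparr>grade = (\<lambda>p. if p = -2 then V \<times> {0} else if p = -1 then {0} \<times> W else {0}),
     lie_br = (\<lambda>x y. (translation_bracket V b c \<beta> (snd x) (snd y), 0))\<rparr>"

definition transitive_prolongation ::
    "'m::real_vector graded_lie \<Rightarrow> 'a::real_vector graded_lie \<Rightarrow> bool"
  where "transitive_prolongation m g \<longleftrightarrow> graded_lie_algebra g \<and>
    (\<forall>p. fd_subspace (grade g p)) \<and>
    graded_lie_iso (negative_part g) m \<and>
    (\<forall>p\<ge>0. \<forall>X\<in>grade g p. (\<forall>y\<in>grade g (-1). lie_br g X y = 0) \<longrightarrow> X = 0)"

text \<open>
  HOL cannot quantify over the ambient type of the competing algebra g'. A graded Lie algebra with
  finite-dimensional components has countable dimension, hence is isomorphic to one whose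
  components are subspaces of nat \<Rightarrow> real; so nothing is lost by letting g' range over the latter.
\<close>

definition maximal_transitive_prolongation ::
    "'m::real_vector graded_lie \<Rightarrow> 'a::real_vector graded_lie \<Rightarrow> bool"
  where "maximal_transitive_prolongation m g \<longleftrightarrow> transitive_prolongation m g \<and>
    (\<forall>g' :: (nat \<Rightarrow> real) graded_lie. transitive_prolongation m g' \<longrightarrow>
      (\<exists>\<phi>. graded_lie_hom g' g \<phi> \<and> inj_on \<phi> (lie_space g')))"


section \<open>The contact algebra\<close>

text \<open>
  Functions on \<open>\<real>\<^sup>2\<^sup>l\<^sup>+\<^sup>1\<close> are represented by functions of points indexed by all coordinate
  labels which depend only on the coordinates in coords l. A vector field is the family of its
  coefficient functions: X j is the coefficient of \<partial>/\<partial>j.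
\<close>

datatype coord = Cx nat | Cy nat | Cz

definition coords :: "nat \<Rightarrow> coord set"
  where "coords l = Cx ` {..<l} \<union> Cy ` {..<l} \<union> {Cz}"

type_synonym point = "coord \<Rightarrow> real"
type_synonym vfield = "coord \<Rightarrow> point \<Rightarrow> real"

primrec weight :: "coord \<Rightarrow> nat"
  where "weight (Cx i) = 1" | "weight (Cy i) = 1" | "weight Cz = 2"

definition monomial_field :: "nat \<Rightarrow> (coord \<Rightarrow> nat) \<Rightarrow> coord \<Rightarrow> vfield"
  where "monomial_field l a i =
    (\<lambda>j p. if j = i then (\<Prod>k\<in>coords l. p k ^ a k) else 0)"

definition polynomial_fields :: "nat \<Rightarrow> vfield set"
  where "polynomial_fields l = span {monomial_field l a i | a i. i \<in> coords l}"

definition homogeneous_fields :: "nat \<Rightarrow> int \<Rightarrow> vfield set"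
  where "homogeneous_fields l d = span {monomial_field l a i | a i. i \<in> coords l \<and>
    int (\<Sum>k\<in>coords l. weight k * a k) - int (weight i) = d}"

definition partial_deriv :: "coord \<Rightarrow> (point \<Rightarrow> real) \<Rightarrow> point \<Rightarrow> real"
  where "partial_deriv i f p = deriv (\<lambda>t. f (p(i := t))) (p i)"

definition field_bracket :: "nat \<Rightarrow> vfield \<Rightarrow> vfield \<Rightarrow> vfield"
  where "field_bracket l X Y = (\<lambda>j p. \<Sum>i\<in>coords l.
    X i p * partial_deriv i (Y j) p - Y i p * partial_deriv i (X j) p)"

definition contact_form :: "nat \<Rightarrow> vfield \<Rightarrow> point \<Rightarrow> real"
  where "contact_form l X p = X Cz p - (\<Sum>i<l. p (Cy i) * X (Cx i) p)"

text \<open>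
  The contact distribution has a global frame of polynomial fields, so it is preserved by X as
  soon as bracketing with X maps its polynomial sections to sections.
\<close>

definition preserves_contact :: "nat \<Rightarrow> vfield \<Rightarrow> bool"
  where "preserves_contact l X \<longleftrightarrow> (\<forall>Y\<in>polynomial_fields l.
    (\<forall>p. contact_form l Y p = 0) \<longrightarrow> (\<forall>p. contact_form l (field_bracket l X Y) p = 0))"

definition contact_algebra :: "nat \<Rightarrow> vfield graded_lie"
  where "contact_algebra l =
    \<lparr>grade = (\<lambda>d. {X \<in> homogeneous_fields l d. preserves_contact l X}),
     lie_br = field_bracket l\<rparr>"

definition heisenberg_algebra :: "nat \<Rightarrow> vfield graded_lie"
  where "heisenberg_algebra l = negative_part (contact_algebra l)"

end

theory Submission
  imports Defs
begin

text \<open>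
  Let \<open>V\<close> be spanned by \<open>e\<close>. Whatever the symmetry of \<open>\<beta>\<close>, the form \<open>\<beta>(e \<cdot> s, t)\<close> on \<open>W\<close> is skew,
      and it is
  nondegenerate because \<open>e\<close> acts invertibly. Hence \<open>W\<close> is a symplectic space of some dimension
      \<open>2l\<close>, and
  a symplectic basis identifies \<open>m\<close> with the Heisenberg algebra \<open>n\<^sub>l\<close> (\<open>translation_line_basis\<close>). To
  find \<open>N\<close>, note that \<open>e\<close> squares to the scalar \<open>- b(e, e)\<close>. If \<open>b(e, e) > 0\<close>, the irreducible
  submodules are the planes spanned by \<open>s\<close> and \<open>e \<cdot> s\<close>,
      and \<open>2N = 2l\<close>. If \<open>b(e, e) < 0\<close>, they are the
  lines of eigenvectors, and \<open>N = 2l\<close> (\<open>num_irreducible_components_line\<close>).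

  It remains to see that \<open>c\<^sub>l\<close> is the maximal transitive prolongation of \<open>n\<^sub>l\<close>. In general, let
      \<open>c\<close> be
  transitive such that every derivation of degree \<open>p \<ge> 0\<close> from the negative part of \<open>c\<close> to \<open>c\<close> is
  bracketing with an element of \<open>c\<close>. Then each transitive \<open>g\<close> with the same negative part embeds
      into
  \<open>c\<close>: going up degree by degree, \<open>X\<close> acts on the negative part
      by a derivation, and its image is the
  unique element of \<open>c\<close> that induces it (\<open>transitive_embedding\<close>).

  For the contact algebra, a field is determined by its generating function \<open>f\<close>, the value of the
  contact form, and every weighted homogeneous polynomial \<open>f\<close> occurs (\<open>contact_grade_iff\<close>,
  \<open>contact_field_grade\<close>). Bracketing with the negative part becomes applying the translations
      \<open>\<partial>\<^sub>x\<close>, \<open>\<partial>\<^sub>y + x\<partial>\<^sub>z\<close>, \<open>\<partial>\<^sub>z\<close> to \<open>f\<close>. Thus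
  transitivity says that a polynomial of positive weight with vanishing derivatives is zero, and a
  derivation is a system of prescribed derivatives for an unknown \<open>f\<close>. Its solvability is the
  Poincare lemma, for which contraction with the weighted Euler field gives an explicit solution
  (\<open>closed_hom_form_exact\<close>, \<open>contact_derivations_inner\<close>).

  Finally, let \<open>g\<close> be any maximal transitive prolongation. It embeds into \<open>c\<^sub>l\<close>
      by the above, and a copy
  of \<open>c\<^sub>l\<close> embeds into it by maximality. The components are finite-dimensional, so the first
  embedding is an isomorphism (\<open>maximal_iso_contact\<close>). Every positive \<open>N\<close> occurs, for \<open>\<complex>\<^sup>N\<close> with its
  Euclidean inner product and \<open>e\<close> acting as \<open>\<i>\<close> (\<open>standard_translation_data\<close>).
\<close>

section \<open>Direct sums of subspaces\<close>

lemma independent_familyD: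
  assumes "independent_family I S" "finite J" "J \<subseteq> I" "\<And>i. i \<in> J \<Longrightarrow> x i \<in> S i"
    "(\<Sum>i\<in>J. x i) = 0" "i \<in> J"
  shows "x i = 0"
  using assms unfolding independent_family_def by blast

lemma independent_family_mono:
  assumes T: "independent_family I T" and sub: "\<And>i. S i \<subseteq> T i"
  shows "independent_family I S"
  unfolding independent_family_def
proof (intro allI impI ballI)
  fix J x k assume J: "finite J" "J \<subseteq> I" "\<forall>i\<in>J. x i \<in> S i" "sum x J = 0" and k: "k \<in> J"
  have "x i \<in> T i" if "i \<in> J" for i using J(3) sub that by blast
  then show "x k = 0" by (rule independent_familyD[OF T J(1,2) _ J(4) k])
qed

text \<open>
  A relation between eigenvectors is shortened by applying \<open>E\<close> and subtracting a multiple of the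
  relation that cancels one term.
\<close>

lemma independent_family_eigenspaces:
  fixes S :: "'i \<Rightarrow> 'a::real_vector set" and ev :: "'i \<Rightarrow> real"
  assumes E: "linear E" and sub: "\<And>i. i \<in> I \<Longrightarrow> subspace (S i)"
    and eig: "\<And>i x. i \<in> I \<Longrightarrow> x \<in> S i \<Longrightarrow> E x = ev i *\<^sub>R x" and inj: "inj_on ev I"
  shows "independent_family I S"
proof -
  have "finite J \<Longrightarrow> J \<subseteq> I \<Longrightarrow> (\<forall>i\<in>J. x i \<in> S i) \<Longrightarrow> (\<Sum>i\<in>J. x i) = 0 \<Longrightarrow> (\<forall>i\<in>J. x i = 0)"
    for J x
  proof (induction J arbitrary: x rule: finite_induct)
    case (insert k J)
    have sum0: "x k + (\<Sum>i\<in>J. x i) = 0" using insert by simp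
    have eig': "E (x i) = ev i *\<^sub>R x i" if "i \<in> insert k J" for i
      using insert.prems eig that by blast
    have "E (x k + (\<Sum>i\<in>J. x i)) = ev k *\<^sub>R x k + (\<Sum>i\<in>J. ev i *\<^sub>R x i)"
      using eig' by (simp add: linear_add[OF E] linear_sum[OF E])
    then have "ev k *\<^sub>R x k + (\<Sum>i\<in>J. ev i *\<^sub>R x i) = ev k *\<^sub>R (x k + (\<Sum>i\<in>J. x i))"
      using sum0 linear_0[OF E] by simp
    then have "(\<Sum>i\<in>J. (ev i - ev k) *\<^sub>R x i) = 0"
      by (simp add: scaleR_diff_left sum_subtractf scaleR_add_right scaleR_sum_right)
    then have "\<forall>i\<in>J. (ev i - ev k) *\<^sub>R x i = 0"
      using insert sub by (intro insert.IH) (auto intro!: subspace_scale)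
    moreover have "ev i \<noteq> ev k" if "i \<in> J" for i
      using that insert.hyps insert.prems inj by (auto dest: inj_onD)
    ultimately have *: "\<forall>i\<in>J. x i = 0" by auto
    then have "x k = 0" using sum0 by simp
    with * show ?case by simp
  qed simp
  then show ?thesis unfolding independent_family_def by blast
qed

lemma span_UN_decomposition:
  assumes sub: "\<And>i. subspace (S i)" and x: "x \<in> span (\<Union>i. S i)"
  obtains J y where "finite J" "\<And>i. y i \<in> S i" "x = (\<Sum>i\<in>J. y i)"
proof -
  let ?P = "\<lambda>x. \<exists>J y. finite J \<and> (\<forall>i. y i \<in> S i) \<and> (\<forall>i. i \<notin> J \<longrightarrow> y i = 0) \<and> x = (\<Sum>i\<in>J. y i)"
  have "?P x" using x
  proof (induction rule: span_induct_alt)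
    case base
    show ?case by (rule exI[of _ "{}"], rule exI[of _ "\<lambda>_. 0"]) (auto simp: subspace_0 sub)
  next
    case (step r a x)
    then obtain k J y where k: "a \<in> S k" and J: "finite J" "\<forall>i. y i \<in> S i"
      "\<forall>i. i \<notin> J \<longrightarrow> y i = 0" "x = (\<Sum>i\<in>J. y i)" by auto
    let ?y = "y(k := r *\<^sub>R a + y k)"
    have "x = (\<Sum>i\<in>insert k J. y i)"
      unfolding J(4) by (rule sum.mono_neutral_left) (use J in auto)
    also have "\<dots> = y k + (\<Sum>i\<in>insert k J - {k}. y i)"
      using J(1) by (simp add: sum.insert_remove)
    finally have "r *\<^sub>R a + x = (\<Sum>i\<in>insert k J. ?y i)"
      using J(1) by (subst sum.remove[of _ k]) (auto simp: algebra_simps intro!: sum.cong)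
    moreover have "\<forall>i. ?y i \<in> S i"
      using J(2) k sub by (auto intro!: subspace_add subspace_scale)
    ultimately show ?case using J
      by (intro exI[of _ "insert k J"] exI[of _ ?y]) auto
  qed
  then show thesis using that by blast
qed

text \<open>
  The graphs of the given maps span the graph of the desired one. Independence makes the first
  projection injective on this span; a linear section of it, followed by the second projection, is
  defined on the whole ambient space.
\<close>

lemma linear_extension_of_family:
  fixes S :: "'i \<Rightarrow> 'a::real_vector set" and f :: "'i \<Rightarrow> 'a \<Rightarrow> 'b::real_vector"
  assumes ind: "independent_family UNIV S" and sub: "\<And>i. subspace (S i)"
    and add: "\<And>i x y. x \<in> S i \<Longrightarrow> y \<in> S i \<Longrightarrow> f i (x + y) = f i x + f i y"
    and scale: "\<And>i r x. x \<in> S i \<Longrightarrow> f i (r *\<^sub>R x) = r *\<^sub>R f i x"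
  obtains \<phi> where "linear \<phi>" "\<And>i x. x \<in> S i \<Longrightarrow> \<phi> x = f i x"
proof -
  define T where "T i = (\<lambda>x. (x, f i x)) ` S i" for i
  have f0: "f i 0 = 0" for i using scale[of 0 i 0] sub by (simp add: subspace_0)
  have T: "subspace (T i)" for i
    unfolding subspace_def T_def
    using sub[of i] f0[of i]
    by (auto simp: zero_prod_def image_iff subspace_0 subspace_add subspace_scale add scale)
  define G where "G = span (\<Union>i. T i)"
  have "inj_on fst G"
  proof (subst linear_inj_on_iff_eq_0)
    show "linear (fst :: 'a \<times> 'b \<Rightarrow> 'a)" by (rule linear_fst)
    show "subspace G" unfolding G_def by simp
    show "\<forall>x\<in>G. fst x = 0 \<longrightarrow> x = 0"
    proof (intro ballI impI)
      fix w assume w: "w \<in> G" "fst w = 0"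
      obtain J y where J: "finite J" "\<And>i. y i \<in> T i" "w = (\<Sum>i\<in>J. y i)"
        using w(1)[unfolded G_def] by (rule span_UN_decomposition[OF T]) blast
      have y: "fst (y i) \<in> S i" "y i = (fst (y i), f i (fst (y i)))" for i
        using J(2)[of i] unfolding T_def by auto
      have "(\<Sum>i\<in>J. fst (y i)) = 0" using w(2) J(3) by (simp add: fst_sum)
      then have "fst (y i) = 0" if "i \<in> J" for i
        using independent_familyD[OF ind J(1) _ y(1)] that by auto
      then have "y i = 0" if "i \<in> J" for i
        using y(2)[of i] f0[of i] that by (simp add: zero_prod_def)
      then show "w = 0" using J(3) by simp
    qed
  qed
  then obtain h where h: "linear h" "\<forall>w\<in>G. h (fst w) = w"
    using linear_exists_left_inverse_on[of fst G] linear_fst unfolding G_def by auto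
  have "(snd \<circ> h) x = f i x" if "x \<in> S i" for i x
  proof -
    have "(x, f i x) \<in> G" unfolding G_def T_def using that by (auto intro: span_base)
    then show ?thesis using h(2) by force
  qed
  moreover have "linear (snd \<circ> h)" by (intro linear_compose h linear_snd)
  ultimately show thesis using that by blast
qed

lemma fd_subspace_basis:
  assumes "fd_subspace S"
  obtains B where "finite B" "independent B" "span B = S" "B \<subseteq> S"
proof -
  obtain C where C: "finite C" "span C = S" using assms unfolding fd_subspace_def by auto
  obtain B where B: "B \<subseteq> S" "independent B" "S \<subseteq> span B"
    using maximal_independent_subset[of S] by auto
  have "finite B" using independent_span_bound[OF C(1) B(2)] B(1) C(2) by auto
  moreover have "span B = S" using B C span_minimal[of B S] by (metis subset_antisym subspace_span)
  ultimately show thesis using that B by auto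
qed

lemma fd_subspace_imp_subspace: "fd_subspace S \<Longrightarrow> subspace S"
  unfolding fd_subspace_def by auto

lemma fd_subspace_subset:
  assumes "fd_subspace T" "S \<subseteq> T" "subspace S"
  shows "fd_subspace S"
proof -
  obtain C where C: "finite C" "span C = T" using assms unfolding fd_subspace_def by auto
  obtain B where B: "B \<subseteq> S" "independent B" "S \<subseteq> span B"
    using maximal_independent_subset[of S] by auto
  have "finite B" using independent_span_bound[OF C(1) B(2)] B(1) C(2) assms(2) by auto
  moreover have "span B = S" using B assms(3) by (metis span_minimal subset_antisym)
  ultimately show ?thesis unfolding fd_subspace_def by auto
qed

lemma dim_le_of_inj:
  assumes T: "fd_subspace T" and f: "linear f" "inj_on f S" "f ` S \<subseteq> T" and S: "subspace S"
  shows "dim S \<le> dim T"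
    and "dim T \<le> dim S \<Longrightarrow> f ` S = T"
proof -
  obtain B where B: "B \<subseteq> S" "independent B" "S \<subseteq> span B" "card B = dim S"
    using basis_exists by blast
  have SB: "span B = S" using B S by (metis span_minimal subset_antisym)
  obtain C where C: "finite C" "independent C" "span C = T" "C \<subseteq> T"
    by (rule fd_subspace_basis[OF T])
  have dT: "dim T = card C" using C dim_span_eq_card_independent by metis
  have ind: "independent (f ` B)"
    using linear_independent_injective_image[of f B] B f SB by auto
  have inB: "inj_on f B" using f(2) B(1) inj_on_subset by blast
  have fin: "finite (f ` B)" and le: "card (f ` B) \<le> card C"
    using independent_span_bound[OF C(1) ind] B(1) f(3) C(3) by auto
  then show "dim S \<le> dim T" using dT B(4) card_image[OF inB] by simp
  assume "dim T \<le> dim S"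
  then have eq: "card (f ` B) = card C" using le dT B(4) card_image[OF inB] by simp
  have "f ` S = span (f ` B)" using SB linear_span_image[OF f(1)] by metis
  moreover have "T \<subseteq> span (f ` B)"
  proof (rule ccontr)
    assume "\<not> T \<subseteq> span (f ` B)"
    then obtain x where x: "x \<in> T" "x \<notin> span (f ` B)" by auto
    have "independent (insert x (f ` B))" using x ind by (simp add: independent_insert)
    moreover have "insert x (f ` B) \<subseteq> span C" using x B(1) f(3) C(3) by auto
    ultimately have "card (insert x (f ` B)) \<le> card C" using independent_span_bound[OF C(1)]
        by blast
    moreover have "x \<notin> f ` B" using x(2) by (auto intro: span_base)
    ultimately show False using eq fin by simp
  qed
  ultimately show "f ` S = T" using f(3) by auto
qed

section \<open>Graded Lie algebras\<close>

lemma bilinear_onD: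
  assumes "bilinear_on S T f"
  shows "x \<in> S \<Longrightarrow> x' \<in> S \<Longrightarrow> y \<in> T \<Longrightarrow> f (x + x') y = f x y + f x' y"
    and "x \<in> S \<Longrightarrow> y \<in> T \<Longrightarrow> y' \<in> T \<Longrightarrow> f x (y + y') = f x y + f x y'"
    and "x \<in> S \<Longrightarrow> y \<in> T \<Longrightarrow> f (r *\<^sub>R x) y = r *\<^sub>R f x y"
    and "x \<in> S \<Longrightarrow> y \<in> T \<Longrightarrow> f x (r *\<^sub>R y) = r *\<^sub>R f x y"
  using assms unfolding bilinear_on_def by blast+

lemma bilinear_on_subset: "bilinear_on S T f \<Longrightarrow> S' \<subseteq> S \<Longrightarrow> T' \<subseteq> T \<Longrightarrow> bilinear_on S' T' f"
  unfolding bilinear_on_def by blast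

lemma bilinear_on_linear_comp: "bilinear_on S T f \<Longrightarrow> linear h \<Longrightarrow> bilinear_on S T (\<lambda>x y. h (f x y))"
  unfolding bilinear_on_def by (simp add: linear_add linear_scale)

lemma bilinear_on_comp_linear:
  assumes "bilinear_on S T f" "linear h" "h ` S' \<subseteq> S" "h ` T' \<subseteq> T"
  shows "bilinear_on S' T' (\<lambda>x y. f (h x) (h y))"
proof -
  have "\<And>x. x \<in> S' \<Longrightarrow> h x \<in> S" "\<And>x. x \<in> T' \<Longrightarrow> h x \<in> T" using assms(3,4) by auto
  then show ?thesis using assms(1,2) unfolding bilinear_on_def
      by (simp add: linear_add linear_scale)
qed

lemma bilinear_on_zero:
  assumes "bilinear_on S T f" "subspace S" "subspace T"
  shows "y \<in> T \<Longrightarrow> f 0 y = 0" and "x \<in> S \<Longrightarrow> f x 0 = 0"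
  using bilinear_onD(3)[OF assms(1), of 0 y 0] bilinear_onD(4)[OF assms(1), of x 0 0] assms(2,3)
  by (auto simp: subspace_0)

lemma bilinear_on_span_closed:
  assumes f: "bilinear_on (span A) (span B) f" and S: "subspace S"
    and base: "\<And>a b. a \<in> A \<Longrightarrow> b \<in> B \<Longrightarrow> f a b \<in> S"
    and x: "x \<in> span A" and y: "y \<in> span B"
  shows "f x y \<in> S"
proof -
  note closed = span_0 span_add span_scale subspace_0[OF S] subspace_add[OF S] subspace_scale[OF S]
  have 1: "f a y \<in> S" if a: "a \<in> A" for a
  proof -
    have "subspace {y \<in> span B. f a y \<in> S}"
      unfolding subspace_def
      using bilinear_on_zero(2)[OF f] bilinear_onD(2,4)[OF f span_base[OF a]] span_base[OF a]
      by (simp add: closed)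
    then have "span B \<subseteq> {y \<in> span B. f a y \<in> S}"
      using base[OF a] by (intro span_minimal) (auto intro: span_base)
    with y show ?thesis by blast
  qed
  have "subspace {x \<in> span A. f x y \<in> S}"
    unfolding subspace_def using bilinear_on_zero(1)[OF f] bilinear_onD(1,3)[OF f] y
    by (simp add: closed)
  then have "span A \<subseteq> {x \<in> span A. f x y \<in> S}"
    using 1 by (intro span_minimal) (auto intro: span_base)
  with x show ?thesis by blast
qed

lemma bilinear_on_eqI:
  assumes f: "bilinear_on (span A) (span B) f" and g: "bilinear_on (span A) (span B) g"
    and eq: "\<And>a b. a \<in> A \<Longrightarrow> b \<in> B \<Longrightarrow> f a b = g a b"
    and x: "x \<in> span A" and y: "y \<in> span B"
  shows "f x y = g x y"
proof -
  have "bilinear_on (span A) (span B) (\<lambda>x y. f x y - g x y)"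
    using f g unfolding bilinear_on_def by (simp add: algebra_simps)
  from bilinear_on_span_closed[OF this, of "{0}", OF _ _ x y] eq show ?thesis by simp
qed

lemma graded_lie_algebraD:
  assumes "graded_lie_algebra L"
  shows "subspace (grade L p)" and "independent_family UNIV (grade L)"
    and "bilinear_on (lie_space L) (lie_space L) (lie_br L)"
    and "x \<in> lie_space L \<Longrightarrow> lie_br L x x = 0"
    and "x \<in> lie_space L \<Longrightarrow> y \<in> lie_space L \<Longrightarrow> z \<in> lie_space L \<Longrightarrow>
      lie_br L x (lie_br L y z) + lie_br L y (lie_br L z x) + lie_br L z (lie_br L x y) = 0"
    and "x \<in> grade L p \<Longrightarrow> y \<in> grade L q \<Longrightarrow> lie_br L x y \<in> grade L (p + q)"
  using assms unfolding graded_lie_algebra_def by blast+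

lemma grade_subset_lie_space: "x \<in> grade L p \<Longrightarrow> x \<in> lie_space L"
  unfolding lie_space_def by (auto intro: span_base)

lemma subspace_lie_space [simp]: "subspace (lie_space L)"
  unfolding lie_space_def by simp

lemma lie_br_closed:
  assumes L: "graded_lie_algebra L" and "x \<in> lie_space L" "y \<in> lie_space L"
  shows "lie_br L x y \<in> lie_space L"
proof -
  have "lie_br L a b \<in> lie_space L" if "a \<in> (\<Union>p. grade L p)" "b \<in> (\<Union>p. grade L p)" for a b
    using that graded_lie_algebraD(6)[OF L] grade_subset_lie_space by blast
  then show ?thesis
    using bilinear_on_span_closed[OF graded_lie_algebraD(3)[OF L, unfolded lie_space_def]
        subspace_lie_space] assms(2,3) unfolding lie_space_def by blast
qed

lemma lie_br_skew:
  assumes L: "graded_lie_algebra L" and x: "x \<in> lie_space L" and y: "y \<in> lie_space L"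
  shows "lie_br L x y = - lie_br L y x"
proof -
  note bil = bilinear_onD[OF graded_lie_algebraD(3)[OF L]]
  have xy: "x + y \<in> lie_space L" using x y by (simp add: subspace_add)
  have "0 = lie_br L (x + y) (x + y)" using graded_lie_algebraD(4)[OF L xy] by simp
  also have "\<dots> = lie_br L x y + lie_br L y x"
    using graded_lie_algebraD(4)[OF L x] graded_lie_algebraD(4)[OF L y]
    by (simp add: bil(1)[OF x y xy] bil(2)[OF x x y] bil(2)[OF y x y])
  finally show ?thesis by (simp add: eq_neg_iff_add_eq_0)
qed

lemma lie_br_minus:
  assumes L: "graded_lie_algebra L" and x: "x \<in> lie_space L" and y: "y \<in> lie_space L"
  shows "lie_br L x (- y) = - lie_br L x y" "lie_br L (- x) y = - lie_br L x y"
  using bilinear_onD(4)[OF graded_lie_algebraD(3)[OF L] x y, of "-1"]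
    bilinear_onD(3)[OF graded_lie_algebraD(3)[OF L] x y, of "-1"] by simp_all

lemma lie_br_diff:
  assumes L: "graded_lie_algebra L" and "x \<in> lie_space L" "x' \<in> lie_space L" "y \<in> lie_space L"
  shows "lie_br L (x - x') y = lie_br L x y - lie_br L x' y"
  using bilinear_onD(1)[OF graded_lie_algebraD(3)[OF L], of x
      "- x'" y] lie_br_minus(2)[OF L, of x' y]
    assms by (simp add: subspace_neg)

lemma lie_br_derivation:
  assumes L: "graded_lie_algebra L" and x: "x \<in> lie_space L" and y: "y \<in> lie_space L"
      and z: "z \<in> lie_space L"
  shows "lie_br L x (lie_br L y z) = lie_br L (lie_br L x y) z + lie_br L y (lie_br L x z)"
proof -
  have "lie_br L y (lie_br L z x) = - lie_br L y (lie_br L x z)"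
    using lie_br_skew[OF L z x] lie_br_minus(1)[OF L y lie_br_closed[OF L x z]] by simp
  moreover have "lie_br L z (lie_br L x y) = - lie_br L (lie_br L x y) z"
    by (rule lie_br_skew[OF L z lie_br_closed[OF L x y]])
  ultimately show ?thesis
    using graded_lie_algebraD(5)[OF L x y z] by (simp add: algebra_simps)
qed

lemma lie_space_decomposition:
  assumes "graded_lie_algebra L" "x \<in> lie_space L"
  obtains J y where "finite J" "\<And>p. y p \<in> grade L p" "x = (\<Sum>p\<in>J. y p)"
  using assms(2)[unfolded lie_space_def]
  by (rule span_UN_decomposition[OF graded_lie_algebraD(1)[OF assms(1)]]) (rule that)

text \<open>
  Images of homogeneous components of different degrees cannot cancel. So an element whose image is
  homogeneous of degree \<open>q\<close> may be replaced by its component of degree \<open>q\<close>. This gives surjectivity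
  in each degree from surjectivity on the whole space,
      and injectivity from injectivity in each degree.
\<close>

lemma homogeneous_preimage:
  assumes L: "graded_lie_algebra L" and M: "independent_family UNIV (grade M)"
      "\<And>p. subspace (grade M p)"
    and \<phi>: "linear \<phi>" "\<And>p. \<phi> ` grade L p \<subseteq> grade M p" and x: "x \<in> lie_space L" "\<phi> x \<in> grade M q"
  obtains y where "y \<in> grade L q" "\<phi> y = \<phi> x"
    "(\<And>p z. p \<noteq> q \<Longrightarrow> z \<in> grade L p \<Longrightarrow> \<phi> z = 0 \<Longrightarrow> z = 0) \<Longrightarrow> y = x"
proof -
  obtain J y where J: "finite J" "\<And>p. y p \<in> grade L p" "x = (\<Sum>p\<in>J. y p)"
    by (rule lie_space_decomposition[OF L x(1)]) blast
  define u where "u p = (if p \<in> J then \<phi> (y p) else 0) - (if p = q then \<phi> x else 0)" for p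
  have "u p \<in> grade M p" for p
  proof -
    have "\<phi> (y p) \<in> grade M p" using J(2) \<phi>(2) by blast
    then show ?thesis unfolding u_def
      by (intro subspace_diff M(2)) (auto simp: subspace_0 M(2) x(2))
  qed
  moreover have "(\<Sum>p\<in>insert q J. u p) = 0"
  proof -
    have "(\<Sum>p\<in>insert q J. (if p \<in> J then \<phi> (y p) else 0)) = (\<Sum>p\<in>J. \<phi> (y p))"
      by (rule sum.mono_neutral_cong_right) (use J(1) in auto)
    moreover have "(\<Sum>p\<in>insert q J. (if p = q then \<phi> x else 0)) = \<phi> x"
      using J(1) by (subst sum.delta) auto
    ultimately show ?thesis
      unfolding u_def sum_subtractf using J(3) by (simp add: linear_sum[OF \<phi>(1)])
  qed
  ultimately have u0: "u p = 0" if "p \<in> insert q J" for p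
    using independent_familyD[OF M(1), of "insert q J" u p] that J(1) by auto
  define w where "w = (if q \<in> J then y q else 0)"
  have w: "w \<in> grade L q" unfolding w_def using J(2) graded_lie_algebraD(1)[OF L]
      by (simp add: subspace_0)
  have 1: "\<phi> w = \<phi> x" using u0[of q] unfolding u_def w_def
    by (auto simp: linear_0[OF \<phi>(1)] split: if_splits)
  have "w = x" if "\<And>p z. p \<noteq> q \<Longrightarrow> z \<in> grade L p \<Longrightarrow> \<phi> z = 0 \<Longrightarrow> z = 0"
  proof -
    have "y p = 0" if "p \<in> J" "p \<noteq> q" for p
      using u0[of p] that J(2) \<open>\<And>p z. p \<noteq> q \<Longrightarrow> z \<in> grade L p \<Longrightarrow> \<phi> z = 0 \<Longrightarrow> z = 0\<close>
      unfolding u_def by auto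
    then have "x = (\<Sum>p\<in>J. if p = q then y p else 0)"
      unfolding J(3) by (intro sum.cong) auto
    then show ?thesis unfolding w_def using J(1) by (simp add: sum.delta)
  qed
  with w 1 show thesis using that by blast
qed

lemma graded_linear_map_inj:
  assumes L: "graded_lie_algebra L" and M: "independent_family UNIV (grade M)"
      "\<And>p. subspace (grade M p)"
    and \<phi>: "linear \<phi>" "\<And>p. \<phi> ` grade L p \<subseteq> grade M p"
    and inj: "\<And>p x. x \<in> grade L p \<Longrightarrow> \<phi> x = 0 \<Longrightarrow> x = 0"
  shows "inj_on \<phi> (lie_space L)"
  unfolding linear_inj_on_iff_eq_0[OF \<phi>(1) subspace_lie_space]
proof (intro ballI impI)
  fix x assume x: "x \<in> lie_space L" "\<phi> x = 0"
  then have "\<phi> x \<in> grade M 0" using M(2) by (simp add: subspace_0)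
  then obtain y where "y \<in> grade L 0" "\<phi> y = \<phi> x"
    "(\<And>p z. p \<noteq> 0 \<Longrightarrow> z \<in> grade L p \<Longrightarrow> \<phi> z = 0 \<Longrightarrow> z = 0) \<Longrightarrow> y = x"
    by (rule homogeneous_preimage[OF L M \<phi> x(1)]) blast
  then show "x = 0" using inj x(2) by metis
qed

lemma lie_space_image:
  assumes "linear \<phi>" "\<And>p. \<phi> ` grade L p = grade M p"
  shows "\<phi> ` lie_space L = lie_space M"
  unfolding lie_space_def linear_span_image[OF assms(1), symmetric] image_UN assms(2) ..

text \<open>
  Compatibility with brackets is bilinear, hence a matter of generators of the vector space.
\<close>

lemma graded_lie_homI:
  assumes L: "graded_lie_algebra L" and M: "bilinear_on (lie_space M) (lie_space M) (lie_br M)"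
    and \<phi>: "linear \<phi>" "\<And>p. \<phi> ` grade L p \<subseteq> grade M p"
    and G: "span G = lie_space L"
    and br: "\<And>x y. x \<in> G \<Longrightarrow> y \<in> G \<Longrightarrow> \<phi> (lie_br L x y) = lie_br M (\<phi> x) (\<phi> y)"
  shows "graded_lie_hom L M \<phi>"
proof -
  have "\<phi> ` lie_space L \<subseteq> lie_space M"
    unfolding lie_space_def linear_span_image[OF \<phi>(1), symmetric]
    by (rule span_mono) (use \<phi>(2) in auto)
  then have b: "bilinear_on (span G) (span G) (\<lambda>x y. lie_br M (\<phi> x) (\<phi> y))"
    unfolding G by (intro bilinear_on_comp_linear[OF M \<phi>(1)])
  have a: "bilinear_on (span G) (span G) (\<lambda>x y. \<phi> (lie_br L x y))"
    unfolding G by (intro bilinear_on_linear_comp[OF _ \<phi>(1)] graded_lie_algebraD L)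
  show ?thesis unfolding graded_lie_hom_def
    using \<phi> bilinear_on_eqI[OF a b br] unfolding G by blast
qed

text \<open>
  A morphism only maps components into components; for a bijective one, nothing is missed in any
  degree by \<open>homogeneous_preimage\<close>.
\<close>

lemma graded_lie_isoE:
  assumes iso: "graded_lie_iso L M" and L: "graded_lie_algebra L"
    and M: "independent_family UNIV (grade M)" "\<And>p. subspace (grade M p)"
  obtains \<phi> where "graded_lie_hom L M \<phi>" "inj_on \<phi> (lie_space L)" "\<And>p. \<phi> ` grade L p = grade M p"
proof -
  obtain \<phi> where \<phi>: "graded_lie_hom L M \<phi>" "bij_betw \<phi> (lie_space L) (lie_space M)"
    using iso unfolding graded_lie_iso_def by auto
  then have h: "linear \<phi>" "\<And>p. \<phi> ` grade L p \<subseteq> grade M p" and inj: "inj_on \<phi> (lie_space L)"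
    unfolding graded_lie_hom_def bij_betw_def by auto
  have "grade M q \<subseteq> \<phi> ` grade L q" for q
  proof
    fix w assume w: "w \<in> grade M q"
    then have "w \<in> \<phi> ` lie_space L"
      using \<phi>(2) grade_subset_lie_space unfolding bij_betw_def by blast
    then obtain x where x: "x \<in> lie_space L" "w = \<phi> x" by auto
    then have "\<phi> x \<in> grade M q" using w by simp
    then obtain y where "y \<in> grade L q" "\<phi> y = \<phi> x"
      by (rule homogeneous_preimage[OF L M h x(1)]) blast
    then show "w \<in> \<phi> ` grade L q" using x by (metis image_eqI)
  qed
  then have "\<phi> ` grade L p = grade M p" for p using h(2) by blast
  then show thesis using that \<phi>(1) inj by blast
qed

lemma graded_lie_isoI:
  assumes "graded_lie_hom L M \<phi>" "inj_on \<phi> (lie_space L)" "\<And>p. \<phi> ` grade L p = grade M p"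
  shows "graded_lie_iso L M"
  unfolding graded_lie_iso_def bij_betw_def
  using assms lie_space_image[of \<phi> L M] unfolding graded_lie_hom_def by blast

lemma graded_lie_iso_inverse:
  assumes \<phi>: "graded_lie_hom L M \<phi>" "inj_on \<phi> (lie_space L)" "\<And>p. \<phi> ` grade L p = grade M p"
    and L: "graded_lie_algebra L"
  shows "graded_lie_iso M L"
proof -
  have lin: "linear \<phi>" using \<phi>(1) unfolding graded_lie_hom_def by blast
  obtain h where h: "linear h" "\<forall>v\<in>lie_space L. h (\<phi> v) = v"
    using linear_exists_left_inverse_on[OF lin subspace_lie_space \<phi>(2)] by auto
  have img: "\<phi> ` lie_space L = lie_space M" by (rule lie_space_image[OF lin \<phi>(3)])
  have g: "h ` grade M p = grade L p" for p
    unfolding \<phi>(3)[symmetric] image_image using h(2) grade_subset_lie_space by force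
  have "h (lie_br M x y) = lie_br L (h x) (h y)" if xy: "x \<in> lie_space M" "y \<in> lie_space M" for x y
  proof -
    obtain x' y' where "x' \<in> lie_space L" "y' \<in> lie_space L" "x = \<phi> x'" "y = \<phi> y'"
      using xy unfolding img[symmetric] by blast
    then show ?thesis using \<phi>(1) h(2) lie_br_closed[OF L] unfolding graded_lie_hom_def by metis
  qed
  then have "graded_lie_hom M L h" unfolding graded_lie_hom_def using h(1) g by auto
  moreover have "inj_on h (lie_space M)"
    unfolding img[symmetric] by (rule inj_on_inverseI[where g=\<phi>]) (use h(2) in auto)
  ultimately show ?thesis using graded_lie_isoI g by blast
qed

lemma graded_lie_iso_trans:
  assumes "graded_lie_iso L M" "graded_lie_iso M K"
  shows "graded_lie_iso L K"
proof -
  obtain f where f: "graded_lie_hom L M f" "bij_betw f (lie_space L) (lie_space M)"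
    using assms(1) unfolding graded_lie_iso_def by blast
  obtain g where g: "graded_lie_hom M K g" "bij_betw g (lie_space M) (lie_space K)"
    using assms(2) unfolding graded_lie_iso_def by blast
  have "f x \<in> lie_space M" if "x \<in> lie_space L" for x using f(2) that unfolding bij_betw_def by auto
  moreover have "linear (g \<circ> f)"
    using f(1) g(1) linear_compose[of f g] unfolding graded_lie_hom_def by simp
  ultimately have "graded_lie_hom L K (g \<circ> f)"
    using f(1) g(1) unfolding graded_lie_hom_def by (auto simp: image_subset_iff)
  then show ?thesis unfolding graded_lie_iso_def using bij_betw_trans[OF f(2) g(2)] by blast
qed

lemma negative_part_simps [simp]:
  "grade (negative_part L) p = (if p < 0 then grade L p else {0})"
  "lie_br (negative_part L) = lie_br L"
  by (simp_all add: negative_part_def)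

lemma lie_space_negative_part_subset: "lie_space (negative_part L) \<subseteq> lie_space L"
  unfolding lie_space_def by (intro span_minimal)
      (auto intro: span_base simp: span_0 split: if_splits)

lemma graded_lie_algebra_negative_part:
  assumes L: "graded_lie_algebra L"
  shows "graded_lie_algebra (negative_part L)"
proof -
  note sub = lie_space_negative_part_subset[of L]
  have 1: "subspace (grade (negative_part L) p)" for p
    using graded_lie_algebraD(1)[OF L] by simp
  have "grade (negative_part L) p \<subseteq> grade L p" for p
    using graded_lie_algebraD(1)[OF L] by (simp add: subspace_0)
  then have 2: "independent_family UNIV (grade (negative_part L))"
    by (rule independent_family_mono[OF graded_lie_algebraD(2)[OF L]])
  have 3: "lie_br L x y \<in> grade (negative_part L) (p + q)"
    if "x \<in> grade (negative_part L) p" "y \<in> grade (negative_part L) q" for x y p q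
    using that graded_lie_algebraD(6)[OF L, of x p y q]
      bilinear_on_zero[OF graded_lie_algebraD(3)[OF L]] graded_lie_algebraD(1)[OF L]
    by (auto split: if_splits simp: grade_subset_lie_space subspace_0)
  show ?thesis
    unfolding graded_lie_algebra_def
    using 1 2 3 sub bilinear_on_subset[OF graded_lie_algebraD(3)[OF L] sub sub]
      graded_lie_algebraD(4,5)[OF L] by (auto simp: subset_iff)
qed

section \<open>Universality of a transitive algebra whose negative derivations are inner\<close>

definition transitive_grading :: "'a::real_vector graded_lie \<Rightarrow> bool"
  where "transitive_grading L \<longleftrightarrow>
    (\<forall>p\<ge>0. \<forall>X\<in>grade L p. (\<forall>y\<in>grade L (-1). lie_br L X y = 0) \<longrightarrow> X = 0)"

text \<open>
  This is the vanishing, in degrees \<open>p \<ge> 0\<close>, of the first cohomology of the negative part with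
  coefficients in the whole algebra.
\<close>

definition negative_derivations_inner :: "'a::real_vector graded_lie \<Rightarrow> bool"
  where "negative_derivations_inner L \<longleftrightarrow> (\<forall>p\<ge>0. \<forall>d. linear d \<longrightarrow>
    (\<forall>q<0. \<forall>u\<in>grade L q. d u \<in> grade L (p + q)) \<longrightarrow>
    (\<forall>q<0. \<forall>r<0. \<forall>u\<in>grade L q. \<forall>v\<in>grade L r.
       d (lie_br L u v) = lie_br L (d u) v + lie_br L u (d v)) \<longrightarrow>
    (\<exists>Y\<in>grade L p. \<forall>q<0. \<forall>u\<in>grade L q. lie_br L Y u = d u))"

text \<open>
  The map \<open>\<theta>\<close> identifies the negative parts and \<open>\<theta>'\<close> inverts it. The embedding will extend \<open>\<theta>\<close>.
\<close>

locale negative_part_embedding =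
  fixes c :: "'c::real_vector graded_lie" and g :: "'g::real_vector graded_lie"
    and \<theta> :: "'g \<Rightarrow> 'c" and \<theta>' :: "'c \<Rightarrow> 'g"
  assumes c: "graded_lie_algebra c" and tc: "transitive_grading c"
    and inner: "negative_derivations_inner c"
    and g: "graded_lie_algebra g" and tg: "transitive_grading g"
    and \<theta>_linear: "linear \<theta>" and \<theta>_grade: "p < 0 \<Longrightarrow> \<theta> ` grade g p = grade c p"
    and \<theta>_br: "p < 0 \<Longrightarrow> q < 0 \<Longrightarrow> x \<in> grade g p \<Longrightarrow> y \<in> grade g q \<Longrightarrow>
      \<theta> (lie_br g x y) = lie_br c (\<theta> x) (\<theta> y)"
    and \<theta>'_linear: "linear \<theta>'" and \<theta>'_\<theta>: "p < 0 \<Longrightarrow> x \<in> grade g p \<Longrightarrow> \<theta>' (\<theta> x) = x"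
begin

lemmas g_br = graded_lie_algebraD(6)[OF g]
lemmas c_br = graded_lie_algebraD(6)[OF c]
lemmas g_bil = bilinear_onD[OF graded_lie_algebraD(3)[OF g]]
lemmas c_bil = bilinear_onD[OF graded_lie_algebraD(3)[OF c]]
lemmas inL = grade_subset_lie_space

lemma \<theta>_in: "p < 0 \<Longrightarrow> x \<in> grade g p \<Longrightarrow> \<theta> x \<in> grade c p"
  using \<theta>_grade by blast

lemma \<theta>'_props:
  assumes "p < 0" "w \<in> grade c p"
  shows "\<theta>' w \<in> grade g p" "\<theta> (\<theta>' w) = w"
proof -
  obtain x where "x \<in> grade g p" "w = \<theta> x" using assms \<theta>_grade by blast
  then show "\<theta>' w \<in> grade g p" "\<theta> (\<theta>' w) = w" using \<theta>'_\<theta>[OF assms(1)] by auto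
qed

text \<open>
  The table \<open>level n\<close> holds the maps on the components of degree less than \<open>n\<close>. It is extended by
  sending an element \<open>X\<close> of degree \<open>n\<close> to the element of the target that acts on the negative part
      as
  \<open>X\<close> does.
\<close>

primrec level :: "nat \<Rightarrow> int \<Rightarrow> 'g \<Rightarrow> 'c"
  where "level 0 = (\<lambda>q. \<theta>)"
  | "level (Suc n) = (level n)(int n := (\<lambda>X. SOME Y. Y \<in> grade c (int n) \<and>
      (\<forall>q<0. \<forall>u\<in>grade g q. lie_br c Y (\<theta> u) = level n (int n + q) (lie_br g X u))))"

definition component :: "int \<Rightarrow> 'g \<Rightarrow> 'c"
  where "component q = level (Suc (nat q)) q"

lemma level_eq_component: "q < int n \<Longrightarrow> level n q = component q"
proof (induction n)
  case (Suc n)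
  then show ?case by (cases "q = int n") (auto simp: component_def simp del: level.simps(1))
qed (simp add: component_def)

lemma component_negative: "q < 0 \<Longrightarrow> component q = \<theta>"
  by (simp add: component_def)

lemma component_nonnegative:
  "component (int n) X = (SOME Y. Y \<in> grade c (int n) \<and>
     (\<forall>q<0. \<forall>u\<in>grade g q. lie_br c Y (\<theta> u) = component (int n + q) (lie_br g X u)))"
proof -
  have "level n (int n + q) = component (int n + q)" if "q < 0" for q
    using that by (intro level_eq_component) simp
  then show ?thesis by (subst component_def) (simp cong: conj_cong imp_cong)
qed

text \<open>
  The invariant of the recursion. Its last clause, for all degrees below \<open>n\<close>, makes the
  transported \<open>ad X\<close> a derivation when \<open>X\<close> has degree \<open>n\<close>.
\<close>

definition adapted :: "int \<Rightarrow> bool"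
  where "adapted s \<longleftrightarrow> (\<forall>X\<in>grade g s. component s X \<in> grade c s) \<and>
    (\<forall>X\<in>grade g s. \<forall>Y\<in>grade g s. component s (X + Y) = component s X + component s Y) \<and>
    (\<forall>r. \<forall>X\<in>grade g s. component s (r *\<^sub>R X) = r *\<^sub>R component s X) \<and>
    (\<forall>q<0. \<forall>X\<in>grade g s. \<forall>v\<in>grade g q.
      component (s + q) (lie_br g X v) = lie_br c (component s X) (\<theta> v))"

lemma adaptedD:
  assumes "adapted s"
  shows "X \<in> grade g s \<Longrightarrow> component s X \<in> grade c s"
    and "X \<in> grade g s \<Longrightarrow> Y \<in> grade g s \<Longrightarrow> component s (X + Y) = component s X + component s Y"
    and "X \<in> grade g s \<Longrightarrow> component s (r *\<^sub>R X) = r *\<^sub>R component s X"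
    and "q < 0 \<Longrightarrow> X \<in> grade g s \<Longrightarrow> v \<in> grade g q \<Longrightarrow>
      component (s + q) (lie_br g X v) = lie_br c (component s X) (\<theta> v)"
  using assms unfolding adapted_def by blast+

lemma adapted_negative: "s < 0 \<Longrightarrow> adapted s"
  unfolding adapted_def
  by (simp add: component_negative \<theta>_in \<theta>_br linear_add[OF \<theta>_linear] linear_scale[OF \<theta>_linear])

text \<open>
  Transporting \<open>ad X\<close> to the target gives a derivation of the negative part, by the Jacobi identity
  and because \<open>ad X\<close> lands in degrees where the maps are already compatible with brackets.
\<close>

lemma component_exists:
  assumes prev: "\<And>s. s < int n \<Longrightarrow> adapted s" and X: "X \<in> grade g (int n)"
  shows "\<exists>Y. Y \<in> grade c (int n) \<and>
    (\<forall>q<0. \<forall>u\<in>grade g q. lie_br c Y (\<theta> u) = component (int n + q) (lie_br g X u))"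
proof -
  let ?f = "\<lambda>s x. if s < int n then component s x else 0"
  obtain \<psi> where \<psi>: "linear \<psi>" "\<And>s x. x \<in> grade g s \<Longrightarrow> \<psi> x = ?f s x"
  proof (rule linear_extension_of_family[of "grade g" ?f])
    show "independent_family UNIV (grade g)" by (rule graded_lie_algebraD(2)[OF g])
  qed (use graded_lie_algebraD(1)[OF g] adaptedD(2,3)[OF prev] in auto)
  have \<psi>_br: "\<psi> (lie_br g Z v) = lie_br c (\<psi> Z) (\<theta> v)"
    if "Z \<in> grade g s" "s < int n" "v \<in> grade g q" "q < 0" for Z s v q
    using \<psi>(2)[OF that(1)] \<psi>(2)[OF g_br[OF that(1,3)]] adaptedD(4)[OF prev, of s q Z v] that by simp
  have br: "lie_br g X (\<theta>' w) \<in> grade g (int n + q)" if "q < 0" "w \<in> grade c q" for q w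
    using g_br[OF X] \<theta>'_props that by blast
  have XL: "X \<in> lie_space g" using X inL by blast
  have \<theta>'L: "\<theta>' w \<in> lie_space g" if "q < 0" "w \<in> grade c q" for q w
    using \<theta>'_props[OF that] inL by blast
  let ?d = "\<lambda>q w. if q < 0 then \<psi> (lie_br g X (\<theta>' w)) else 0"
  obtain d where d: "linear d" "\<And>q w. w \<in> grade c q \<Longrightarrow> d w = ?d q w"
  proof (rule linear_extension_of_family[of "grade c" ?d])
    show "independent_family UNIV (grade c)" by (rule graded_lie_algebraD(2)[OF c])
    show "?d q (u + v) = ?d q u + ?d q v" if "u \<in> grade c q" "v \<in> grade c q" for q u v
      using XL \<theta>'L that g_bil(2) by (simp add: linear_add[OF \<theta>'_linear] linear_add[OF \<psi>(1)])
    show "?d q (r *\<^sub>R u) = r *\<^sub>R ?d q u" if "u \<in> grade c q" for q r u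
      using XL \<theta>'L that g_bil(4) by (simp add: linear_scale[OF \<theta>'_linear] linear_scale[OF \<psi>(1)])
  qed (use graded_lie_algebraD(1)[OF c] in auto)
  have d_neg: "d w = \<psi> (lie_br g X (\<theta>' w))" if "q < 0" "w \<in> grade c q" for q w
    using d(2)[OF that(2)] that(1) by simp
  have d_in: "d w \<in> grade c (int n + q)" if "q < 0" "w \<in> grade c q" for q w
    unfolding d_neg[OF that] using \<psi>(2)[OF br[OF that]] adaptedD(1)[OF prev br[OF that]] that
        by simp
  have "d (lie_br c u v) = lie_br c (d u) v + lie_br c u (d v)"
    if q: "q < 0" "u \<in> grade c q" and r: "r < 0" "v \<in> grade c r" for q r u v
  proof -
    note u = \<theta>'_props[OF q] and v = \<theta>'_props[OF r]
    have "\<theta>' (lie_br c u v) = lie_br g (\<theta>' u) (\<theta>' v)"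
      using \<theta>_br[OF q(1) r(1) u(1) v(1)] u(2) v(2) \<theta>'_\<theta>[OF _ g_br[OF u(1) v(1)]] q r by simp
    then have "d (lie_br c u v)
        = \<psi> (lie_br g (lie_br g X (\<theta>' u)) (\<theta>' v)) + \<psi> (lie_br g (\<theta>' u) (lie_br g X (\<theta>' v)))"
      using d_neg[OF _ c_br[OF q(2) r(2)]] q(1) r(1) lie_br_derivation[OF g XL \<theta>'L[OF q] \<theta>'L[OF r]]
      by (simp add: linear_add[OF \<psi>(1)])
    also have "\<psi> (lie_br g (lie_br g X (\<theta>' u)) (\<theta>' v)) = lie_br c (d u) v"
      unfolding d_neg[OF q] using \<psi>_br[OF br[OF q] _ v(1) r(1)] q v(2) by simp
    also have "\<psi> (lie_br g (\<theta>' u) (lie_br g X (\<theta>' v))) = - \<psi> (lie_br g (lie_br g X (\<theta>' v)) (\<theta>' u))"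
      using lie_br_skew[OF g \<theta>'L[OF q] inL[OF br[OF r]]] by (simp add: linear_neg[OF \<psi>(1)])
    also have "\<dots> = - lie_br c (d v) u"
      unfolding d_neg[OF r] using \<psi>_br[OF br[OF r] _ u(1) q(1)] r u(2) by simp
    also have "\<dots> = lie_br c u (d v)"
      using lie_br_skew[OF c inL[OF q(2)] inL[OF d_in[OF r]]] by simp
    finally show ?thesis .
  qed
  then obtain Y where Y: "Y \<in> grade c (int n)" "\<forall>q<0. \<forall>u\<in>grade c q. lie_br c Y u = d u"
    using inner[unfolded negative_derivations_inner_def, rule_format, of "int n" d] d_in d(1)
        by auto
  have "lie_br c Y (\<theta> u) = component (int n + q) (lie_br g X u)" if "q < 0" "u \<in> grade g q" for q u
    using Y(2) \<theta>_in[OF that] that \<psi>(2)[OF g_br[OF X that(2)]] \<theta>'_\<theta>[OF that] d_neg[OF that(1)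
        \<theta>_in[OF that]] by auto
  with Y(1) show ?thesis by blast
qed

lemma component_unique:
  assumes "0 \<le> p" "Y \<in> grade c p" "Z \<in> grade c p"
    and eq: "\<And>u. u \<in> grade g (-1) \<Longrightarrow> lie_br c Y (\<theta> u) = lie_br c Z (\<theta> u)"
  shows "Y = Z"
proof -
  have "Y - Z \<in> grade c p" using assms graded_lie_algebraD(1)[OF c] by (auto intro: subspace_diff)
  moreover have "lie_br c (Y - Z) w = 0" if w: "w \<in> grade c (-1)" for w
  proof -
    obtain u where "u \<in> grade g (-1)" "w = \<theta> u" using w \<theta>_grade[of "-1"] by auto
    then show ?thesis using eq assms lie_br_diff[OF c] w inL by (metis right_minus_eq)
  qed
  ultimately have "Y - Z = 0" using tc assms(1) unfolding transitive_grading_def by blast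
  then show ?thesis by simp
qed

lemma adapted_nonnegative:
  assumes prev: "\<And>s. s < int n \<Longrightarrow> adapted s"
  shows "adapted (int n)"
proof -
  have spec: "component (int n) X \<in> grade c (int n) \<and>
    (\<forall>q<0. \<forall>u\<in>grade g q. lie_br c (component (int n) X) (\<theta> u)
        = component (int n + q) (lie_br g X u))"
    if "X \<in> grade g (int n)" for X
    unfolding component_nonnegative using someI_ex[OF component_exists[OF prev that]] by blast
  have spec1: "lie_br c (component (int n) X) (\<theta> u) = component (int n - 1) (lie_br g X u)"
    if "X \<in> grade g (int n)" "u \<in> grade g (-1)" for X u
    using spec[OF that(1)] that(2) by force
  have specL: "component (int n) X \<in> lie_space c" if "X \<in> grade g (int n)" for X
    using spec[OF that] inL by blast
  have \<theta>L: "\<theta> u \<in> lie_space c" if "u \<in> grade g (-1)" for u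
    using \<theta>_in[OF _ that] inL by simp
  note sg = graded_lie_algebraD(1)[OF g] and sc = graded_lie_algebraD(1)[OF c]
  note prev1 = adaptedD[OF prev[of "int n - 1"], simplified]
  have "component (int n) (X + Y) = component (int n) X + component (int n) Y"
    if X: "X \<in> grade g (int n)" and Y: "Y \<in> grade g (int n)" for X Y
  proof (rule component_unique)
    have XY: "X + Y \<in> grade g (int n)" using X Y sg by (simp add: subspace_add)
    show "component (int n) (X + Y) \<in> grade c (int n)" using spec XY by blast
    show "component (int n) X + component (int n) Y \<in> grade c (int n)"
      using spec X Y sc by (simp add: subspace_add)
    fix u assume u: "u \<in> grade g (-1)"
    have "component (int n - 1) (lie_br g (X + Y) u)
        = component (int n - 1) (lie_br g X u) + component (int n - 1) (lie_br g Y u)"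
      using g_bil(1)[OF inL[OF X] inL[OF Y] inL[OF u]] prev1(2) g_br[OF X u] g_br[OF Y u] by simp
    then show "lie_br c (component (int n) (X + Y)) (\<theta> u)
        = lie_br c (component (int n) X + component (int n) Y) (\<theta> u)"
      unfolding c_bil(1)[OF specL[OF X] specL[OF Y] \<theta>L[OF u]]
        spec1[OF XY u] spec1[OF X u] spec1[OF Y u] .
  qed simp
  moreover have "component (int n) (r *\<^sub>R X) = r *\<^sub>R component (int n) X"
    if X: "X \<in> grade g (int n)" for X r
  proof (rule component_unique)
    have rX: "r *\<^sub>R X \<in> grade g (int n)" using X sg by (simp add: subspace_scale)
    show "component (int n) (r *\<^sub>R X) \<in> grade c (int n)" using spec rX by blast
    show "r *\<^sub>R component (int n) X \<in> grade c (int n)"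
      using spec X sc by (simp add: subspace_scale)
    fix u assume u: "u \<in> grade g (-1)"
    have "component (int n - 1) (lie_br g (r *\<^sub>R X) u) = r *\<^sub>R component (int n - 1) (lie_br g X u)"
      using g_bil(3)[OF inL[OF X] inL[OF u]] prev1(3) g_br[OF X u] by simp
    then show "lie_br c (component (int n) (r *\<^sub>R X)) (\<theta> u)
        = lie_br c (r *\<^sub>R component (int n) X) (\<theta> u)"
      unfolding c_bil(3)[OF specL[OF X] \<theta>L[OF u]] spec1[OF rX u] spec1[OF X u] .
  qed simp
  ultimately show ?thesis unfolding adapted_def using spec by auto
qed

lemma adapted: "adapted s"
proof (cases "s < 0")
  case False
  have "adapted (int n)" for n
  proof (induction n rule: less_induct)
    case (less n)
    show ?case
    proof (rule adapted_nonnegative)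
      fix s assume "s < int n"
      then show "adapted s"
        using less[of "nat s"] adapted_negative[of s] by (cases "s < 0") auto
    qed
  qed
  from this[of "nat s"] False show ?thesis by simp
qed (rule adapted_negative)

lemma component_inj:
  assumes "X \<in> grade g s" "component s X = 0"
  shows "X = 0"
proof -
  have neg: "x = 0" if "x \<in> grade g s" "s < 0" "component s x = 0" for x s
    using that \<theta>'_\<theta>[of s x] linear_0[OF \<theta>'_linear] by (simp add: component_negative)
  have nonneg: "x = 0" if "x \<in> grade g (int n)" "component (int n) x = 0" for x n
    using that
  proof (induction n arbitrary: x rule: less_induct)
    case (less n)
    have "lie_br g x u = 0" if u: "u \<in> grade g (-1)" for u
    proof -
      have x: "lie_br g x u \<in> grade g (int n - 1)" using g_br[OF less.prems(1) u] by simp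
      have "component (int n - 1) (lie_br g x u) = lie_br c 0 (\<theta> u)"
        using adaptedD(4)[OF adapted, of "-1" x "int n" u] u less.prems by simp
      then have "component (int n - 1) (lie_br g x u) = 0"
        using bilinear_on_zero(1)[OF graded_lie_algebraD(3)[OF c]] inL[OF \<theta>_in[OF _ u]] by simp
      then show ?thesis using less.IH[of "n - 1"] neg x by (cases "n = 0") (auto simp: of_nat_diff)
    qed
    then have "\<forall>u\<in>grade g (-1). lie_br g x u = 0" by blast
    then show ?case
      using tg less.prems(1) of_nat_0_le_iff[of n] unfolding transitive_grading_def by blast
  qed
  show ?thesis using assms neg[of X s] nonneg[of X "nat s"] by (cases "s < 0") auto
qed

text \<open>
  For two elements of nonnegative degree, compatibility with the bracket is proved by induction on
  the sum of the degrees: by transitivity it can be tested after bracketing with an element of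
      degree
  \<open>-1\<close>, and the Jacobi identity then leaves brackets of smaller total degree.
\<close>

lemma embedding: "\<exists>\<phi>. graded_lie_hom g c \<phi> \<and> inj_on \<phi> (lie_space g)"
proof -
  obtain \<phi> where \<phi>: "linear \<phi>" "\<And>s x. x \<in> grade g s \<Longrightarrow> \<phi> x = component s x"
    using linear_extension_of_family[of "grade g" component] graded_lie_algebraD(1,2)[OF g]
      adaptedD(2,3)[OF adapted] by metis
  have \<phi>_in: "\<phi> x \<in> grade c s" if "x \<in> grade g s" for x s
    using \<phi>(2)[OF that] adaptedD(1)[OF adapted that] by simp
  have neg: "\<phi> (lie_br g X v) = lie_br c (\<phi> X) (\<phi> v)"
    if "X \<in> grade g s" "q < 0" "v \<in> grade g q" for X s v q
    using adaptedD(4)[OF adapted that(2,1,3)] \<phi>(2) that g_br[OF that(1,3)] component_negative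
    by metis
  have neg': "\<phi> (lie_br g v X) = lie_br c (\<phi> v) (\<phi> X)"
    if "X \<in> grade g s" "q < 0" "v \<in> grade g q" for X s v q
    using neg[OF that] lie_br_skew[OF g, of v X] lie_br_skew[OF c, of "\<phi> v" "\<phi> X"]
      \<phi>_in[OF that(1)] \<phi>_in[OF that(3)] that inL linear_neg[OF \<phi>(1)] by metis
  have nonneg: "\<phi> (lie_br g X Y) = lie_br c (\<phi> X) (\<phi> Y)"
    if "X \<in> grade g (int p)" "Y \<in> grade g (int q)" for X Y p q
    using that
  proof (induction "p + q" arbitrary: p q X Y rule: less_induct)
    case less
    note X = less.prems(1) and Y = less.prems(2)
    have low: "\<phi> (lie_br g X' Y') = lie_br c (\<phi> X') (\<phi> Y')"
      if X': "X' \<in> grade g p'" and Y': "Y' \<in> grade g q'" and sm: "p' + q' < int p + int q"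
          for X' Y' p' q'
    proof (cases "p' < 0 \<or> q' < 0")
      case True
      then show ?thesis using neg[OF X' _ Y'] neg'[OF Y' _ X'] by auto
    next
      case False
      then show ?thesis using less.hyps[of "nat p'" "nat q'" X' Y'] X' Y' sm by auto
    qed
    show ?case
    proof (rule component_unique)
      show "\<phi> (lie_br g X Y) \<in> grade c (int p + int q)" using \<phi>_in g_br X Y by blast
      show "lie_br c (\<phi> X) (\<phi> Y) \<in> grade c (int p + int q)" using \<phi>_in c_br X Y by blast
      fix u assume u: "u \<in> grade g (-1)"
      have \<theta>u: "\<theta> u = \<phi> u" using \<phi>(2)[OF u] by (simp add: component_negative)
      note XL = inL[OF X] and YL = inL[OF Y] and uL = inL[OF u]
      note XL' = inL[OF \<phi>_in[OF X]] and YL' = inL[OF \<phi>_in[OF Y]] and uL' = inL[OF \<phi>_in[OF u]]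
      have g_ad: "lie_br g (lie_br g X Y) u = lie_br g X (lie_br g Y u) - lie_br g Y (lie_br g X u)"
        using lie_br_derivation[OF g XL YL uL] by simp
      have c_ad: "lie_br c (lie_br c (\<phi> X) (\<phi> Y)) (\<phi> u)
          = lie_br c (\<phi> X) (lie_br c (\<phi> Y) (\<phi> u)) - lie_br c (\<phi> Y) (lie_br c (\<phi> X) (\<phi> u))"
        using lie_br_derivation[OF c XL' YL' uL'] by simp
      have "lie_br c (\<phi> (lie_br g X Y)) (\<phi> u) = \<phi> (lie_br g (lie_br g X Y) u)"
        using neg[OF g_br[OF X Y] _ u] by simp
      also have "\<dots> = \<phi> (lie_br g X (lie_br g Y u)) - \<phi> (lie_br g Y (lie_br g X u))"
        unfolding g_ad by (simp add: linear_diff[OF \<phi>(1)])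
      also have "\<dots> = lie_br c (\<phi> X) (\<phi> (lie_br g Y u)) - lie_br c (\<phi> Y) (\<phi> (lie_br g X u))"
        using low[OF X g_br[OF Y u]] low[OF Y g_br[OF X u]] by simp
      also have "\<dots> = lie_br c (lie_br c (\<phi> X) (\<phi> Y)) (\<phi> u)"
        unfolding c_ad using neg[OF X _ u] neg[OF Y _ u] by simp
      finally show "lie_br c (\<phi> (lie_br g X Y)) (\<theta> u) = lie_br c (lie_br c (\<phi> X) (\<phi> Y)) (\<theta> u)"
        unfolding \<theta>u .
    qed simp
  qed
  have "\<phi> (lie_br g X Y) = lie_br c (\<phi> X) (\<phi> Y)"
    if "X \<in> grade g p" "Y \<in> grade g q" for X Y p q
    using neg[OF that(1) _ that(2)] neg'[OF that(2) _ that(1)] nonneg[of X "nat p" Y "nat q"] that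
    by (cases "p < 0 \<or> q < 0") auto
  then have "graded_lie_hom g c \<phi>"
    using \<phi>_in \<phi>(1)
    by (intro graded_lie_homI[OF g graded_lie_algebraD(3)[OF c], where G = "\<Union>p. grade g p"])
      (auto simp: lie_space_def)
  moreover have "inj_on \<phi> (lie_space g)"
  proof (rule graded_linear_map_inj[OF g graded_lie_algebraD(2,1)[OF c] \<phi>(1)])
    show "\<phi> ` grade g p \<subseteq> grade c p" for p using \<phi>_in by blast
    show "x = 0" if "x \<in> grade g p" "\<phi> x = 0" for p x
      using component_inj[OF that(1)] \<phi>(2)[OF that(1)] that(2) by simp
  qed
  ultimately show ?thesis by blast
qed

end

theorem transitive_embedding:
  assumes c: "graded_lie_algebra c" "transitive_grading c" "negative_derivations_inner c"
    and g: "graded_lie_algebra g" "transitive_grading g"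
    and iso: "graded_lie_iso (negative_part g) (negative_part c)"
  shows "\<exists>\<phi>. graded_lie_hom g c \<phi> \<and> inj_on \<phi> (lie_space g)"
proof -
  note ng = graded_lie_algebra_negative_part[OF g(1)]
  note nc = graded_lie_algebra_negative_part[OF c(1)]
  obtain \<theta> where \<theta>: "graded_lie_hom (negative_part g) (negative_part c) \<theta>"
    "inj_on \<theta> (lie_space (negative_part g))"
    "\<And>p. \<theta> ` grade (negative_part g) p = grade (negative_part c) p"
    using graded_lie_isoE[OF iso ng graded_lie_algebraD(2,1)[OF nc]] by metis
  have lin: "linear \<theta>" using \<theta>(1) unfolding graded_lie_hom_def by blast
  obtain \<theta>' where \<theta>': "linear \<theta>'" "\<forall>v\<in>lie_space (negative_part g). \<theta>' (\<theta> v) = v"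
    using linear_exists_left_inverse_on[OF lin subspace_lie_space \<theta>(2)] by auto
  have sub: "x \<in> lie_space (negative_part g)" if "p < 0" "x \<in> grade g p" for p x
    using that grade_subset_lie_space[of x "negative_part g" p] by simp
  interpret negative_part_embedding c g \<theta> \<theta>'
  proof (rule negative_part_embedding.intro)
    show "\<theta> ` grade g p = grade c p" if "p < 0" for p using \<theta>(3)[of p] that by simp
    show "\<theta> (lie_br g x y) = lie_br c (\<theta> x) (\<theta> y)"
      if "p < 0" "q < 0" "x \<in> grade g p" "y \<in> grade g q" for p q x y
      using \<theta>(1) sub[OF that(1,3)] sub[OF that(2,4)] unfolding graded_lie_hom_def by simp
    show "\<theta>' (\<theta> x) = x" if "p < 0" "x \<in> grade g p" for p x using \<theta>'(2) sub[OF that] by blast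
  qed (use c g lin \<theta>'(1) in auto)
  show ?thesis by (rule embedding)
qed

section \<open>Copies inside the space of real sequences\<close>

text \<open>
  A basis is mapped to unit sequences. The map is defined on the ambient space by linear extension.
\<close>

lemma countable_basis_embeds_in_sequences:
  fixes S :: "'a::real_vector set"
  assumes "countable C" "S = span C"
  obtains \<psi> :: "'a \<Rightarrow> nat \<Rightarrow> real" where "linear \<psi>" "inj_on \<psi> S"
proof -
  obtain B where B: "B \<subseteq> C" "independent B" "C \<subseteq> span B"
    using maximal_independent_subset[of C] by auto
  have SB: "S = span B" using B assms(2) by (metis span_mono span_span subset_antisym)
  have cB: "countable B" using B(1) assms(1) countable_subset by blast
  define e where "e b = (\<lambda>n. if n = to_nat_on B b then 1 else 0 :: real)" for b
  obtain \<psi> where \<psi>: "linear \<psi>" "\<forall>b\<in>B. \<psi> b = e b"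
    using linear_independent_extend[OF B(2), of e] by blast
  have "x = 0" if x: "x \<in> span B" "\<psi> x = 0" for x
  proof -
    obtain t r where t: "finite t" "t \<subseteq> B" "x = (\<Sum>a\<in>t. r a *\<^sub>R a)"
      using x(1) unfolding span_explicit by auto
    have ev: "linear (\<lambda>f :: nat \<Rightarrow> real. f n)" for n
      by (rule linearI) (simp_all add: scaleR_fun_def)
    have "r b = 0" if b: "b \<in> t" for b
    proof -
      have "\<psi> x (to_nat_on B b) = (\<Sum>a\<in>t. r a * e a (to_nat_on B b))"
        using \<psi> t by (simp add: linear_sum[OF \<psi>(1)] linear_scale[OF \<psi>(1)] linear_sum[OF ev]
            scaleR_fun_def subset_iff cong: sum.cong)
      also have "\<dots> = (\<Sum>a\<in>t. if a = b then r a else 0)"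
        by (intro sum.cong)
          (use b t(2) inj_on_to_nat_on[OF cB] in \<open>auto simp: e_def dest: inj_onD\<close>)
      also have "\<dots> = r b" using t(1) b by simp
      finally show ?thesis using x(2) by simp
    qed
    then show ?thesis using t(3) by simp
  qed
  then have "inj_on \<psi> S"
    unfolding SB by (subst linear_inj_on_iff_eq_0[OF \<psi>(1)]) auto
  with \<psi>(1) show thesis using that by blast
qed

lemma lie_space_countable_span:
  assumes "\<And>p. fd_subspace (grade L p)"
  obtains C where "countable C" "lie_space L = span C"
proof -
  have "\<exists>B. finite B \<and> span B = grade L p" for p using assms unfolding fd_subspace_def by blast
  then obtain B where B: "\<And>p. finite (B p)" "\<And>p. span (B p) = grade L p" by metis
  have "span (\<Union>p. grade L p) = span (\<Union>p. B p)"
  proof (rule subset_antisym)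
    show "span (\<Union>p. grade L p) \<subseteq> span (\<Union>p. B p)"
      by (rule span_minimal) (use B(2) span_mono[of "B _" "\<Union>p. B p"] in auto)
    show "span (\<Union>p. B p) \<subseteq> span (\<Union>p. grade L p)"
      using B(2) by (intro span_mono) (auto intro: span_base)
  qed
  moreover have "countable (\<Union>p. B p)" using B(1) by (auto intro: countable_finite)
  ultimately show thesis using that unfolding lie_space_def by metis
qed

text \<open>
  Maximality compares only with algebras inside \<open>nat \<Rightarrow> real\<close>, so the algebra that is to be embedded
  into a maximal one is first moved there.
\<close>

lemma transitive_prolongation_sequence_copy:
  fixes g :: "'a::real_vector graded_lie"
  assumes g: "transitive_prolongation m g"
  obtains g' :: "(nat \<Rightarrow> real) graded_lie" and \<psi>
  where "transitive_prolongation m g'" "linear \<psi>" "inj_on \<psi> (lie_space g)"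
    "\<And>p. grade g' p = \<psi> ` grade g p"
proof -
  have L: "graded_lie_algebra g" and fd: "\<And>p. fd_subspace (grade g p)"
    and iso: "graded_lie_iso (negative_part g) m" and tr: "transitive_grading g"
    using g unfolding transitive_prolongation_def transitive_grading_def by auto
  obtain C where C: "countable C" "lie_space g = span C"
    using lie_space_countable_span[of g] fd by metis
  obtain \<psi> :: "'a \<Rightarrow> nat \<Rightarrow> real" where \<psi>: "linear \<psi>" "inj_on \<psi> (lie_space g)"
    using countable_basis_embeds_in_sequences[OF C] by metis
  obtain h where h: "linear h" "\<forall>v\<in>lie_space g. h (\<psi> v) = v"
    using linear_exists_left_inverse_on[OF \<psi>(1) subspace_lie_space \<psi>(2)] by auto
  define g' where "g' = \<lparr>grade = (\<lambda>p. \<psi> ` grade g p), lie_br = (\<lambda>x y. \<psi> (lie_br g (h x) (h y)))\<rparr>"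
  have gr: "grade g' p = \<psi> ` grade g p" for p by (simp add: g'_def)
  have sp: "lie_space g' = \<psi> ` lie_space g" using lie_space_image[OF \<psi>(1)] gr by metis
  have h_sp: "h ` lie_space g' \<subseteq> lie_space g" unfolding sp using h(2) by auto
  have br: "lie_br g' x y = \<psi> (lie_br g (h x) (h y))" for x y by (simp add: g'_def)
  have br': "lie_br g' (\<psi> x) (\<psi> y) = \<psi> (lie_br g x y)" if "x \<in> lie_space g" "y \<in> lie_space g"
      for x y
    using that h(2) by (simp add: br)
  have br'': "lie_br g' (\<psi> x) (\<psi> y) = \<psi> (lie_br g x y)" if "x \<in> grade g p" "y \<in> grade g q"
      for x y p q
    using that br' grade_subset_lie_space by blast
  have ind: "independent_family UNIV (grade g')"
    unfolding independent_family_def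
  proof (intro allI impI ballI)
    fix J x i assume J: "finite J" "J \<subseteq> UNIV" "\<forall>i\<in>J. x i \<in> grade g' i" "sum x J = 0" "i \<in> J"
    have hx: "h (x i) \<in> grade g i" "x i = \<psi> (h (x i))" if "i \<in> J" for i
      using J(3) that h(2) grade_subset_lie_space unfolding gr by fastforce+
    have "(\<Sum>i\<in>J. h (x i)) = 0" using J(4) linear_sum[OF h(1), of x J] linear_0[OF h(1)] by simp
    then have "h (x i) = 0"
      using independent_familyD[OF graded_lie_algebraD(2)[OF L] J(1,2), of
          "\<lambda>i. h (x i)" i] hx(1) J(5)
      by simp
    then show "x i = 0" using hx(2)[OF J(5)] linear_0[OF \<psi>(1)] by simp
  qed
  have L': "graded_lie_algebra g'"
    unfolding graded_lie_algebra_def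
  proof (intro conjI allI ballI)
    show "subspace (grade g' p)" for p
      unfolding gr by (intro linear_subspace_image \<psi> graded_lie_algebraD L)
    show "bilinear_on (lie_space g') (lie_space g') (lie_br g')"
      unfolding g'_def graded_lie.simps
      by (rule bilinear_on_linear_comp[OF bilinear_on_comp_linear[OF graded_lie_algebraD(3)[OF L]
          h(1)] \<psi>(1)])
        (use h_sp in \<open>simp_all add: g'_def\<close>)
    show "lie_br g' x x = 0" if "x \<in> lie_space g'" for x
      using that graded_lie_algebraD(4)[OF L] br' linear_0[OF \<psi>(1)] unfolding sp by auto
    show "lie_br g' x (lie_br g' y z) + lie_br g' y (lie_br g' z x) + lie_br g' z (lie_br g' x y)
        = 0"
      if xyz: "x \<in> lie_space g'" "y \<in> lie_space g'" "z \<in> lie_space g'" for x y z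
    proof -
      obtain a b c where abc: "a \<in> lie_space g" "b \<in> lie_space g" "c \<in> lie_space g"
        "x = \<psi> a" "y = \<psi> b" "z = \<psi> c" using xyz unfolding sp by auto
      show ?thesis
        using graded_lie_algebraD(5)[OF L abc(1-3)] abc lie_br_closed[OF L] linear_0[OF \<psi>(1)]
        by (simp add: br' linear_add[OF \<psi>(1), symmetric])
    qed
    show "lie_br g' x y \<in> grade g' (p + q)" if "x \<in> grade g' p" "y \<in> grade g' q" for x y p q
      using that br'' graded_lie_algebraD(6)[OF L] unfolding gr by auto
  qed (rule ind)
  have "graded_lie_iso (negative_part g') (negative_part g)"
  proof (rule graded_lie_iso_inverse[OF _ _ _ graded_lie_algebra_negative_part[OF L]])
    note sub = lie_space_negative_part_subset[of g]
    show "inj_on \<psi> (lie_space (negative_part g))" using \<psi>(2) sub inj_on_subset by blast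
    show "\<psi> ` grade (negative_part g) p = grade (negative_part g') p" for p
      using linear_0[OF \<psi>(1)] by (simp add: gr)
    then show "graded_lie_hom (negative_part g) (negative_part g') \<psi>"
      unfolding graded_lie_hom_def using \<psi>(1) br' sub by (auto simp: subset_iff)
  qed
  then have "graded_lie_iso (negative_part g') m" using graded_lie_iso_trans iso by blast
  moreover have "fd_subspace (grade g' p)" for p
    using fd[of p] linear_span_image[OF \<psi>(1)] unfolding fd_subspace_def gr by (metis finite_imageI)
  moreover have "X = 0" if p: "p \<ge> 0" and X: "X \<in> grade g' p"
    and 0: "\<forall>y\<in>grade g' (-1). lie_br g' X y = 0" for p X
  proof -
    obtain x where x: "x \<in> grade g p" "X = \<psi> x" using X unfolding gr by auto
    have "lie_br g x y = 0" if y: "y \<in> grade g (-1)" for y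
    proof -
      have "\<psi> (lie_br g x y) = 0" using 0 x y br''[OF x(1) y] unfolding gr by auto
      then show ?thesis
        using \<psi>(2) linear_0[OF \<psi>(1)] graded_lie_algebraD(6)[OF L x(1) y] grade_subset_lie_space
          linear_inj_on_iff_eq_0[OF \<psi>(1) subspace_lie_space] by blast
    qed
    then show ?thesis using tr p x linear_0[OF \<psi>(1)] unfolding transitive_grading_def by auto
  qed
  ultimately have "transitive_prolongation m g'" unfolding transitive_prolongation_def using L'
      by blast
  then show thesis using that \<psi> gr by blast
qed

text \<open>
  The two embeddings force equality of the finite dimensions in each degree.
\<close>

lemma graded_lie_iso_of_mutual_embeddings:
  assumes g: "graded_lie_algebra g" "\<And>p. fd_subspace (grade g p)"
    and c: "\<And>p. fd_subspace (grade c p)"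
    and \<phi>: "graded_lie_hom g c \<phi>" "inj_on \<phi> (lie_space g)"
    and \<psi>: "linear \<psi>" "\<And>p. inj_on \<psi> (grade c p)" "\<And>p. \<psi> ` grade c p \<subseteq> grade g p"
  shows "graded_lie_iso g c"
proof (rule graded_lie_isoI[OF \<phi>])
  fix p
  have "inj_on \<phi> (grade g p)" using \<phi>(2) grade_subset_lie_space inj_on_subset by blast
  moreover have "linear \<phi>" "\<phi> ` grade g p \<subseteq> grade c p" using \<phi>(1) unfolding graded_lie_hom_def
      by auto
  moreover have "dim (grade c p) \<le> dim (grade g p)"
    using dim_le_of_inj(1)[OF g(2) \<psi>] fd_subspace_imp_subspace[OF c] by blast
  ultimately show "\<phi> ` grade g p = grade c p"
    using dim_le_of_inj(2)[OF c, of \<phi> "grade g p"] graded_lie_algebraD(1)[OF g(1)] by blast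
qed

section \<open>Polynomial functions\<close>

instance "fun" :: (type, real_algebra) real_algebra
  by standard (simp_all add: scaleR_fun_def times_fun_def)

lemma scaleR_fun_apply [simp]: "(r *\<^sub>R f) x = r *\<^sub>R f x"
  by (simp add: scaleR_fun_def)

lemma sum_fun_apply: "(\<Sum>i\<in>A. f i) x = (\<Sum>i\<in>A. f i x)"
  by (induction A rule: infinite_finite_induct) auto

lemma finite_coords [simp]: "finite (coords l)"
  by (simp add: coords_def)

lemma coords_simps [simp]: "Cx i \<in> coords l \<longleftrightarrow> i < l" "Cy i \<in> coords l \<longleftrightarrow> i < l" "Cz \<in> coords l"
  by (auto simp: coords_def)

lemma sum_coords: "(\<Sum>k\<in>coords l. h k) = (\<Sum>i<l. h (Cx i)) + (\<Sum>i<l. h (Cy i)) + h Cz"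
proof -
  have "(\<Sum>k\<in>coords l. h k) = (\<Sum>k\<in>Cx ` {..<l} \<union> Cy ` {..<l}. h k) + h Cz"
    unfolding coords_def by (subst sum.union_disjoint) auto
  also have "(\<Sum>k\<in>Cx ` {..<l} \<union> Cy ` {..<l}. h k) = (\<Sum>k\<in>Cx ` {..<l}. h k) + (\<Sum>k\<in>Cy ` {..<l}. h k)"
    by (subst sum.union_disjoint) auto
  also have "(\<Sum>k\<in>Cx ` {..<l}. h k) = (\<Sum>i<l. h (Cx i))"
    by (subst sum.reindex) (auto simp: inj_on_def)
  also have "(\<Sum>k\<in>Cy ` {..<l}. h k) = (\<Sum>i<l. h (Cy i))"
    by (subst sum.reindex) (auto simp: inj_on_def)
  finally show ?thesis .
qed

lemma weight_pos: "0 < weight k"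
  by (cases k) auto

definition mono_fun :: "nat \<Rightarrow> (coord \<Rightarrow> nat) \<Rightarrow> point \<Rightarrow> real"
  where "mono_fun l a = (\<lambda>p. \<Prod>k\<in>coords l. p k ^ a k)"

definition mono_weight :: "nat \<Rightarrow> (coord \<Rightarrow> nat) \<Rightarrow> nat"
  where "mono_weight l a = (\<Sum>k\<in>coords l. weight k * a k)"

definition poly_funs :: "nat \<Rightarrow> (point \<Rightarrow> real) set"
  where "poly_funs l = span (range (mono_fun l))"

definition hom_polys :: "nat \<Rightarrow> int \<Rightarrow> (point \<Rightarrow> real) set"
  where "hom_polys l d = span {mono_fun l a | a. int (mono_weight l a) = d}"

definition coord_fun :: "coord \<Rightarrow> point \<Rightarrow> real"
  where "coord_fun k = (\<lambda>p. p k)"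

lemma subspace_poly_funs [simp]: "subspace (poly_funs l)"
  and subspace_hom_polys [simp]: "subspace (hom_polys l d)"
  by (simp_all add: poly_funs_def hom_polys_def)

lemma hom_polys_subset: "f \<in> hom_polys l d \<Longrightarrow> f \<in> poly_funs l"
  unfolding poly_funs_def hom_polys_def by (rule span_mono[THEN subsetD]) auto

lemma mono_fun_mult: "mono_fun l a * mono_fun l b = mono_fun l (\<lambda>k. a k + b k)"
  by (simp add: mono_fun_def times_fun_def power_add prod.distrib)

lemma mono_weight_add: "mono_weight l (\<lambda>k. a k + b k) = mono_weight l a + mono_weight l b"
  by (simp add: mono_weight_def distrib_left sum.distrib)

lemma span_mult_closed:
  fixes A B C :: "(point \<Rightarrow> real) set"
  assumes "\<And>a b. a \<in> A \<Longrightarrow> b \<in> B \<Longrightarrow> a * b \<in> span C" and f: "f \<in> span A" and g: "g \<in> span B"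
  shows "f * g \<in> span C"
proof (rule bilinear_on_span_closed[where f = "(*)", OF _ subspace_span assms])
  show "bilinear_on (span A) (span B) (*)"
    unfolding bilinear_on_def by (simp add: distrib_left distrib_right)
qed

lemma hom_polys_mult:
  "f \<in> hom_polys l d \<Longrightarrow> g \<in> hom_polys l e \<Longrightarrow> f * g \<in> hom_polys l (d + e)"
  unfolding hom_polys_def
  by (erule (1) span_mult_closed[rotated 1])
    (auto simp: mono_fun_mult mono_weight_add intro!: span_base)

lemma poly_funs_mult: "f \<in> poly_funs l \<Longrightarrow> g \<in> poly_funs l \<Longrightarrow> f * g \<in> poly_funs l"
  unfolding poly_funs_def
  by (erule (1) span_mult_closed[rotated 1]) (auto simp: mono_fun_mult intro!: span_base)

lemma one_hom_poly: "1 \<in> hom_polys l 0"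
proof -
  have "mono_fun l (\<lambda>_. 0) = 1" by (simp add: mono_fun_def fun_eq_iff)
  then show ?thesis unfolding hom_polys_def
    by (intro span_base) (auto simp: mono_weight_def intro!: exI[of _ "\<lambda>_. 0"])
qed

lemma coord_fun_hom_poly:
  assumes "k \<in> coords l" shows "coord_fun k \<in> hom_polys l (int (weight k))"
proof -
  define a where "a j = (if j = k then 1 else 0 :: nat)" for j
  have "mono_fun l a p = (\<Prod>j\<in>coords l. if j = k then p j else 1)" for p
    unfolding mono_fun_def a_def by (intro prod.cong) auto
  then have "mono_fun l a = coord_fun k"
    using assms by (simp add: fun_eq_iff coord_fun_def)
  moreover have "mono_weight l a = (\<Sum>j\<in>coords l. if j = k then weight j else 0)"
    unfolding mono_weight_def a_def by (intro sum.cong) auto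
  then have "mono_weight l a = weight k" using assms by simp
  ultimately show ?thesis unfolding hom_polys_def
    by (intro span_base) (auto intro!: exI[of _ a])
qed

lemmas poly_closed =
  subspace_add[OF subspace_poly_funs] subspace_diff[OF subspace_poly_funs]
  subspace_neg[OF subspace_poly_funs] subspace_scale[OF subspace_poly_funs]
  subspace_0[OF subspace_poly_funs] subspace_sum[OF subspace_poly_funs]
  poly_funs_mult hom_polys_subset[OF one_hom_poly] hom_polys_subset[OF coord_fun_hom_poly]

lemma mono_fun_update:
  assumes "i \<in> coords l"
  shows "mono_fun l a (p(i := t)) = t ^ a i * (\<Prod>k\<in>coords l - {i}. p k ^ a k)"
  using assms unfolding mono_fun_def
  by (subst prod.remove[of _ i]) (auto intro!: prod.cong)

lemma mono_fun_has_deriv: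
  "\<exists>D. ((\<lambda>t. mono_fun l a (p(i := t))) has_field_derivative D) (at u)"
proof (cases "i \<in> coords l")
  case True
  show ?thesis unfolding mono_fun_update[OF True]
    by (intro exI) (rule derivative_eq_intros refl)+
next
  case False
  then have "mono_fun l a (p(i := t)) = mono_fun l a p" for t
    unfolding mono_fun_def by (intro prod.cong) auto
  then show ?thesis by (auto intro!: exI[of _ 0])
qed

text \<open>
  Membership in the span is carried along because differentiation is additive only on functions
  known to be differentiable.
\<close>

lemma span_pred_induct:
  fixes A :: "'a::real_vector set"
  assumes f: "f \<in> span A" and base: "\<And>f. f \<in> A \<Longrightarrow> P f" and zero: "P 0"
    and add: "\<And>f g. f \<in> span A \<Longrightarrow> g \<in> span A \<Longrightarrow> P f \<Longrightarrow> P g \<Longrightarrow> P (f + g)"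
    and scale: "\<And>r f. f \<in> span A \<Longrightarrow> P f \<Longrightarrow> P (r *\<^sub>R f)"
  shows "P f"
proof -
  have "span A \<subseteq> {f \<in> span A. P f}"
    by (rule span_minimal)
      (auto simp: subspace_def span_0 span_base span_add span_scale base zero add scale)
  with f show ?thesis by auto
qed

lemma hom_polys_induct:
  assumes "f \<in> hom_polys l d" and "\<And>a. int (mono_weight l a) = d \<Longrightarrow> P (mono_fun l a)" and "P 0"
    and "\<And>f g. f \<in> hom_polys l d \<Longrightarrow> g \<in> hom_polys l d \<Longrightarrow> P f \<Longrightarrow> P g \<Longrightarrow> P (f + g)"
    and "\<And>r f. f \<in> hom_polys l d \<Longrightarrow> P f \<Longrightarrow> P (r *\<^sub>R f)"
  shows "P f"
proof (rule span_pred_induct[OF assms(1)[unfolded hom_polys_def]])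
  show "P f" if "f \<in> {mono_fun l a | a. int (mono_weight l a) = d}" for f
    using that assms(2) by blast
  show "P 0" by (rule assms(3))
  show "P (f + g)" if "f \<in> span {mono_fun l a | a. int (mono_weight l a) = d}"
    "g \<in> span {mono_fun l a | a. int (mono_weight l a) = d}" "P f" "P g" for f g
    using assms(4) that unfolding hom_polys_def by blast
  show "P (r *\<^sub>R f)" if "f \<in> span {mono_fun l a | a. int (mono_weight l a) = d}" "P f" for r f
    using assms(5) that unfolding hom_polys_def by blast
qed

lemma poly_funs_induct:
  assumes "f \<in> poly_funs l" and mono: "\<And>a. P (mono_fun l a)"
    and add: "\<And>f g. f \<in> poly_funs l \<Longrightarrow> g \<in> poly_funs l \<Longrightarrow> P f \<Longrightarrow> P g \<Longrightarrow> P (f + g)"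
    and scale: "\<And>r f. f \<in> poly_funs l \<Longrightarrow> P f \<Longrightarrow> P (r *\<^sub>R f)"
  shows "P f"
proof -
  have "mono_fun l (\<lambda>_. 0) \<in> poly_funs l" unfolding poly_funs_def by (auto intro: span_base)
  from scale[OF this mono, of 0] have P0: "P 0" by simp
  show ?thesis
  proof (rule span_pred_induct[OF assms(1)[unfolded poly_funs_def]])
    show "P f" if "f \<in> range (mono_fun l)" for f using that mono by blast
    show "P 0" by (rule P0)
    show "P (f + g)" if "f \<in> span (range (mono_fun l))" "g \<in> span (range (mono_fun l))" "P f"
        "P g" for f g
      using add that unfolding poly_funs_def by blast
    show "P (r *\<^sub>R f)" if "f \<in> span (range (mono_fun l))" "P f" for r f
      using scale that unfolding poly_funs_def by blast
  qed
qed

lemma mono_fun_hom_poly: "int (mono_weight l a) = d \<Longrightarrow> mono_fun l a \<in> hom_polys l d"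
  unfolding hom_polys_def by (auto intro: span_base)

lemma mono_fun_poly: "mono_fun l a \<in> poly_funs l"
  unfolding poly_funs_def by (auto intro: span_base)

lemma poly_fun_differentiable:
  assumes "f \<in> poly_funs l"
  shows "(\<lambda>t. f (p(i := t))) field_differentiable (at u)"
proof (rule poly_funs_induct[OF assms, where P
    = "\<lambda>f. (\<lambda>t. f (p(i := t))) field_differentiable (at u)"])
  show "(\<lambda>t. mono_fun l a (p(i := t))) field_differentiable (at u)" for a
    unfolding field_differentiable_def by (rule mono_fun_has_deriv)
  show "(\<lambda>t. (f + g) (p(i := t))) field_differentiable (at u)"
    if "(\<lambda>t. f (p(i := t))) field_differentiable (at u)"
        "(\<lambda>t. g (p(i := t))) field_differentiable (at u)" for f g
    unfolding plus_fun_apply by (rule field_differentiable_add[OF that])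
  show "(\<lambda>t. (r *\<^sub>R f) (p(i := t))) field_differentiable (at u)"
    if "(\<lambda>t. f (p(i := t))) field_differentiable (at u)" for r f
    unfolding scaleR_fun_apply real_scaleR_def
    by (rule field_differentiable_mult[OF field_differentiable_const that])
qed

lemma partial_deriv_const [simp]: "partial_deriv i 0 = 0" "partial_deriv i 1 = 0"
  by (simp_all add: partial_deriv_def fun_eq_iff)

lemma partial_deriv_add:
  assumes "f \<in> poly_funs l" "g \<in> poly_funs l"
  shows "partial_deriv i (f + g) = partial_deriv i f + partial_deriv i g"
  unfolding partial_deriv_def
  using assms by (auto simp: fun_eq_iff intro!: deriv_add poly_fun_differentiable)

lemma partial_deriv_scaleR:
  assumes "f \<in> poly_funs l"
  shows "partial_deriv i (r *\<^sub>R f) = r *\<^sub>R partial_deriv i f"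
  unfolding partial_deriv_def
  using assms by (auto simp: fun_eq_iff intro!: deriv_cmult poly_fun_differentiable)

lemma partial_deriv_minus:
  assumes "f \<in> poly_funs l"
  shows "partial_deriv i (- f) = - partial_deriv i f"
  using partial_deriv_scaleR[OF assms, of i "-1"] by simp

lemma partial_deriv_diff:
  assumes "f \<in> poly_funs l" "g \<in> poly_funs l"
  shows "partial_deriv i (f - g) = partial_deriv i f - partial_deriv i g"
  using partial_deriv_add[OF assms(1) poly_closed(3)[OF assms(2)], of i] partial_deriv_minus[OF
      assms(2)]
  by simp

lemma partial_deriv_mult:
  assumes "f \<in> poly_funs l" "g \<in> poly_funs l"
  shows "partial_deriv i (f * g) = f * partial_deriv i g + partial_deriv i f * g"
  unfolding partial_deriv_def
  using assms by (auto simp: fun_eq_iff deriv_mult poly_fun_differentiable)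

lemma partial_deriv_sum:
  assumes "\<And>k. k \<in> A \<Longrightarrow> f k \<in> poly_funs l"
  shows "partial_deriv i (\<Sum>k\<in>A. f k) = (\<Sum>k\<in>A. partial_deriv i (f k))"
  using assms
  by (induction A rule: infinite_finite_induct)
    (auto simp: partial_deriv_add[of _ l] poly_closed)

lemma partial_deriv_coord_fun: "partial_deriv i (coord_fun k) = (if i = k then 1 else 0)"
  by (auto simp: partial_deriv_def coord_fun_def fun_eq_iff)

lemma partial_deriv_mono_fun:
  "partial_deriv i (mono_fun l a) =
    (if i \<in> coords l then real (a i) *\<^sub>R mono_fun l (a(i := a i - 1)) else 0)"
proof (cases "i \<in> coords l")
  case True
  have "partial_deriv i (mono_fun l a) p = real (a i) * mono_fun l (a(i := a i - 1)) p" for p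
  proof -
    have "deriv (\<lambda>t. t ^ a i * (\<Prod>k\<in>coords l - {i}. p k ^ a k)) (p i)
        = real (a i) * p i ^ (a i - 1) * (\<Prod>k\<in>coords l - {i}. p k ^ a k)"
      by (rule DERIV_imp_deriv) (auto intro!: derivative_eq_intros)
    moreover have "mono_fun l (a(i := a i - 1)) p
        = p i ^ (a i - 1) * (\<Prod>k\<in>coords l - {i}. p k ^ a k)"
      using mono_fun_update[OF True, of "a(i := a i - 1)" p "p i"] by (simp add: fun_upd_triv)
    ultimately show ?thesis unfolding partial_deriv_def mono_fun_update[OF True] by simp
  qed
  with True show ?thesis by (simp add: fun_eq_iff)
next
  case False
  then have "mono_fun l a (p(i := t)) = mono_fun l a p" for t p
    unfolding mono_fun_def by (intro prod.cong) auto
  with False show ?thesis by (simp add: partial_deriv_def fun_eq_iff)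
qed

lemma partial_deriv_hom_poly:
  assumes f: "f \<in> hom_polys l d"
  shows "partial_deriv i f \<in> hom_polys l (d - int (weight i))"
proof (rule hom_polys_induct[OF f])
  fix a assume a: "int (mono_weight l a) = d"
  show "partial_deriv i (mono_fun l a) \<in> hom_polys l (d - int (weight i))"
  proof (cases "i \<in> coords l \<and> a i \<noteq> 0")
    case True
    have "mono_weight l a = weight i * a i + (\<Sum>k\<in>coords l - {i}. weight k * a k)"
      unfolding mono_weight_def using True sum.remove[of "coords l" i "\<lambda>k. weight k * a k"] by simp
    moreover have "mono_weight l (a(i := a i - 1))
        = weight i * (a i - 1) + (\<Sum>k\<in>coords l - {i}. weight k * a k)"
      unfolding mono_weight_def
      using True sum.remove[of "coords l" i "\<lambda>k. weight k * (a(i := a i - 1)) k"] by simp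
    moreover have "weight i * a i = weight i * (a i - 1) + weight i"
      using True by (cases "a i") auto
    ultimately have "int (mono_weight l (a(i := a i - 1))) = d - int (weight i)"
      using a by linarith
    then show ?thesis
      unfolding partial_deriv_mono_fun
      by (simp add: subspace_0 subspace_scale mono_fun_hom_poly)
  next
    case False
    then have "partial_deriv i (mono_fun l a) = 0" by (auto simp: partial_deriv_mono_fun)
    then show ?thesis by (simp add: subspace_0)
  qed
next
  fix f g assume "f \<in> hom_polys l d" "g \<in> hom_polys l d"
    "partial_deriv i f \<in> hom_polys l (d - int (weight i))"
        "partial_deriv i g \<in> hom_polys l (d - int (weight i))"
  then show "partial_deriv i (f + g) \<in> hom_polys l (d - int (weight i))"
    by (simp add: partial_deriv_add[of _ l] hom_polys_subset subspace_add)
next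
  fix r f assume "f \<in> hom_polys l d" "partial_deriv i f \<in> hom_polys l (d - int (weight i))"
  then show "partial_deriv i (r *\<^sub>R f) \<in> hom_polys l (d - int (weight i))"
    by (simp add: partial_deriv_scaleR[of _ l] hom_polys_subset subspace_scale)
next
  show "partial_deriv i 0 \<in> hom_polys l (d - int (weight i))" by (simp add: subspace_0)
qed

lemma partial_deriv_poly:
  assumes "f \<in> poly_funs l" shows "partial_deriv i f \<in> poly_funs l"
proof (rule poly_funs_induct[OF assms])
  show "partial_deriv i (mono_fun l a) \<in> poly_funs l" for a
    unfolding partial_deriv_mono_fun by (simp add: poly_closed mono_fun_poly)
  show "partial_deriv i (f + g) \<in> poly_funs l" if "f \<in> poly_funs l" "g \<in> poly_funs l"
    "partial_deriv i f \<in> poly_funs l" "partial_deriv i g \<in> poly_funs l" for f g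
    using that by (simp add: partial_deriv_add[of _ l] poly_closed)
  show "partial_deriv i (r *\<^sub>R f) \<in> poly_funs l"
      if "f \<in> poly_funs l" "partial_deriv i f \<in> poly_funs l" for r f
    using that by (simp add: partial_deriv_scaleR[of _ l] poly_closed)
qed

lemma partial_deriv_commute:
  assumes "f \<in> poly_funs l"
  shows "partial_deriv i (partial_deriv j f) = partial_deriv j (partial_deriv i f)"
proof (rule poly_funs_induct[OF assms])
  show "partial_deriv i (partial_deriv j (mono_fun l a))
      = partial_deriv j (partial_deriv i (mono_fun l a))" for a
    by (cases "i = j")
      (simp_all add: partial_deriv_mono_fun partial_deriv_scaleR[of _ l] mono_fun_poly
          fun_upd_twist mult.commute)
  show "partial_deriv i (partial_deriv j (f + g)) = partial_deriv j (partial_deriv i (f + g))"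
    if "f \<in> poly_funs l" "g \<in> poly_funs l" "partial_deriv i (partial_deriv j f)
        = partial_deriv j (partial_deriv i f)"
      "partial_deriv i (partial_deriv j g) = partial_deriv j (partial_deriv i g)" for f g
    using that by (simp add: partial_deriv_add[of _ l] partial_deriv_poly)
  show "partial_deriv i (partial_deriv j (r *\<^sub>R f)) = partial_deriv j (partial_deriv i (r *\<^sub>R f))"
    if "f \<in> poly_funs l" "partial_deriv i (partial_deriv j f)
        = partial_deriv j (partial_deriv i f)" for r f
    using that by (simp add: partial_deriv_scaleR[of _ l] partial_deriv_poly)
qed

lemma euler_identity:
  assumes f: "f \<in> hom_polys l d"
  shows "(\<Sum>k\<in>coords l. real (weight k) *\<^sub>R (coord_fun k * partial_deriv k f)) = of_int d *\<^sub>R f"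
proof (rule hom_polys_induct[OF f])
  fix a assume a: "int (mono_weight l a) = d"
  have "coord_fun k * partial_deriv k (mono_fun l a) = real (a k) *\<^sub>R mono_fun l a"
    if k: "k \<in> coords l" for k
  proof (cases "a k")
    case 0
    with k show ?thesis by (simp add: partial_deriv_mono_fun)
  next
    case (Suc n)
    have "p k * mono_fun l (a(k := n)) p = mono_fun l a p" for p
      using mono_fun_update[OF k, of "a(k := n)" p "p k"] mono_fun_update[OF k, of a p "p k"] Suc
      by (simp add: fun_upd_triv)
    then show ?thesis using Suc k
      by (simp add: partial_deriv_mono_fun fun_eq_iff coord_fun_def)
  qed
  then have "(\<Sum>k\<in>coords l. real (weight k) *\<^sub>R (coord_fun k * partial_deriv k (mono_fun l a)))
      = (\<Sum>k\<in>coords l. real (weight k * a k) *\<^sub>R mono_fun l a)"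
    by (intro sum.cong) simp_all
  also have "\<dots> = of_int d *\<^sub>R mono_fun l a"
    using a unfolding mono_weight_def scaleR_sum_left[symmetric] of_nat_sum[symmetric] by auto
  finally show "(\<Sum>k\<in>coords l. real (weight k) *\<^sub>R (coord_fun k * partial_deriv k (mono_fun l a)))
    = of_int d *\<^sub>R mono_fun l a" .
next
  fix f g
  assume "f \<in> hom_polys l d" "g \<in> hom_polys l d"
    and "(\<Sum>k\<in>coords l. real (weight k) *\<^sub>R (coord_fun k * partial_deriv k f)) = of_int d *\<^sub>R f"
    and "(\<Sum>k\<in>coords l. real (weight k) *\<^sub>R (coord_fun k * partial_deriv k g)) = of_int d *\<^sub>R g"
  then show "(\<Sum>k\<in>coords l. real (weight k) *\<^sub>R (coord_fun k * partial_deriv k (f + g)))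
      = of_int d *\<^sub>R (f + g)"
    by (simp add: partial_deriv_add[of _ l] hom_polys_subset distrib_left scaleR_add_right
        sum.distrib)
next
  fix r f
  assume f: "f \<in> hom_polys l d"
    and eq: "(\<Sum>k\<in>coords l. real (weight k) *\<^sub>R (coord_fun k * partial_deriv k f)) = of_int d *\<^sub>R f"
  have "(\<Sum>k\<in>coords l. real (weight k) *\<^sub>R (coord_fun k * partial_deriv k (r *\<^sub>R f)))
      = r *\<^sub>R (\<Sum>k\<in>coords l. real (weight k) *\<^sub>R (coord_fun k * partial_deriv k f))"
    using f by (simp add: partial_deriv_scaleR[of _ l] hom_polys_subset scaleR_sum_right
        mult.commute)
  then show "(\<Sum>k\<in>coords l. real (weight k) *\<^sub>R (coord_fun k * partial_deriv k (r *\<^sub>R f)))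
      = of_int d *\<^sub>R (r *\<^sub>R f)"
    unfolding eq by (simp add: mult.commute)
next
  show "(\<Sum>k\<in>coords l. real (weight k) *\<^sub>R (coord_fun k * partial_deriv k 0)) = of_int d *\<^sub>R 0"
    by simp
qed

lemma hom_poly_zero_partials:
  assumes "f \<in> hom_polys l d" "d \<noteq> 0" "\<And>k. k \<in> coords l \<Longrightarrow> partial_deriv k f = 0"
  shows "f = 0"
  using euler_identity[OF assms(1)] assms(2,3) by simp

lemma hom_polys_negative:
  assumes "d < 0" "f \<in> hom_polys l d" shows "f = 0"
proof -
  have "{mono_fun l a | a. int (mono_weight l a) = d} = {}" using assms(1) by auto
  then show ?thesis using assms(2) unfolding hom_polys_def by simp
qed

lemma hom_polys_zero:
  assumes "f \<in> hom_polys l 0" shows "f = f 0 *\<^sub>R 1"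
proof -
  have "mono_fun l a = 1" if "mono_weight l a = 0" for a
  proof -
    have "a k = 0" if "k \<in> coords l" for k
      using that \<open>mono_weight l a = 0\<close> weight_pos[of k] unfolding mono_weight_def by auto
    then show ?thesis unfolding mono_fun_def by (simp add: fun_eq_iff)
  qed
  then have "{mono_fun l a | a. int (mono_weight l a) = 0} \<subseteq> {1}" by auto
  then have "hom_polys l 0 \<subseteq> span {1}"
    unfolding hom_polys_def by (rule span_mono)
  then obtain r where "f = r *\<^sub>R 1" using assms by (auto simp: span_singleton)
  then show ?thesis by (simp add: fun_eq_iff)
qed

text \<open>
  Dilations separate the degrees: they act on each of them by a different scalar.
\<close>

lemma hom_poly_dilation:
  assumes f: "f \<in> hom_polys l d"
  shows "f (\<lambda>k. 2 ^ weight k * p k) = 2 powr (of_int d) * f p"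
proof -
  have "hom_polys l d \<subseteq> {f. \<forall>p. f (\<lambda>k. 2 ^ weight k * p k) = 2 powr (of_int d) * f p}"
    unfolding hom_polys_def
  proof (intro span_minimal)
    show "{mono_fun l a | a. int (mono_weight l a) = d}
        \<subseteq> {f. \<forall>p. f (\<lambda>k. 2 ^ weight k * p k) = 2 powr (of_int d) * f p}"
    proof clarsimp
      fix a p assume d: "d = int (mono_weight l a)"
      have "2 powr (of_int d) = (2::real) ^ mono_weight l a"
        unfolding d using powr_realpow[of 2] by simp
      also have "\<dots> = (\<Prod>k\<in>coords l. (2 ^ weight k) ^ a k)"
        unfolding mono_weight_def power_sum by (simp add: power_mult)
      finally show "mono_fun l a (\<lambda>k. 2 ^ weight k * p k)
          = 2 powr real (mono_weight l a) * mono_fun l a p"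
        unfolding d by (simp add: mono_fun_def power_mult_distrib prod.distrib)
    qed
  qed (auto simp: subspace_def distrib_left)
  with f show ?thesis by auto
qed

lemma fd_subspace_hom_polys: "fd_subspace (hom_polys l d)"
proof -
  have "mono_fun l a \<in> mono_fun l ` (PiE (coords l) (\<lambda>_. {..nat d}))"
    if "int (mono_weight l a) = d" for a
  proof (rule image_eqI)
    show "mono_fun l a = mono_fun l (restrict a (coords l))"
      unfolding mono_fun_def by (intro ext prod.cong) auto
    have "a k \<le> nat d" if k: "k \<in> coords l" for k
    proof -
      have "a k \<le> weight k * a k" using weight_pos[of k] by simp
      also have "\<dots> \<le> mono_weight l a"
        unfolding mono_weight_def by (rule member_le_sum[OF k]) auto
      finally show ?thesis using \<open>int (mono_weight l a) = d\<close> by simp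
    qed
    then show "restrict a (coords l) \<in> PiE (coords l) (\<lambda>_. {..nat d})" by auto
  qed
  then have "finite {mono_fun l a | a. int (mono_weight l a) = d}"
    by (rule_tac finite_subset[of _ "mono_fun l ` (PiE (coords l) (\<lambda>_. {..nat d}))"])
      (auto intro!: finite_PiE finite_imageI)
  then show ?thesis unfolding fd_subspace_def hom_polys_def by blast
qed

section \<open>Polynomial vector fields\<close>

definition comp_field :: "coord \<Rightarrow> (point \<Rightarrow> real) \<Rightarrow> vfield"
  where "comp_field j f = (\<lambda>k. if k = j then f else 0)"

lemma linear_comp_field: "linear (comp_field j)"
  by (rule linearI) (auto simp: comp_field_def fun_eq_iff)

lemma monomial_field_eq: "monomial_field l a i = comp_field i (mono_fun l a)"
  by (auto simp: monomial_field_def comp_field_def mono_fun_def fun_eq_iff)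

lemma field_decomposition:
  assumes "\<And>j. j \<notin> coords l \<Longrightarrow> X j = 0"
  shows "X = (\<Sum>j\<in>coords l. comp_field j (X j))"
proof
  fix k
  have "(\<Sum>j\<in>coords l. comp_field j (X j)) k = (\<Sum>j\<in>coords l. comp_field j (X j) k)"
    by (rule sum_fun_apply)
  also have "\<dots> = (\<Sum>j\<in>coords l. if j = k then X k else 0)"
    by (rule sum.cong) (auto simp: comp_field_def)
  finally show "X k = (\<Sum>j\<in>coords l. comp_field j (X j)) k" using assms[of k] by simp
qed

lemma span_fields_iff:
  fixes A :: "coord \<Rightarrow> (point \<Rightarrow> real) set"
  shows "X \<in> span {comp_field i f | i f. i \<in> coords l \<and> f \<in> A i} \<longleftrightarrow>
    (\<forall>j\<in>coords l. X j \<in> span (A j)) \<and> (\<forall>j. j \<notin> coords l \<longrightarrow> X j = 0)" (is "_ \<in> span ?G \<longleftrightarrow> ?R X")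
proof
  have "span ?G \<subseteq> {X. ?R X}"
  proof (rule span_minimal)
    show "?G \<subseteq> {X. ?R X}" by (auto simp: comp_field_def intro: span_base span_0)
    show "subspace {X. ?R X}"
      by (auto simp: subspace_def span_0 span_add span_scale)
  qed
  then show "X \<in> span ?G \<Longrightarrow> ?R X" by blast
next
  assume R: "?R X"
  have "comp_field j (X j) \<in> span ?G" if j: "j \<in> coords l" for j
  proof -
    have "comp_field j ` span (A j) = span (comp_field j ` A j)"
      by (rule linear_span_image[OF linear_comp_field, symmetric])
    also have "\<dots> \<subseteq> span ?G" using j by (intro span_mono) auto
    finally show ?thesis using R j by auto
  qed
  then show "X \<in> span ?G"
    using field_decomposition[of l X] R by (metis (no_types, lifting) span_sum)
qed

lemma polynomial_fields_iff:
  "X \<in> polynomial_fields l \<longleftrightarrow>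
    (\<forall>j\<in>coords l. X j \<in> poly_funs l) \<and> (\<forall>j. j \<notin> coords l \<longrightarrow> X j = 0)"
proof -
  have "{monomial_field l a i | a i. i \<in> coords l}
      = {comp_field i f | i f. i \<in> coords l \<and> f \<in> range (mono_fun l)}"
    unfolding monomial_field_eq by auto
  then show ?thesis unfolding polynomial_fields_def poly_funs_def
    using span_fields_iff[of X l "\<lambda>_. range (mono_fun l)"] by simp
qed

lemma homogeneous_fields_iff:
  "X \<in> homogeneous_fields l d \<longleftrightarrow>
    (\<forall>j\<in>coords l. X j \<in> hom_polys l (d + int (weight j))) \<and> (\<forall>j. j \<notin> coords l \<longrightarrow> X j = 0)"
proof -
  have "{monomial_field l a i | a i. i \<in> coords l \<and>
      int (\<Sum>k\<in>coords l. weight k * a k) - int (weight i) = d}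
      = {comp_field i f | i f. i \<in> coords l \<and>
          f \<in> {mono_fun l a | a. int (mono_weight l a) = d + int (weight i)}}"
    unfolding monomial_field_eq mono_weight_def[symmetric] by fastforce
  then show ?thesis unfolding homogeneous_fields_def hom_polys_def
    using span_fields_iff[of X l "\<lambda>i. {mono_fun l a | a. int (mono_weight l a)
        = d + int (weight i)}"]
    by simp
qed

lemma subspace_polynomial_fields [simp]: "subspace (polynomial_fields l)"
  and subspace_homogeneous_fields [simp]: "subspace (homogeneous_fields l d)"
  by (simp_all add: polynomial_fields_def homogeneous_fields_def)

lemma homogeneous_fields_subset: "X \<in> homogeneous_fields l d \<Longrightarrow> X \<in> polynomial_fields l"
  unfolding homogeneous_fields_iff polynomial_fields_iff by (auto intro: hom_polys_subset)

lemma independent_homogeneous_fields: "independent_family UNIV (homogeneous_fields l)"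
proof -
  \<comment> \<open>the pullback by a dilation, which has the homogeneous fields as eigenvectors\<close>
  define E :: "vfield \<Rightarrow> vfield"
    where "E X = (\<lambda>j p. X j (\<lambda>k. 2 ^ weight k * p k) / 2 ^ weight j)" for X
  show ?thesis
  proof (rule independent_family_eigenspaces[where E = E and ev = "\<lambda>d. 2 powr (of_int d)"])
    show "linear E" by (rule linearI) (auto simp: E_def fun_eq_iff add_divide_distrib)
    show "inj_on (\<lambda>d. 2 powr real_of_int d) UNIV" by (rule inj_onI) (simp add: powr_inj)
    fix d X assume X: "X \<in> homogeneous_fields l d"
    have "E X j p = 2 powr (of_int d) * X j p" for j p
    proof (cases "j \<in> coords l")
      case True
      then have "X j (\<lambda>k. 2 ^ weight k * p k) = 2 powr (of_int (d + int (weight j))) * X j p"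
        using X unfolding homogeneous_fields_iff by (intro hom_poly_dilation) auto
      then show ?thesis by (simp add: E_def powr_add powr_realpow)
    next
      case False
      then show ?thesis using X unfolding homogeneous_fields_iff by (simp add: E_def)
    qed
    then show "E X = 2 powr (of_int d) *\<^sub>R X" by (simp add: fun_eq_iff)
  qed simp
qed

lemma fd_subspace_homogeneous_fields: "fd_subspace (homogeneous_fields l d)"
proof -
  have "\<exists>B. finite B \<and> span B = hom_polys l e" for e
    using fd_subspace_hom_polys unfolding fd_subspace_def by blast
  then obtain B where B: "\<And>e. finite (B e)" "\<And>e. span (B e) = hom_polys l e" by metis
  let ?G = "{comp_field i f | i f. i \<in> coords l \<and> f \<in> B (d + int (weight i))}"
  have "?G = (\<Union>i\<in>coords l. comp_field i ` B (d + int (weight i)))" by auto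
  then have "finite ?G" using B(1) by simp
  moreover have "span ?G = homogeneous_fields l d"
    using span_fields_iff[of _ l "\<lambda>i. B (d + int (weight i))"] homogeneous_fields_iff
    by (auto simp: B(2))
  ultimately show ?thesis unfolding fd_subspace_def by blast
qed

definition field_action :: "nat \<Rightarrow> vfield \<Rightarrow> (point \<Rightarrow> real) \<Rightarrow> point \<Rightarrow> real"
  where "field_action l X f = (\<Sum>i\<in>coords l. X i * partial_deriv i f)"

lemma field_bracket_eq:
  "field_bracket l X Y = (\<lambda>j. field_action l X (Y j) - field_action l Y (X j))"
  by (auto simp: field_bracket_def field_action_def fun_eq_iff sum_fun_apply sum_subtractf)

lemma field_action_poly:
  "X \<in> polynomial_fields l \<Longrightarrow> f \<in> poly_funs l \<Longrightarrow> field_action l X f \<in> poly_funs l"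
  unfolding field_action_def polynomial_fields_iff
  by (auto intro!: poly_closed(6,7) partial_deriv_poly)

lemma field_action_hom_poly:
  assumes "X \<in> homogeneous_fields l d" "f \<in> hom_polys l e"
  shows "field_action l X f \<in> hom_polys l (d + e)"
  unfolding field_action_def
proof (rule subspace_sum)
  fix i assume "i \<in> coords l"
  then have "X i * partial_deriv i f \<in> hom_polys l (d + int (weight i) + (e - int (weight i)))"
    using assms unfolding homogeneous_fields_iff
        by (intro hom_polys_mult partial_deriv_hom_poly) auto
  then show "X i * partial_deriv i f \<in> hom_polys l (d + e)" by simp
qed simp

lemma field_action_add_left: "field_action l (X + Y) f = field_action l X f + field_action l Y f"
  by (simp add: field_action_def distrib_right sum.distrib)

lemma field_action_scaleR_left: "field_action l (r *\<^sub>R X) f = r *\<^sub>R field_action l X f"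
  by (simp add: field_action_def scaleR_sum_right)

lemma field_action_zero [simp]: "field_action l X 0 = 0" "field_action l X 1 = 0"
  by (simp_all add: field_action_def)

lemma field_action_scaleR:
  "f \<in> poly_funs l \<Longrightarrow> field_action l X (r *\<^sub>R f) = r *\<^sub>R field_action l X f"
  by (simp add: field_action_def partial_deriv_scaleR[of _ l] scaleR_sum_right)

lemma field_action_add:
  "f \<in> poly_funs l \<Longrightarrow> g \<in> poly_funs l \<Longrightarrow> field_action l X (f + g)
      = field_action l X f + field_action l X g"
  by (simp add: field_action_def partial_deriv_add[of _ l] distrib_left sum.distrib)

lemma field_action_diff:
  "f \<in> poly_funs l \<Longrightarrow> g \<in> poly_funs l \<Longrightarrow> field_action l X (f - g)
      = field_action l X f - field_action l X g"
  by (simp add: field_action_def partial_deriv_diff[of _ l] right_diff_distrib sum_subtractf)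

lemma field_action_mult:
  "f \<in> poly_funs l \<Longrightarrow> g \<in> poly_funs l \<Longrightarrow>
    field_action l X (f * g) = f * field_action l X g + field_action l X f * g"
  by (simp add: field_action_def partial_deriv_mult[of _ l] sum.distrib sum_distrib_left
      sum_distrib_right
      algebra_simps)

lemma field_action_sum:
  "(\<And>k. k \<in> A \<Longrightarrow> f k \<in> poly_funs l) \<Longrightarrow>
    field_action l X (\<Sum>k\<in>A. f k) = (\<Sum>k\<in>A. field_action l X (f k))"
  by (induction A rule: infinite_finite_induct)
    (auto simp: field_action_add poly_closed)

lemma field_action_coord_fun: "k \<in> coords l \<Longrightarrow> field_action l X (coord_fun k) = X k"
proof -
  assume k: "k \<in> coords l"
  have "field_action l X (coord_fun k) = (\<Sum>i\<in>coords l. if i = k then X k else 0)"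
    unfolding field_action_def partial_deriv_coord_fun by (intro sum.cong) auto
  then show ?thesis using k by simp
qed

lemma field_action_comp_field:
  "j \<in> coords l \<Longrightarrow> field_action l (comp_field j h) f = h * partial_deriv j f"
proof -
  assume j: "j \<in> coords l"
  have "field_action l (comp_field j h) f = (\<Sum>i\<in>coords l.
      if i = j then h * partial_deriv j f else 0)"
    unfolding field_action_def comp_field_def by (intro sum.cong) auto
  then show ?thesis using j by simp
qed

text \<open>
  The terms with second derivatives cancel because partial derivatives commute.
\<close>

lemma field_action_bracket:
  assumes X: "X \<in> polynomial_fields l" and Y: "Y \<in> polynomial_fields l" and f: "f \<in> poly_funs l"
  shows "field_action l (field_bracket l X Y) f
    = field_action l X (field_action l Y f) - field_action l Y (field_action l X f)"
proof -
  have second: "field_action l X (field_action l Y f) =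
      (\<Sum>i\<in>coords l. field_action l X (Y i) * partial_deriv i f)
      + (\<Sum>i\<in>coords l. \<Sum>j\<in>coords l. Y i * X j * partial_deriv j (partial_deriv i f))"
    if "X \<in> polynomial_fields l" "Y \<in> polynomial_fields l" for X Y
  proof -
    have Yi: "Y i \<in> poly_funs l" if "i \<in> coords l" for i
      using \<open>Y \<in> polynomial_fields l\<close> that unfolding polynomial_fields_iff by blast
    have "field_action l X (field_action l Y f)
        = (\<Sum>i\<in>coords l. field_action l X (Y i * partial_deriv i f))"
      unfolding field_action_def[of l Y] using Yi f
      by (intro field_action_sum) (auto intro!: poly_closed(7) partial_deriv_poly)
    also have "\<dots> = (\<Sum>i\<in>coords l. Y i * field_action l X (partial_deriv i f) + field_action l X
        (Y i) * partial_deriv i f)"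
      using Yi f by (intro sum.cong field_action_mult partial_deriv_poly) auto
    finally show ?thesis
      by (simp add: sum.distrib add.commute field_action_def[of l X
          "partial_deriv _ f"] sum_distrib_left mult.assoc)
  qed
  have "(\<Sum>i\<in>coords l. \<Sum>j\<in>coords l. Y i * X j * partial_deriv j (partial_deriv i f))
      = (\<Sum>i\<in>coords l. \<Sum>j\<in>coords l. X i * Y j * partial_deriv j (partial_deriv i f))"
    by (subst sum.swap) (simp add: mult.commute[of "X _"] partial_deriv_commute[OF f])
  then have "field_action l X (field_action l Y f) - field_action l Y (field_action l X f)
      = (\<Sum>i\<in>coords l. field_action l X (Y i) * partial_deriv i f)
        - (\<Sum>i\<in>coords l. field_action l Y (X i) * partial_deriv i f)"
    unfolding second[OF X Y] second[OF Y X] by simp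
  also have "\<dots> = field_action l (field_bracket l X Y) f"
    unfolding field_action_def[of l "field_bracket l X Y"]
    unfolding field_bracket_eq
    by (simp add: left_diff_distrib sum_subtractf)
  finally show ?thesis by simp
qed

lemma field_bracket_polynomial:
  assumes "X \<in> polynomial_fields l" "Y \<in> polynomial_fields l"
  shows "field_bracket l X Y \<in> polynomial_fields l"
  using assms field_action_poly[of X l] field_action_poly[of Y l]
  unfolding polynomial_fields_iff[of "field_bracket l X Y"] field_bracket_eq
  by (auto simp: polynomial_fields_iff intro!: poly_closed(2))

lemma field_bracket_homogeneous:
  assumes X: "X \<in> homogeneous_fields l d" and Y: "Y \<in> homogeneous_fields l e"
  shows "field_bracket l X Y \<in> homogeneous_fields l (d + e)"
  unfolding homogeneous_fields_iff field_bracket_eq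
proof (intro conjI ballI allI impI)
  fix j assume j: "j \<in> coords l"
  have "field_action l X (Y j) \<in> hom_polys l (d + (e + int (weight j)))"
    using X Y j by (intro field_action_hom_poly) (auto simp: homogeneous_fields_iff)
  moreover have "field_action l Y (X j) \<in> hom_polys l (e + (d + int (weight j)))"
    using X Y j by (intro field_action_hom_poly) (auto simp: homogeneous_fields_iff)
  ultimately show "field_action l X (Y j) - field_action l Y (X j) \<in> hom_polys l (d + e + int
      (weight j))"
    by (intro subspace_diff) (simp_all add: algebra_simps)
next
  fix j assume "j \<notin> coords l"
  then show "field_action l X (Y j) - field_action l Y (X j) = 0"
    using X Y by (simp add: homogeneous_fields_iff)
qed

lemma polynomial_field_component:
  "X \<in> polynomial_fields l \<Longrightarrow> X j \<in> poly_funs l"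
  unfolding polynomial_fields_iff by (cases "j \<in> coords l") (auto intro: poly_closed)

lemma field_bracket_bilinear:
  "bilinear_on (polynomial_fields l) (polynomial_fields l) (field_bracket l)"
  unfolding bilinear_on_def field_bracket_eq
  by (auto simp: fun_eq_iff field_action_add_left field_action_scaleR_left field_action_add
      field_action_scaleR polynomial_field_component scaleR_diff_right right_diff_distrib)

lemma field_bracket_self: "field_bracket l X X = 0"
  by (simp add: field_bracket_eq fun_eq_iff)

lemma field_bracket_skew: "field_bracket l X Y = - field_bracket l Y X"
  by (simp add: field_bracket_eq fun_eq_iff)

lemma field_bracket_jacobi:
  assumes X: "X \<in> polynomial_fields l" and Y: "Y \<in> polynomial_fields l"
      and Z: "Z \<in> polynomial_fields l"
  shows "field_bracket l X (field_bracket l Y Z) + field_bracket l Y (field_bracket l Z X)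
    + field_bracket l Z (field_bracket l X Y) = 0"
proof -
  note c = polynomial_field_component[OF X] polynomial_field_component[OF Y]
      polynomial_field_component[OF Z]
  have "(field_bracket l X (field_bracket l Y Z) + field_bracket l Y (field_bracket l Z X)
    + field_bracket l Z (field_bracket l X Y)) j = 0" for j
    using c[of j]
    by (simp add: field_bracket_eq[of l X "field_bracket l Y Z"] field_bracket_eq[of l Y
        "field_bracket l Z X"]
        field_bracket_eq[of l Z "field_bracket l X Y"] field_action_bracket X Y Z)
      (simp add: field_bracket_eq field_action_diff field_action_poly X Y Z)
  then show ?thesis by (simp add: fun_eq_iff)
qed

section \<open>The contact algebra\<close>

lemma contact_form_eq: "contact_form l X = X Cz - (\<Sum>i<l. coord_fun (Cy i) * X (Cx i))"
  by (auto simp: contact_form_def coord_fun_def fun_eq_iff sum_fun_apply)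

lemma contact_form_add: "contact_form l (X + Y) = contact_form l X + contact_form l Y"
  and contact_form_diff: "contact_form l (X - Y) = contact_form l X - contact_form l Y"
  and contact_form_scaleR: "contact_form l (r *\<^sub>R X) = r *\<^sub>R contact_form l X"
  and contact_form_zero [simp]: "contact_form l 0 = 0"
  by (simp_all add: contact_form_eq distrib_left right_diff_distrib sum.distrib sum_subtractf
      scaleR_diff_right scaleR_sum_right)

lemma contact_form_sum: "contact_form l (\<Sum>i\<in>A. X i) = (\<Sum>i\<in>A. contact_form l (X i))"
proof -
  have "linear (contact_form l)" by (rule linearI)
      (simp_all only: contact_form_add contact_form_scaleR)
  then show ?thesis by (rule linear_sum)
qed

lemma homogeneous_field_component:
  "X \<in> homogeneous_fields l d \<Longrightarrow> j \<in> coords l \<Longrightarrow> X j \<in> hom_polys l (d + int (weight j))"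
  unfolding homogeneous_fields_iff by blast

lemma contact_form_hom_poly:
  assumes X: "X \<in> homogeneous_fields l d"
  shows "contact_form l X \<in> hom_polys l (d + 2)"
proof -
  have "coord_fun (Cy i) * X (Cx i) \<in> hom_polys l (int (weight (Cy i)) + (d + int (weight
      (Cx i))))" if "i < l" for i
    using homogeneous_field_component[OF X, of "Cx i"] that
    by (intro hom_polys_mult coord_fun_hom_poly) auto
  moreover have "X Cz \<in> hom_polys l (d + 2)" using homogeneous_field_component[OF X, of Cz] by simp
  ultimately show ?thesis unfolding contact_form_eq
    by (intro subspace_diff subspace_sum) (auto simp: add.commute)
qed

text \<open>
  This is Cartan's formula for the exterior derivative of the contact form \<open>dz - \<Sum> y\<^sub>i dx\<^sub>i\<close>; the
      sum is
  the contribution of \<open>\<Sum> dx\<^sub>i \<and> dy\<^sub>i\<close>.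
\<close>

lemma contact_form_bracket:
  assumes X: "X \<in> polynomial_fields l" and Y: "Y \<in> polynomial_fields l"
  shows "contact_form l (field_bracket l X Y)
    = field_action l X (contact_form l Y) - field_action l Y (contact_form l X)
      + (\<Sum>i<l. X (Cy i) * Y (Cx i) - Y (Cy i) * X (Cx i))"
proof -
  have act: "field_action l X (contact_form l Y) = field_action l X (Y Cz)
      - (\<Sum>i<l. coord_fun (Cy i) * field_action l X (Y (Cx i)) + X (Cy i) * Y (Cx i))"
    if "Y \<in> polynomial_fields l" for X Y
  proof -
    note c = polynomial_field_component[OF that]
    have "field_action l X (\<Sum>i<l. coord_fun (Cy i) * Y (Cx i))
        = (\<Sum>i<l. field_action l X (coord_fun (Cy i) * Y (Cx i)))"
      using c by (intro field_action_sum poly_closed) auto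
    also have "\<dots> = (\<Sum>i<l. coord_fun (Cy i) * field_action l X (Y (Cx i)) + X (Cy i) * Y (Cx i))"
      using c by (intro sum.cong) (simp_all add: field_action_mult poly_closed
          field_action_coord_fun)
    finally show ?thesis unfolding contact_form_eq
      using c by (subst field_action_diff) (auto intro!: poly_closed)
  qed
  show ?thesis
    unfolding act[OF Y] act[OF X] contact_form_eq[of l "field_bracket l X Y"]
    unfolding field_bracket_eq
    by (simp add: sum.distrib sum_subtractf right_diff_distrib)
qed

text \<open>
  The fields on which the contact form vanishes are spanned
      by \<open>\<partial>\<^sub>x\<^sub>i + y\<^sub>i \<partial>\<^sub>z\<close> and \<open>\<partial>\<^sub>y\<^sub>i\<close>. The right-hand
  side is linear over functions in \<open>S\<close>, with one coefficient for each of these fields.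
\<close>

lemma contact_form_bracket_section:
  assumes X: "X \<in> polynomial_fields l" and S: "S \<in> polynomial_fields l"
      and 0: "contact_form l S = 0"
  defines "f \<equiv> contact_form l X"
  shows "contact_form l (field_bracket l X S)
    = (\<Sum>i<l. S (Cx i) * (X (Cy i) - partial_deriv (Cx i) f - coord_fun (Cy i) * partial_deriv Cz f)
         - S (Cy i) * (X (Cx i) + partial_deriv (Cy i) f))"
proof -
  have Sz: "S Cz = (\<Sum>i<l. coord_fun (Cy i) * S (Cx i))" using 0 unfolding contact_form_eq by simp
  have "field_action l S f = (\<Sum>i<l. S (Cx i) * partial_deriv (Cx i) f)
      + (\<Sum>i<l. S (Cy i) * partial_deriv (Cy i) f)
      + (\<Sum>i<l. coord_fun (Cy i) * S (Cx i) * partial_deriv Cz f)"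
    unfolding field_action_def sum_coords Sz by (simp add: sum_distrib_right)
  then show ?thesis
    unfolding contact_form_bracket[OF X S] 0 f_def[symmetric]
    by (simp add: sum.distrib[symmetric] sum_subtractf[symmetric] sum_negf[symmetric] algebra_simps)
qed

lemma preserves_contact_alt:
  "preserves_contact l X \<longleftrightarrow> (\<forall>S\<in>polynomial_fields l.
    contact_form l S = 0 \<longrightarrow> contact_form l (field_bracket l X S) = 0)"
  unfolding preserves_contact_def by (simp add: fun_eq_iff)

lemma comp_field_polynomial:
  "k \<in> coords l \<Longrightarrow> f \<in> poly_funs l \<Longrightarrow> comp_field k f \<in> polynomial_fields l"
  unfolding polynomial_fields_iff comp_field_def by (auto intro: poly_closed)

text \<open>
  Testing against \<open>\<partial>\<^sub>x\<^sub>i + y\<^sub>i \<partial>\<^sub>z\<close> and \<open>\<partial>\<^sub>y\<^sub>i\<close> makes each coefficient in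
      \<open>contact_form_bracket_section\<close>
  vanish. So a contact field is determined by the function \<open>f\<close>, its generating function.
\<close>

lemma preserves_contact_iff:
  assumes X: "X \<in> polynomial_fields l"
  defines "f \<equiv> contact_form l X"
  shows "preserves_contact l X \<longleftrightarrow> (\<forall>i<l. X (Cx i) = - partial_deriv (Cy i) f \<and>
    X (Cy i) = partial_deriv (Cx i) f + coord_fun (Cy i) * partial_deriv Cz f)" (is "_ \<longleftrightarrow> ?R")
proof
  assume R: ?R
  show "preserves_contact l X"
    unfolding preserves_contact_alt
  proof (intro ballI impI)
    fix S assume S: "S \<in> polynomial_fields l" "contact_form l S = 0"
    show "contact_form l (field_bracket l X S) = 0"
      unfolding contact_form_bracket_section[OF X S] f_def[symmetric]
      by (rule sum.neutral) (use R in auto)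
  qed
next
  assume P: "preserves_contact l X"
  have sec: "(\<Sum>i<l. S (Cx i) * (X (Cy i) - partial_deriv (Cx i) f - coord_fun
      (Cy i) * partial_deriv Cz f)
         - S (Cy i) * (X (Cx i) + partial_deriv (Cy i) f)) = 0"
    if "S \<in> polynomial_fields l" "contact_form l S = 0" for S
    using P that contact_form_bracket_section[OF X that] unfolding preserves_contact_alt f_def
        by simp
  show ?R
  proof (intro allI impI conjI)
    fix i assume i: "i < l"
    let ?S = "comp_field (Cy i) 1"
    have S: "?S \<in> polynomial_fields l" using i by (intro comp_field_polynomial poly_closed) simp
    have "contact_form l ?S = 0" unfolding contact_form_eq by (simp add: comp_field_def)
    from sec[OF S this] have "(\<Sum>j<l. if j = i then X (Cx j) + partial_deriv (Cy j) f else 0) = 0"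
      by (simp add: comp_field_def if_distrib[of "\<lambda>u. u * _"] sum_negf cong: if_cong)
    then show "X (Cx i) = - partial_deriv (Cy i) f"
      using i by (simp add: eq_neg_iff_add_eq_0)
  next
    fix i assume i: "i < l"
    let ?S = "comp_field (Cx i) 1 + comp_field Cz (coord_fun (Cy i))"
    have S: "?S \<in> polynomial_fields l"
      using i by (intro subspace_add comp_field_polynomial poly_closed) simp_all
    have "(\<Sum>j<l. coord_fun (Cy j) * ?S (Cx j)) = (\<Sum>j<l. if j = i then coord_fun (Cy i) else 0)"
      by (rule sum.cong) (auto simp: comp_field_def)
    then have "contact_form l ?S = 0"
      using i unfolding contact_form_eq by (simp add: comp_field_def)
    from sec[OF S this] have "(\<Sum>j<l. if j = i then X (Cy j) - partial_deriv (Cx j) f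
        - coord_fun (Cy j) * partial_deriv Cz f else 0) = 0"
      by (simp add: comp_field_def if_distrib[of "\<lambda>u. u * _"] cong: if_cong)
    then show "X (Cy i) = partial_deriv (Cx i) f + coord_fun (Cy i) * partial_deriv Cz f"
      using i by (simp add: algebra_simps)
  qed
qed

definition contact_field :: "nat \<Rightarrow> (point \<Rightarrow> real) \<Rightarrow> vfield"
  where "contact_field l f = (\<lambda>k. case k of
      Cx i \<Rightarrow> if i < l then - partial_deriv (Cy i) f else 0
    | Cy i \<Rightarrow> if i < l then partial_deriv (Cx i) f + coord_fun (Cy i) * partial_deriv Cz f else 0
    | Cz \<Rightarrow> f - (\<Sum>i<l. coord_fun (Cy i) * partial_deriv (Cy i) f))"

lemma contact_field_simps:
  "i < l \<Longrightarrow> contact_field l f (Cx i) = - partial_deriv (Cy i) f"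
  "i < l \<Longrightarrow> contact_field l f (Cy i) = partial_deriv (Cx i) f + coord_fun
      (Cy i) * partial_deriv Cz f"
  "contact_field l f Cz = f - (\<Sum>i<l. coord_fun (Cy i) * partial_deriv (Cy i) f)"
  by (simp_all add: contact_field_def)

lemma contact_form_contact_field [simp]: "contact_form l (contact_field l f) = f"
  unfolding contact_form_eq by (simp add: contact_field_simps sum_negf)

lemma contact_field_homogeneous:
  assumes f: "f \<in> hom_polys l (d + 2)"
  shows "contact_field l f \<in> homogeneous_fields l d"
proof -
  note pd = partial_deriv_hom_poly[OF f]
  have x: "partial_deriv (Cx i) f \<in> hom_polys l (d + 1)"
      "partial_deriv (Cy i) f \<in> hom_polys l (d + 1)" for i
    using pd[of "Cx i"] pd[of "Cy i"] by (simp_all add: add.commute)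
  have z: "partial_deriv Cz f \<in> hom_polys l d" using pd[of Cz] by simp
  have yz: "coord_fun (Cy i) * partial_deriv Cz f \<in> hom_polys l (d + 1)" if "i < l" for i
    using hom_polys_mult[OF coord_fun_hom_poly z, of "Cy i"] that by (simp add: add.commute)
  have yy: "coord_fun (Cy i) * partial_deriv (Cy i) f \<in> hom_polys l (d + 2)" if "i < l" for i
    using hom_polys_mult[OF coord_fun_hom_poly x(2), of "Cy i" i] that by (simp add: algebra_simps)
  show ?thesis
    unfolding homogeneous_fields_iff
  proof (intro conjI ballI allI impI)
    fix j assume "j \<in> coords l"
    then show "contact_field l f j \<in> hom_polys l (d + int (weight j))"
      using x yz yy f
      by (cases j) (auto simp: contact_field_simps intro!: subspace_neg subspace_add subspace_diff
          subspace_sum)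
  next
    fix j assume "j \<notin> coords l"
    then show "contact_field l f j = 0" by (cases j) (auto simp: contact_field_def)
  qed
qed

lemma contact_algebra_simps [simp]:
  "lie_br (contact_algebra l) = field_bracket l"
  "grade (contact_algebra l) d = {X \<in> homogeneous_fields l d. preserves_contact l X}"
  by (simp_all add: contact_algebra_def)

lemma contact_grade_iff:
  "X \<in> grade (contact_algebra l) d \<longleftrightarrow>
    contact_form l X \<in> hom_polys l (d + 2) \<and> X = contact_field l (contact_form l X)"
proof
  assume "X \<in> grade (contact_algebra l) d"
  then have X: "X \<in> homogeneous_fields l d" "preserves_contact l X" by simp_all
  have P: "X \<in> polynomial_fields l" using X(1) by (rule homogeneous_fields_subset)
  define f where "f = contact_form l X"
  have c: "X (Cx i) = - partial_deriv (Cy i) f"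
    "X (Cy i) = partial_deriv (Cx i) f + coord_fun (Cy i) * partial_deriv Cz f" if "i < l" for i
    using X(2) that unfolding preserves_contact_iff[OF P] f_def by auto
  have "X j = contact_field l f j" for j
  proof (cases "j \<in> coords l")
    case False
    then show ?thesis using X(1) unfolding homogeneous_fields_iff
        by (cases j) (auto simp: contact_field_def)
  next
    case True
    have "X Cz = f + (\<Sum>i<l. coord_fun (Cy i) * X (Cx i))" unfolding f_def contact_form_eq by simp
    then have "X Cz = f - (\<Sum>i<l. coord_fun (Cy i) * partial_deriv (Cy i) f)"
      by (simp add: c sum_negf)
    then show ?thesis using True c by (cases j) (auto simp: contact_field_simps)
  qed
  then show "contact_form l X \<in> hom_polys l (d + 2) \<and> X = contact_field l (contact_form l X)"
    using contact_form_hom_poly[OF X(1)] unfolding f_def by auto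
next
  assume X: "contact_form l X \<in> hom_polys l (d + 2) \<and> X = contact_field l (contact_form l X)"
  define f where "f = contact_form l X"
  have hom: "X \<in> homogeneous_fields l d" using X contact_field_homogeneous by metis
  moreover have "preserves_contact l X"
    unfolding preserves_contact_iff[OF homogeneous_fields_subset[OF hom]] f_def[symmetric]
    using X contact_field_simps(1,2)[of _ l f] unfolding f_def[symmetric] by metis
  ultimately show "X \<in> grade (contact_algebra l) d" by simp
qed

lemma contact_field_grade: "f \<in> hom_polys l (d + 2)
    \<Longrightarrow> contact_field l f \<in> grade (contact_algebra l) d"
  unfolding contact_grade_iff by simp

lemma contact_grade_polynomial: "X \<in> grade (contact_algebra l) d \<Longrightarrow> X \<in> polynomial_fields l"
  by (auto intro: homogeneous_fields_subset)

lemma contact_grade_eqI: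
  "X \<in> grade (contact_algebra l) d \<Longrightarrow> Y \<in> grade (contact_algebra l) d' \<Longrightarrow>
    contact_form l X = contact_form l Y \<Longrightarrow> X = Y"
  unfolding contact_grade_iff by metis

text \<open>
  For the bracket, the Jacobi identity expresses the action of \<open>[X, Y]\<close> on a section through those
      of
  \<open>X\<close> and \<open>Y\<close>.
\<close>

lemma preserves_contact_closed:
  assumes "X \<in> polynomial_fields l" "Y \<in> polynomial_fields l" "preserves_contact l X"
      "preserves_contact l Y"
  shows "preserves_contact l (X + Y)" "preserves_contact l (r *\<^sub>R X)"
      "preserves_contact l (field_bracket l X Y)"
proof -
  note bil = bilinear_onD[OF field_bracket_bilinear, of _ l]
  show "preserves_contact l (X + Y)" "preserves_contact l (r *\<^sub>R X)"
    using assms unfolding preserves_contact_alt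
    by (simp_all add: bil contact_form_add contact_form_scaleR)
  show "preserves_contact l (field_bracket l X Y)"
    unfolding preserves_contact_alt
  proof (intro ballI impI)
    fix S assume S: "S \<in> polynomial_fields l" "contact_form l S = 0"
    have "field_bracket l (field_bracket l X Y) S
        = field_bracket l X (field_bracket l Y S) + field_bracket l Y (field_bracket l S X)"
      using field_bracket_jacobi[OF assms(1,2) S(1)] field_bracket_skew[of l
          "field_bracket l X Y" S]
      unfolding eq_neg_iff_add_eq_0 by (metis add_right_cancel)
    moreover have "contact_form l (field_bracket l X (field_bracket l Y S)) = 0"
      using assms S field_bracket_polynomial unfolding preserves_contact_alt by simp
    moreover have "contact_form l (field_bracket l S X) = 0"
      unfolding field_bracket_skew[of l S X]
      using assms S contact_form_scaleR[of l "-1"] unfolding preserves_contact_alt by simp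
    then have "contact_form l (field_bracket l Y (field_bracket l S X)) = 0"
      using assms S field_bracket_polynomial unfolding preserves_contact_alt by simp
    ultimately show "contact_form l (field_bracket l (field_bracket l X Y) S) = 0"
      by (simp add: contact_form_add)
  qed
qed

lemma lie_space_contact_algebra: "lie_space (contact_algebra l) \<subseteq> polynomial_fields l"
  unfolding lie_space_def by (intro span_minimal) (auto simp: homogeneous_fields_subset)

lemma fd_subspace_contact_grade: "fd_subspace (grade (contact_algebra l) d)"
proof (rule fd_subspace_subset[OF fd_subspace_homogeneous_fields])
  show "grade (contact_algebra l) d \<subseteq> homogeneous_fields l d" by auto
  have "preserves_contact l 0" unfolding preserves_contact_alt
    using bilinear_on_zero(1)[OF field_bracket_bilinear] by simp
  moreover have "X + Y \<in> grade (contact_algebra l) d" "r *\<^sub>R X \<in> grade (contact_algebra l) d"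
    if X: "X \<in> grade (contact_algebra l) d" and Y: "Y \<in> grade (contact_algebra l) d" for X Y r
    using that preserves_contact_closed(1,2)[OF contact_grade_polynomial[OF X]
        contact_grade_polynomial[OF Y]]
    by (simp_all add: subspace_add subspace_scale)
  ultimately show "subspace (grade (contact_algebra l) d)"
    unfolding subspace_def by (simp add: subspace_0)
qed

lemma graded_lie_algebra_contact: "graded_lie_algebra (contact_algebra l)"
proof -
  note sub = lie_space_contact_algebra[of l]
  have "independent_family UNIV (grade (contact_algebra l))"
    by (rule independent_family_mono[OF independent_homogeneous_fields]) auto
  moreover have "bilinear_on (lie_space (contact_algebra l)) (lie_space (contact_algebra l))
      (field_bracket l)"
    by (rule bilinear_on_subset[OF field_bracket_bilinear sub sub])
  moreover have "field_bracket l X Y \<in> grade (contact_algebra l) (p + q)"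
    if "X \<in> grade (contact_algebra l) p" "Y \<in> grade (contact_algebra l) q" for X Y p q
    using that preserves_contact_closed(3)[OF contact_grade_polynomial[OF that(1)]
        contact_grade_polynomial[OF that(2)]]
    by (simp add: field_bracket_homogeneous)
  moreover have "field_bracket l X (field_bracket l Y Z) + field_bracket l Y (field_bracket l Z X)
      + field_bracket l Z (field_bracket l X Y) = 0"
    if "X \<in> lie_space (contact_algebra l)" "Y \<in> lie_space (contact_algebra l)"
      "Z \<in> lie_space (contact_algebra l)" for X Y Z
    using that sub by (intro field_bracket_jacobi) auto
  ultimately show ?thesis
    unfolding graded_lie_algebra_def contact_algebra_simps(1)
    using fd_subspace_imp_subspace[OF fd_subspace_contact_grade] field_bracket_self by blast
qed

subsection \<open>The negative part\<close>

lemma comp_field_apply: "comp_field j f k = (if k = j then f else 0)"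
  by (simp add: comp_field_def)

text \<open>
  The translations of the Heisenberg group. They preserve the contact form itself, not only its
  kernel.
\<close>

primrec translation_field :: "coord \<Rightarrow> vfield"
  where "translation_field (Cx i) = comp_field (Cx i) 1"
  | "translation_field (Cy i) = comp_field (Cy i) 1 + comp_field Cz (coord_fun (Cx i))"
  | "translation_field Cz = comp_field Cz 1"

lemma contact_form_comp_field:
  "contact_form l (comp_field Cz f) = f"
  "i < l \<Longrightarrow> contact_form l (comp_field (Cx i) f) = - coord_fun (Cy i) * f"
  "contact_form l (comp_field (Cy i) f) = 0"
proof -
  show "contact_form l (comp_field Cz f) = f" "contact_form l (comp_field (Cy i) f) = 0"
    by (simp_all add: contact_form_eq comp_field_def)
  assume i: "i < l"
  have "(\<Sum>j<l. coord_fun (Cy j) * comp_field (Cx i) f (Cx j))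
      = (\<Sum>j<l. if j = i then coord_fun (Cy i) * f else 0)"
    by (rule sum.cong) (auto simp: comp_field_def)
  then show "contact_form l (comp_field (Cx i) f) = - coord_fun (Cy i) * f"
    using i by (simp add: contact_form_eq comp_field_def)
qed

lemma contact_form_translation_field:
  "i < l \<Longrightarrow> contact_form l (translation_field (Cx i)) = - coord_fun (Cy i)"
  "i < l \<Longrightarrow> contact_form l (translation_field (Cy i)) = coord_fun (Cx i)"
  "contact_form l (translation_field Cz) = 1"
  by (simp_all add: contact_form_comp_field contact_form_add)

lemma comp_field_homogeneous:
  "k \<in> coords l \<Longrightarrow> f \<in> hom_polys l (d + int (weight k)) \<Longrightarrow> comp_field k f \<in> homogeneous_fields l d"
  unfolding homogeneous_fields_iff comp_field_def by (auto simp: subspace_0)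

lemma translation_field_homogeneous:
  assumes "k \<in> coords l"
  shows "translation_field k \<in> homogeneous_fields l (- int (weight k))"
proof (cases k)
  case (Cy i)
  then show ?thesis
    using assms one_hom_poly[of l] coord_fun_hom_poly[of "Cx i" l]
    by (auto intro!: subspace_add comp_field_homogeneous)
qed (use assms one_hom_poly[of l] in \<open>auto intro!: comp_field_homogeneous\<close>)

lemma translation_field_preserves_contact:
  assumes k: "k \<in> coords l"
  shows "preserves_contact l (translation_field k)"
proof -
  note P = homogeneous_fields_subset[OF translation_field_homogeneous[OF k]]
  have neg: "partial_deriv j (- coord_fun i) = - partial_deriv j (coord_fun i)" if "i \<in> coords l"
      for i j
    using that by (intro partial_deriv_minus poly_closed)
  show ?thesis
    unfolding preserves_contact_iff[OF P]
    using k by (cases k)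
      (auto simp: contact_form_comp_field contact_form_add comp_field_apply
          partial_deriv_coord_fun neg)
qed

lemma translation_field_grade:
  "k \<in> coords l \<Longrightarrow> translation_field k \<in> grade (contact_algebra l) (- int (weight k))"
  by (simp add: translation_field_homogeneous translation_field_preserves_contact)

lemma field_action_translation_field:
  "i < l \<Longrightarrow> field_action l (translation_field (Cx i)) f = partial_deriv (Cx i) f"
  "i < l \<Longrightarrow> field_action l (translation_field (Cy i)) f
    = partial_deriv (Cy i) f + coord_fun (Cx i) * partial_deriv Cz f"
  "field_action l (translation_field Cz) f = partial_deriv Cz f"
  by (simp_all add: field_action_comp_field field_action_add_left)

text \<open>
  Since translations preserve the contact form, they commute with passing to generating functions.
\<close>

lemma contact_form_bracket_translation:
  assumes k: "k \<in> coords l" and Y: "Y \<in> polynomial_fields l"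
  shows "contact_form l (field_bracket l (translation_field k) Y)
    = field_action l (translation_field k) (contact_form l Y)"
proof -
  have T: "translation_field k \<in> polynomial_fields l"
    using homogeneous_fields_subset[OF translation_field_homogeneous[OF k]] .
  have minus: "field_action l Y (- coord_fun j) = - Y j" if "j \<in> coords l" for j
    using that field_action_scaleR[of "coord_fun j" l Y "-1"]
    by (simp add: poly_closed field_action_coord_fun)
  show ?thesis
  proof (cases k)
    case (Cx i)
    then have i: "i < l" using k by simp
    have "(\<Sum>j<l. translation_field k (Cy j) * Y (Cx j) - Y (Cy j) * translation_field k (Cx j))
        = (\<Sum>j<l. if j = i then - Y (Cy i) else 0)"
      by (rule sum.cong) (auto simp: Cx comp_field_def)
    then show ?thesis
      using i unfolding contact_form_bracket[OF T Y]
      by (simp add: Cx contact_form_comp_field minus)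
  next
    case (Cy i)
    then have i: "i < l" using k by simp
    have "(\<Sum>j<l. translation_field k (Cy j) * Y (Cx j) - Y (Cy j) * translation_field k (Cx j))
        = (\<Sum>j<l. if j = i then Y (Cx i) else 0)"
      by (rule sum.cong) (auto simp: Cy comp_field_def)
    then show ?thesis
      using i contact_form_translation_field(2)[OF i] field_action_coord_fun[of "Cx i" l Y]
      unfolding contact_form_bracket[OF T Y] by (simp add: Cy del: translation_field.simps)
  next
    case Cz
    have "(\<Sum>j<l. translation_field k (Cy j) * Y (Cx j) - Y (Cy j) * translation_field k (Cx j)) = 0"
      by (rule sum.neutral) (auto simp: Cz comp_field_def)
    then show ?thesis
      unfolding contact_form_bracket[OF T Y] by (simp add: Cz contact_form_comp_field)
  qed
qed

text \<open>
  The structure constants of the Heisenberg algebra in the basis of translations.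
\<close>

definition heisenberg_coeff :: "coord \<Rightarrow> coord \<Rightarrow> real"
  where "heisenberg_coeff j k = (case (j, k) of
      (Cx i, Cy i') \<Rightarrow> if i = i' then 1 else 0
    | (Cy i, Cx i') \<Rightarrow> if i = i' then -1 else 0
    | _ \<Rightarrow> 0)"

lemma translation_field_bracket:
  assumes j: "j \<in> coords l" and k: "k \<in> coords l"
  shows "field_bracket l (translation_field j) (translation_field k)
    = heisenberg_coeff j k *\<^sub>R translation_field Cz"
proof -
  let ?d = "- int (weight j) + - int (weight k)"
  note T = homogeneous_fields_subset[OF translation_field_homogeneous]
  have br: "field_bracket l (translation_field j) (translation_field k) \<in> grade
      (contact_algebra l) ?d"
    using graded_lie_algebraD(6)[OF graded_lie_algebra_contact translation_field_grade[OF j]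
        translation_field_grade[OF k]] by simp
  have neg: "partial_deriv j (- coord_fun i) = - partial_deriv j (coord_fun i)" if "i \<in> coords l"
      for i j
    using that by (intro partial_deriv_minus poly_closed)
  have form: "contact_form l (field_bracket l (translation_field j) (translation_field k))
      = heisenberg_coeff j k *\<^sub>R 1"
    unfolding contact_form_bracket_translation[OF j T[OF k]]
    using j k
    by (cases j; cases k)
      (auto simp: field_action_translation_field contact_form_translation_field heisenberg_coeff_def
        neg partial_deriv_coord_fun simp del: translation_field.simps)
  have "heisenberg_coeff j k *\<^sub>R translation_field Cz \<in> grade (contact_algebra l) (-2)"
    using translation_field_grade[of Cz l] fd_subspace_imp_subspace[OF
        fd_subspace_contact_grade[of l "-2"]]
    by (intro subspace_scale) auto
  then show ?thesis
    using contact_grade_eqI[OF br] form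
    by (simp add: contact_form_scaleR contact_form_comp_field)
qed

lemma coord_fun_at_zero [simp]: "coord_fun k 0 = 0"
  by (simp add: coord_fun_def)

lemma contact_grade_minus_two:
  assumes X: "X \<in> grade (contact_algebra l) (-2)"
  shows "X = X Cz 0 *\<^sub>R translation_field Cz"
proof (rule contact_grade_eqI[OF X])
  show "X Cz 0 *\<^sub>R translation_field Cz \<in> grade (contact_algebra l) (-2)"
    using translation_field_grade[of Cz l] fd_subspace_imp_subspace[OF
        fd_subspace_contact_grade[of l "-2"]]
    by (intro subspace_scale) auto
  have "contact_form l X \<in> hom_polys l 0" using X unfolding contact_grade_iff by simp
  then have "contact_form l X = contact_form l X 0 *\<^sub>R 1" by (rule hom_polys_zero)
  moreover have "contact_form l X 0 = X Cz 0"
    by (simp add: contact_form_eq sum_fun_apply)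
  ultimately show "contact_form l X = contact_form l (X Cz 0 *\<^sub>R translation_field Cz)"
    by (simp add: contact_form_scaleR contact_form_comp_field)
qed

text \<open>
  A generating function of weight one is linear in the \<open>x\<^sub>i\<close> and \<open>y\<^sub>i\<close>
      by Euler's identity, and those of
  the translations are \<open>- y\<^sub>i\<close> and \<open>x\<^sub>i\<close>.
\<close>

lemma contact_grade_minus_one:
  assumes X: "X \<in> grade (contact_algebra l) (-1)"
  shows "X = (\<Sum>i<l. X (Cx i) 0 *\<^sub>R translation_field (Cx i) + X (Cy i) 0 *\<^sub>R translation_field
      (Cy i))"
    (is "X = ?Y")
proof (rule contact_grade_eqI[OF X])
  show "?Y \<in> grade (contact_algebra l) (-1)"
    using translation_field_grade[of "Cx _" l] translation_field_grade[of "Cy _" l]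
      fd_subspace_imp_subspace[OF fd_subspace_contact_grade[of l "-1"]]
    by (intro subspace_sum subspace_add subspace_scale) auto
  define f where "f = contact_form l X"
  have f: "f \<in> hom_polys l 1" and Xf: "X = contact_field l f"
    using X unfolding contact_grade_iff f_def by simp_all
  have "partial_deriv Cz f \<in> hom_polys l (-1)" using partial_deriv_hom_poly[OF f, of Cz] by simp
  then have z: "partial_deriv Cz f = 0" by (rule hom_polys_negative[rotated]) simp
  have x: "partial_deriv (Cx i) f = X (Cy i) 0 *\<^sub>R 1" if "i < l" for i
  proof -
    have "partial_deriv (Cx i) f \<in> hom_polys l 0" using partial_deriv_hom_poly[OF f, of "Cx i"]
        by simp
    from hom_polys_zero[OF this] show ?thesis using that z by (simp add: Xf contact_field_simps)
  qed
  have y: "partial_deriv (Cy i) f = - X (Cx i) 0 *\<^sub>R 1" if "i < l" for i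
  proof -
    have "partial_deriv (Cy i) f \<in> hom_polys l 0" using partial_deriv_hom_poly[OF f, of "Cy i"]
        by simp
    from hom_polys_zero[OF this] show ?thesis using that by (simp add: Xf contact_field_simps)
  qed
  have "f = (\<Sum>i<l. X (Cy i) 0 *\<^sub>R coord_fun (Cx i)) + (\<Sum>i<l. - X (Cx i) 0 *\<^sub>R coord_fun (Cy i))"
    using euler_identity[OF f] unfolding sum_coords by (simp add: x y z)
  also have "\<dots> = contact_form l ?Y"
    by (simp add: contact_form_sum contact_form_add contact_form_scaleR
        contact_form_translation_field
        sum.distrib sum_negf del: translation_field.simps)
  finally show "contact_form l X = contact_form l ?Y" unfolding f_def .
qed

lemma contact_grade_below:
  assumes "d < -2" "X \<in> grade (contact_algebra l) d"
  shows "X = 0"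
proof (rule contact_grade_eqI[OF assms(2)])
  show "0 \<in> grade (contact_algebra l) d"
    using fd_subspace_imp_subspace[OF fd_subspace_contact_grade] by (rule subspace_0)
  show "contact_form l X = contact_form l 0"
    using assms hom_polys_negative[of "d + 2" "contact_form l X" l] unfolding contact_grade_iff
        by simp
qed

lemma contact_grade_negative_span:
  assumes q: "q < 0" and X: "X \<in> grade (contact_algebra l) q"
  shows "X \<in> span (translation_field ` {k \<in> coords l. - int (weight k) = q})" (is "_ \<in> span ?T")
proof -
  consider "q = -1" | "q = -2" | "q < -2" using q by linarith
  then show ?thesis
  proof cases
    case 1
    then have "translation_field (Cx i) \<in> span ?T" "translation_field (Cy i) \<in> span ?T" if "i < l"
        for i
      using that by (auto intro!: span_base simp del: translation_field.simps)
    then show ?thesis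
      using X 1 by (subst contact_grade_minus_one)
          (auto intro!: span_sum span_add span_scale simp del: translation_field.simps)
  next
    case 2
    then have "translation_field Cz \<in> span ?T"
        by (auto intro!: span_base simp del: translation_field.simps)
    then show ?thesis
      using X 2 by (subst contact_grade_minus_two)
          (auto intro!: span_scale simp del: translation_field.simps)
  next
    case 3
    then show ?thesis using contact_grade_below[OF 3 X] by (simp add: span_0)
  qed
qed

subsection \<open>Transitivity and vanishing cohomology\<close>

text \<open>
  A field commuting with the translations in degree \<open>-1\<close> commutes with their bracket \<open>\<partial>\<^sub>z\<close>,
      for which
  \<open>l > 0\<close> is needed. Then all derivatives of its generating function vanish, which forces the
      function
  to be zero since its weight is at least two.
\<close>

lemma transitive_contact_algebra:
  assumes l: "0 < l"
  shows "transitive_grading (contact_algebra l)"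
  unfolding transitive_grading_def
proof (intro allI impI ballI)
  fix p X assume p: "0 \<le> p" and X: "X \<in> grade (contact_algebra l) p"
    and 0: "\<forall>y\<in>grade (contact_algebra l) (-1). lie_br (contact_algebra l) X y = 0"
  define f where "f = contact_form l X"
  have f: "f \<in> hom_polys l (p + 2)" using X unfolding contact_grade_iff f_def by simp
  note fp = hom_polys_subset[OF f]
  have act: "field_action l (translation_field k) f = 0" if "k \<in> coords l" "weight k = 1" for k
  proof -
    have "translation_field k \<in> grade (contact_algebra l) (-1)"
        using translation_field_grade[OF that(1)] that(2) by simp
    then have "field_bracket l X (translation_field k) = 0" using 0 by simp
    then have "field_bracket l (translation_field k) X = 0" by (subst field_bracket_skew) simp
    then show ?thesis
      using contact_form_bracket_translation[OF that(1) contact_grade_polynomial[OF X]]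
          unfolding f_def by simp
  qed
  have x: "partial_deriv (Cx i) f = 0" if "i < l" for i
    using act[of "Cx i"] that field_action_translation_field(1)[OF that] by simp
  have "field_bracket l (translation_field (Cx 0)) (translation_field (Cy 0))
      = translation_field Cz"
    using l by (subst translation_field_bracket) (simp_all add: heisenberg_coeff_def)
  then have "field_action l (translation_field Cz) f = 0"
    using act[of "Cx 0"] act[of "Cy 0"] l
      field_action_bracket[OF homogeneous_fields_subset homogeneous_fields_subset fp,
        OF translation_field_homogeneous translation_field_homogeneous, of "Cx 0" "Cy 0"] by simp
  then have z: "partial_deriv Cz f = 0" unfolding field_action_translation_field .
  have y: "partial_deriv (Cy i) f = 0" if "i < l" for i
    using act[of "Cy i"] that z field_action_translation_field(2)[OF that] by simp
  have "f = 0"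
  proof (rule hom_poly_zero_partials[OF f])
    show "p + 2 \<noteq> 0" using p by simp
    show "partial_deriv k f = 0" if "k \<in> coords l" for k
      using that x y z by (cases k) auto
  qed
  moreover have "0 \<in> grade (contact_algebra l) p"
    using fd_subspace_imp_subspace[OF fd_subspace_contact_grade] by (rule subspace_0)
  ultimately show "X = 0" using contact_grade_eqI[OF X] unfolding f_def by simp
qed

text \<open>
  The Poincare lemma: for a closed form, contraction with the weighted Euler field followed by
  differentiation is the Lie derivative along that field, that is, multiplication by the weight.
\<close>

lemma closed_hom_form_exact:
  assumes g: "\<And>k. k \<in> coords l \<Longrightarrow> g k \<in> hom_polys l (d - int (weight k))" and d: "d \<noteq> 0"
    and closed: "\<And>j k. j \<in> coords l \<Longrightarrow> k \<in> coords l \<Longrightarrow> partial_deriv j (g k) = partial_deriv k (g j)"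
  shows "\<exists>f\<in>hom_polys l d. \<forall>k\<in>coords l. partial_deriv k f = g k"
proof -
  define h where "h = (\<Sum>k\<in>coords l. real (weight k) *\<^sub>R (coord_fun k * g k))"
  have hk: "coord_fun k * g k \<in> hom_polys l d" if "k \<in> coords l" for k
    using hom_polys_mult[OF coord_fun_hom_poly[OF that] g[OF that]] by simp
  then have h: "h \<in> hom_polys l d" unfolding h_def by (intro subspace_sum subspace_scale) auto
  have "partial_deriv j h = of_int d *\<^sub>R g j" if j: "j \<in> coords l" for j
  proof -
    have "partial_deriv j h = (\<Sum>k\<in>coords l. partial_deriv j (real (weight k) *\<^sub>R
        (coord_fun k * g k)))"
      unfolding h_def by (rule partial_deriv_sum[of _ _ l])
          (rule poly_closed(4)[OF hom_polys_subset[OF hk]])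
    also have "\<dots> = (\<Sum>k\<in>coords l. real (weight k) *\<^sub>R (coord_fun k * partial_deriv k (g j))
        + (if k = j then real (weight j) *\<^sub>R g j else 0))"
    proof (rule sum.cong)
      fix k assume k: "k \<in> coords l"
      have "partial_deriv j (real (weight k) *\<^sub>R (coord_fun k * g k))
          = real (weight k) *\<^sub>R (coord_fun k * partial_deriv j (g k) + partial_deriv j
              (coord_fun k) * g k)"
        using k g[OF k] hk[OF k] hom_polys_subset
        by (simp add: partial_deriv_scaleR[of _ l] partial_deriv_mult[of _ l] poly_closed)
      then show "partial_deriv j (real (weight k) *\<^sub>R (coord_fun k * g k))
          = real (weight k) *\<^sub>R (coord_fun k * partial_deriv k (g j)) + (if k
              = j then real (weight j) *\<^sub>R g j else 0)"
        using closed[OF j k] by (auto simp: partial_deriv_coord_fun scaleR_add_right)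
    qed simp
    also have "\<dots> = of_int (d - int (weight j)) *\<^sub>R g j + real (weight j) *\<^sub>R g j"
      using j euler_identity[OF g[OF j]] by (simp add: sum.distrib)
    finally show ?thesis by (simp add: scaleR_add_left[symmetric])
  qed
  then have "partial_deriv k ((1 / of_int d) *\<^sub>R h) = g k" if "k \<in> coords l" for k
    using that d hom_polys_subset[OF h] by (simp add: partial_deriv_scaleR[of _ l])
  moreover have "(1 / of_int d) *\<^sub>R h \<in> hom_polys l d" using h by (simp add: subspace_scale)
  ultimately show ?thesis by blast
qed

text \<open>
  Expressing the partial derivatives through the translations reduces the claim to closed forms. The
  translations do not commute, so the structure constants enter the integrability condition.
\<close>

lemma translation_potential:
  assumes \<alpha>: "\<And>k. k \<in> coords l \<Longrightarrow> \<alpha> k \<in> hom_polys l (d - int (weight k))" and d: "d \<noteq> 0"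
    and compat: "\<And>j k. j \<in> coords l \<Longrightarrow> k \<in> coords l \<Longrightarrow>
      field_action l (translation_field j) (\<alpha> k) - field_action l (translation_field k) (\<alpha> j)
        = heisenberg_coeff j k *\<^sub>R \<alpha> Cz"
  shows "\<exists>f\<in>hom_polys l d. \<forall>k\<in>coords l. field_action l (translation_field k) f = \<alpha> k"
proof -
  \<comment> \<open>the partial derivatives that a potential must have\<close>
  define g where "g k = (case k of Cy i \<Rightarrow> \<alpha> (Cy i) - coord_fun (Cx i) * \<alpha> Cz | _ \<Rightarrow> \<alpha> k)" for k
  have g_simps [simp]: "g (Cx i) = \<alpha> (Cx i)" "g (Cy i) = \<alpha> (Cy i) - coord_fun (Cx i) * \<alpha> Cz" "g Cz
      = \<alpha> Cz" for i
    by (simp_all add: g_def)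
  have \<alpha>x: "\<alpha> (Cx i) \<in> poly_funs l" and \<alpha>y: "\<alpha> (Cy i) \<in> poly_funs l" if "i < l" for i
    using \<alpha>[of "Cx i"] \<alpha>[of "Cy i"] that hom_polys_subset by auto
  have \<alpha>z: "\<alpha> Cz \<in> poly_funs l" using \<alpha>[of Cz] hom_polys_subset by auto
  note act = field_action_translation_field
  have xx: "partial_deriv (Cx i) (\<alpha> (Cx j)) = partial_deriv (Cx j) (\<alpha> (Cx i))" if "i < l" "j < l"
      for i j
    using compat[of "Cx i" "Cx j"] that by (simp add: act heisenberg_coeff_def del:
        translation_field.simps)
  have xz: "partial_deriv Cz (\<alpha> (Cx i)) = partial_deriv (Cx i) (\<alpha> Cz)" if "i < l" for i
    using compat[of "Cz" "Cx i"] that by (simp add: act heisenberg_coeff_def del: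
        translation_field.simps)
  have yz: "partial_deriv Cz (\<alpha> (Cy i)) = partial_deriv (Cy i) (\<alpha> Cz) + coord_fun
      (Cx i) * partial_deriv Cz (\<alpha> Cz)"
    if "i < l" for i
    using compat[of "Cz" "Cy i"] that by (simp add: act heisenberg_coeff_def del:
        translation_field.simps)
  have xy: "partial_deriv (Cx i) (\<alpha> (Cy j)) = partial_deriv (Cy j) (\<alpha> (Cx i))
      + coord_fun (Cx j) * partial_deriv (Cx i) (\<alpha> Cz) + (if i = j then \<alpha> Cz else 0)"
          if "i < l" "j < l" for i j
    using compat[of "Cx i" "Cy j"] that xz[of i]
    by (auto simp: act heisenberg_coeff_def algebra_simps simp del: translation_field.simps split:
        if_splits)
  have yy: "partial_deriv (Cy i) (\<alpha> (Cy j)) + coord_fun (Cx i) * partial_deriv (Cy j) (\<alpha> Cz)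
      = partial_deriv (Cy j) (\<alpha> (Cy i)) + coord_fun (Cx j) * partial_deriv (Cy i) (\<alpha> Cz)"
          if "i < l" "j < l" for i j
    using compat[of "Cy i" "Cy j"] that
    by (simp add: act heisenberg_coeff_def yz algebra_simps del: translation_field.simps)
  have gy: "partial_deriv k (g (Cy i)) = partial_deriv k (\<alpha> (Cy i)) - coord_fun
      (Cx i) * partial_deriv k (\<alpha> Cz)
      - (if k = Cx i then \<alpha> Cz else 0)" if "i < l" for i k
    using that \<alpha>y[OF that] \<alpha>z
    by (auto simp: partial_deriv_diff[of _ l] partial_deriv_mult[of _ l] poly_closed
        partial_deriv_coord_fun)
  have g_hom: "g k \<in> hom_polys l (d - int (weight k))" if "k \<in> coords l" for k
  proof (cases k)
    case (Cy i)
    have "coord_fun (Cx i) * \<alpha> Cz \<in> hom_polys l (d - 1)"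
      using hom_polys_mult[OF coord_fun_hom_poly \<alpha>[of Cz], of "Cx i"] that Cy by simp
    then show ?thesis using \<alpha>[OF that] Cy by (simp add: subspace_diff)
  qed (use \<alpha>[OF that] in auto)
  have closed: "partial_deriv j (g k) = partial_deriv k (g j)" if "j \<in> coords l" "k \<in> coords l"
      for j k
  proof -
    have yy': "partial_deriv (Cy i) (g (Cy j)) = partial_deriv (Cy j) (g (Cy i))"
        if "i < l" "j < l" for i j
      using yy[OF that] unfolding gy[OF that(1)] gy[OF that(2)] by (simp add: algebra_simps)
    show ?thesis
      using that yy' by (cases j; cases k) (auto simp: xx xz yz xy gy simp del: g_simps(2))
  qed
  obtain f where f: "f \<in> hom_polys l d" "\<forall>k\<in>coords l. partial_deriv k f = g k"
    using closed_hom_form_exact[OF g_hom d closed] by blast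
  have "field_action l (translation_field k) f = \<alpha> k" if "k \<in> coords l" for k
    using that bspec[OF f(2), of Cz] bspec[OF f(2) that]
        by (cases k) (auto simp: act simp del: translation_field.simps)
  with f(1) show ?thesis by blast
qed

text \<open>
  The values of the derivation on the translations have generating functions which satisfy the
  integrability condition of \<open>translation_potential\<close>. A potential for them is, up to sign, the
  generating function of the field that induces the derivation.
\<close>

lemma contact_derivations_inner: "negative_derivations_inner (contact_algebra l)"
  unfolding negative_derivations_inner_def
proof (intro allI impI)
  fix p :: int and d :: "vfield \<Rightarrow> vfield"
  let ?c = "contact_algebra l"
  assume p: "0 \<le> p" and d: "linear d" and d_in: "\<forall>q<0. \<forall>u\<in>grade ?c q. d u \<in> grade ?c (p + q)"
    and d_br: "\<forall>q<0. \<forall>r<0. \<forall>u\<in>grade ?c q. \<forall>v\<in>grade ?c r.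
       d (lie_br ?c u v) = lie_br ?c (d u) v + lie_br ?c u (d v)"
  note T = translation_field_grade
  have w: "- int (weight k) < 0" for k using weight_pos[of k] by simp
  define \<alpha> where "\<alpha> k = contact_form l (d (translation_field k))" for k
  have dT: "d (translation_field k) \<in> grade ?c (p - int (weight k))" if "k \<in> coords l" for k
    using d_in[rule_format, OF w, OF T[OF that]] by simp
  have \<alpha>: "\<alpha> k \<in> hom_polys l (p + 2 - int (weight k))" if "k \<in> coords l" for k
    using dT[OF that] unfolding contact_grade_iff \<alpha>_def by (simp add: algebra_simps)
  have compat: "field_action l (translation_field j) (\<alpha> k) - field_action l (translation_field k)
      (\<alpha> j)
      = heisenberg_coeff j k *\<^sub>R \<alpha> Cz" if j: "j \<in> coords l" and k: "k \<in> coords l" for j k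
  proof -
    have "d (field_bracket l (translation_field j) (translation_field k))
        = field_bracket l (d (translation_field j)) (translation_field k)
          + field_bracket l (translation_field j) (d (translation_field k))"
      using d_br[rule_format, OF w w, OF T[OF j] T[OF k]] by simp
    moreover have "d (field_bracket l (translation_field j) (translation_field k))
        = heisenberg_coeff j k *\<^sub>R d (translation_field Cz)"
      unfolding translation_field_bracket[OF j k] by (rule linear_scale[OF d])
    ultimately have "heisenberg_coeff j k *\<^sub>R d (translation_field Cz)
        = field_bracket l (translation_field j) (d (translation_field k))
          - field_bracket l (translation_field k) (d (translation_field j))"
      using field_bracket_skew[of l "d (translation_field j)"] by simp
    then have "heisenberg_coeff j k *\<^sub>R \<alpha> Cz
        = contact_form l (field_bracket l (translation_field j) (d (translation_field k)))
          - contact_form l (field_bracket l (translation_field k) (d (translation_field j)))"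
      unfolding \<alpha>_def by (metis contact_form_diff contact_form_scaleR)
    then show ?thesis
      unfolding \<alpha>_def using contact_form_bracket_translation[OF j contact_grade_polynomial[OF
          dT[OF k]]]
        contact_form_bracket_translation[OF k contact_grade_polynomial[OF dT[OF j]]] by simp
  qed
  have p2: "p + 2 \<noteq> 0" using p by simp
  obtain h where h: "h \<in> hom_polys l (p + 2)"
    "\<forall>k\<in>coords l. field_action l (translation_field k) h = \<alpha> k"
    using translation_potential[OF \<alpha> p2 compat] by blast
  define Y where "Y = contact_field l (- h)"
  have Y: "Y \<in> grade ?c p" unfolding Y_def using h(1)
      by (intro contact_field_grade subspace_neg) simp_all
  have YT: "field_bracket l Y (translation_field k) = d (translation_field k)"
      if k: "k \<in> coords l" for k
  proof (rule contact_grade_eqI)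
    show "field_bracket l Y (translation_field k) \<in> grade ?c (p + - int (weight k))"
      using graded_lie_algebraD(6)[OF graded_lie_algebra_contact Y T[OF k]] by simp
    show "d (translation_field k) \<in> grade ?c (p - int (weight k))" by (rule dT[OF k])
    have "contact_form l (field_bracket l Y (translation_field k))
        = - contact_form l (field_bracket l (translation_field k) Y)"
      using field_bracket_skew[of l Y] contact_form_scaleR[of l "-1"] by simp
    also have "\<dots> = - field_action l (translation_field k) ((-1) *\<^sub>R h)"
      unfolding contact_form_bracket_translation[OF k contact_grade_polynomial[OF Y]]
          by (simp add: Y_def)
    also have "\<dots> = \<alpha> k"
      unfolding field_action_scaleR[OF hom_polys_subset[OF h(1)]] by (simp add: bspec[OF h(2) k])
    finally show "contact_form l (field_bracket l Y (translation_field k))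
        = contact_form l (d (translation_field k))"
      unfolding \<alpha>_def .
  qed
  have YP: "Y \<in> polynomial_fields l" using contact_grade_polynomial[OF Y] .
  have U: "subspace {u \<in> polynomial_fields l. field_bracket l Y u = d u}"
    unfolding subspace_def
    using bilinear_onD(2,4)[OF field_bracket_bilinear YP] bilinear_on_zero(2)[OF
        field_bracket_bilinear _ _ YP]
    by (simp add: linear_0[OF d] linear_add[OF d] linear_scale[OF d] subspace_0 subspace_add
        subspace_scale)
  have "lie_br ?c Y u = d u" if q: "q < 0" and u: "u \<in> grade ?c q" for q u
  proof -
    have "span (translation_field ` {k \<in> coords l. - int (weight k) = q})
        \<subseteq> {u \<in> polynomial_fields l. field_bracket l Y u = d u}"
      using YT contact_grade_polynomial[OF T] by (intro span_minimal U) blast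
    then show ?thesis using contact_grade_negative_span[OF q u] by auto
  qed
  with Y show "\<exists>Y\<in>grade ?c p. \<forall>q<0. \<forall>u\<in>grade ?c q. lie_br ?c Y u = d u" by blast
qed

section \<open>Symplectic bases\<close>

lemma bilinear_on_sum_left:
  assumes f: "bilinear_on S T f" and S: "subspace S" "subspace T" and y: "y \<in> T"
      and x: "\<And>i. i \<in> I \<Longrightarrow> x i \<in> S"
  shows "f (\<Sum>i\<in>I. x i) y = (\<Sum>i\<in>I. f (x i) y)"
  using x
proof (induction I rule: infinite_finite_induct)
  case (insert i I)
  then have "(\<Sum>i\<in>I. x i) \<in> S" using S(1) by (intro subspace_sum) auto
  then show ?case using insert bilinear_onD(1)[OF f] y by simp
qed (use bilinear_on_zero(1)[OF f S y] in auto)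

lemma card_independent_le_dim:
  assumes "fd_subspace S" "B \<subseteq> S" "independent B"
  shows "finite B" "card B \<le> dim S"
proof -
  obtain C where C: "finite C" "independent C" "span C = S" "C \<subseteq> S"
    by (rule fd_subspace_basis[OF assms(1)])
  have "finite B \<and> card B \<le> card C"
    using independent_span_bound[OF C(1) assms(3)] assms(2) C(3) by simp
  moreover have "dim S = card C" using C(2,3) dim_span_eq_card_independent by metis
  ultimately show "finite B" "card B \<le> dim S" by auto
qed

text \<open>
  Pairing a linear relation with \<open>v j\<close> isolates the coefficient of \<open>u j\<close>.
\<close>

lemma biorthogonal_independent:
  fixes \<omega> :: "'w::real_vector \<Rightarrow> 'w \<Rightarrow> real"
  assumes \<omega>: "bilinear_on W W \<omega>" and W: "subspace W" and I: "finite I"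
    and u: "\<And>i. i \<in> I \<Longrightarrow> u i \<in> W" and v: "\<And>i. i \<in> I \<Longrightarrow> v i \<in> W"
    and uv: "\<And>i j. i \<in> I \<Longrightarrow> j \<in> I \<Longrightarrow> \<omega> (u i) (v j) = (if i = j then k i else 0)"
    and k: "\<And>i. i \<in> I \<Longrightarrow> k i \<noteq> 0"
  shows "inj_on u I" "independent (u ` I)"
proof -
  show inj: "inj_on u I"
  proof (rule inj_onI, rule ccontr)
    fix i j assume ij: "i \<in> I" "j \<in> I" "u i = u j" "i \<noteq> j"
    then show False using uv[of i i] uv[of j i] k[of i] by simp
  qed
  show "independent (u ` I)"
  proof
    assume "dependent (u ` I)"
    then obtain r where r: "\<exists>x\<in>u ` I. r x \<noteq> 0" "(\<Sum>x\<in>u ` I. r x *\<^sub>R x) = 0"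
      using I by (auto simp: dependent_finite)
    then obtain j where j: "j \<in> I" "r (u j) \<noteq> 0" by auto
    have "(\<Sum>i\<in>I. r (u i) *\<^sub>R u i) = 0" using r(2) inj by (simp add: sum.reindex)
    then have "0 = \<omega> (\<Sum>i\<in>I. r (u i) *\<^sub>R u i) (v j)"
      using bilinear_on_zero(1)[OF \<omega> W W v[OF j(1)]] by simp
    also have "\<dots> = (\<Sum>i\<in>I. \<omega> (r (u i) *\<^sub>R u i) (v j))"
      using u W by (intro bilinear_on_sum_left[OF \<omega> W W v[OF j(1)]]) (simp add: subspace_scale)
    also have "\<dots> = (\<Sum>i\<in>I. if i = j then r (u j) * k j else 0)"
      using bilinear_onD(3)[OF \<omega> u v[OF j(1)]] uv j(1) by (intro sum.cong) auto
    also have "\<dots> = r (u j) * k j" using I j(1) by simp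
    finally show False using j k by simp
  qed
qed

definition symplectic_system ::
    "'w::real_vector set \<Rightarrow> ('w \<Rightarrow> 'w \<Rightarrow> real) \<Rightarrow> nat \<Rightarrow> (nat \<Rightarrow> 'w) \<Rightarrow> (nat \<Rightarrow> 'w) \<Rightarrow> bool"
  where "symplectic_system W \<omega> l s t \<longleftrightarrow> (\<forall>i<l. s i \<in> W \<and> t i \<in> W) \<and>
    (\<forall>i<l. \<forall>j<l. \<omega> (s i) (s j) = 0 \<and> \<omega> (t i) (t j) = 0 \<and>
      \<omega> (s i) (t j) = (if i = j then 1 else 0) \<and> \<omega> (t i) (s j) = (if i = j then -1 else 0))"

lemma symplectic_systemD:
  assumes "symplectic_system W \<omega> l s t"
  shows "i < l \<Longrightarrow> s i \<in> W" "i < l \<Longrightarrow> t i \<in> W"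
    and "i < l \<Longrightarrow> j < l \<Longrightarrow> \<omega> (s i) (s j) = 0"
    and "i < l \<Longrightarrow> j < l \<Longrightarrow> \<omega> (t i) (t j) = 0"
    and "i < l \<Longrightarrow> j < l \<Longrightarrow> \<omega> (s i) (t j) = (if i = j then 1 else 0)"
    and "i < l \<Longrightarrow> j < l \<Longrightarrow> \<omega> (t i) (s j) = (if i = j then -1 else 0)"
  using assms unfolding symplectic_system_def by blast+

lemma symplectic_system_combination:
  assumes \<omega>: "bilinear_on W W \<omega>" and W: "subspace W" and sys: "symplectic_system W \<omega> l s t"
      and j: "j < l"
  shows "\<omega> (\<Sum>i<l. x i *\<^sub>R s i + y i *\<^sub>R t i) (t j) = x j"
    and "\<omega> (\<Sum>i<l. x i *\<^sub>R s i + y i *\<^sub>R t i) (s j) = - y j"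
proof -
  note D = symplectic_systemD[OF sys]
  have mem: "x i *\<^sub>R s i + y i *\<^sub>R t i \<in> W" if "i < l" for i
    using D(1,2) W that by (simp add: subspace_add subspace_scale)
  have ev: "\<omega> (x i *\<^sub>R s i + y i *\<^sub>R t i) w = x i * \<omega> (s i) w + y i * \<omega> (t i) w"
    if "i < l" "w \<in> W" for i w
    using bilinear_onD(1,3)[OF \<omega>] D(1,2) that W by (simp add: subspace_scale)
  have sum: "\<omega> (\<Sum>i<l. x i *\<^sub>R s i + y i *\<^sub>R t i) w = (\<Sum>i<l. x i * \<omega> (s i) w + y i * \<omega> (t i) w)"
    if "w \<in> W" for w
    using bilinear_on_sum_left[OF \<omega> W W that, of "{..<l}"
        "\<lambda>i. x i *\<^sub>R s i + y i *\<^sub>R t i"] mem ev that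
    by simp
  have "(\<Sum>i<l. x i * \<omega> (s i) (t j) + y i * \<omega> (t i) (t j)) = (\<Sum>i<l. if i = j then x j else 0)"
    by (rule sum.cong) (auto simp: D(4,5) j)
  then show "\<omega> (\<Sum>i<l. x i *\<^sub>R s i + y i *\<^sub>R t i) (t j) = x j"
    using sum[OF D(2)[OF j]] j by simp
  have "(\<Sum>i<l. x i * \<omega> (s i) (s j) + y i * \<omega> (t i) (s j)) = (\<Sum>i<l. if i = j then - y j else 0)"
    by (rule sum.cong) (auto simp: D(3,6) j)
  then show "\<omega> (\<Sum>i<l. x i *\<^sub>R s i + y i *\<^sub>R t i) (s j) = - y j"
    using sum[OF D(1)[OF j]] j by simp
qed

lemma symplectic_system_independent:
  assumes \<omega>: "bilinear_on W W \<omega>" and W: "subspace W" and sys: "symplectic_system W \<omega> l s t"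
  defines "B \<equiv> (\<lambda>(a, i). if a then s i else t i) ` (UNIV \<times> {..<l})"
  shows "independent B" "card B = 2 * l" "B \<subseteq> W"
proof -
  note D = symplectic_systemD[OF sys]
  let ?u = "\<lambda>(a, i). if a then s i else t i" and ?v = "\<lambda>(a, i). if a then t i else s i"
  let ?k = "\<lambda>(a, i). if a then 1 else - 1 :: real"
  have "?u x \<in> W" "?v x \<in> W" "?k x \<noteq> 0" if "x \<in> UNIV \<times> {..<l}" for x
    using that D(1,2) by (auto split: prod.splits)
  moreover have "\<omega> (?u x) (?v y) = (if x = y then ?k x else 0)"
    if "x \<in> UNIV \<times> {..<l}" "y \<in> UNIV \<times> {..<l}" for x y
    using that D(3-6) by (auto split: prod.splits)
  ultimately have "inj_on ?u (UNIV \<times> {..<l})" "independent B"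
    unfolding B_def using biorthogonal_independent[OF \<omega> W, of "UNIV \<times> {..<l}" ?u ?v ?k] by auto
  then show "independent B" "card B = 2 * l"
    unfolding B_def by (simp_all add: card_image card_cartesian_product)
  show "B \<subseteq> W" unfolding B_def using D(1,2) by auto
qed

text \<open>
  A symplectic system of maximal length spans: a nonzero vector orthogonal to the system would
      have a
  partner that is also orthogonal to it, and together they would form one more hyperbolic pair.
\<close>

lemma symplectic_basis_exists:
  assumes W: "fd_subspace W" and \<omega>: "bilinear_on W W \<omega>"
    and skew: "\<And>s t. s \<in> W \<Longrightarrow> t \<in> W \<Longrightarrow> \<omega> s t = - \<omega> t s"
    and nondeg: "\<And>s. s \<in> W \<Longrightarrow> (\<And>t. t \<in> W \<Longrightarrow> \<omega> s t = 0) \<Longrightarrow> s = 0"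
  obtains l s t where "symplectic_system W \<omega> l s t" "dim W = 2 * l"
    "\<forall>w\<in>W. w = (\<Sum>i<l. \<omega> w (t i) *\<^sub>R s i - \<omega> w (s i) *\<^sub>R t i)"
proof -
  have sW: "subspace W" using W by (rule fd_subspace_imp_subspace)
  let ?P = "\<lambda>l. \<exists>s t. symplectic_system W \<omega> l s t"
  have "?P 0" by (simp add: symplectic_system_def)
  moreover have "l \<le> dim W" if Pl: "?P l" for l
  proof -
    obtain s t where sys: "symplectic_system W \<omega> l s t" using Pl by blast
    note B = symplectic_system_independent[OF \<omega> sW sys]
    show ?thesis using card_independent_le_dim(2)[OF W B(3,1)] B(2) by simp
  qed
  ultimately have "\<exists>l. ?P l \<and> (\<forall>n. ?P n \<longrightarrow> n \<le> l)"
    by (intro Nat.ex_has_greatest_nat[of ?P 0 "dim W"]) simp_all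
  then obtain l where l: "?P l" "\<forall>n. ?P n \<longrightarrow> n \<le> l" by blast
  then obtain s t where sys: "symplectic_system W \<omega> l s t" by blast
  note D = symplectic_systemD[OF sys]
  \<comment> \<open>the projection to the orthogonal complement of the system\<close>
  define pr where "pr w = w - (\<Sum>i<l. \<omega> w (t i) *\<^sub>R s i + (- \<omega> w (s i)) *\<^sub>R t i)" for w
  have sum_in: "(\<Sum>i<l. x i *\<^sub>R s i + y i *\<^sub>R t i) \<in> W" for x y
    using D(1,2) sW by (intro subspace_sum subspace_add subspace_scale) auto
  have diff: "\<omega> (a - b) w = \<omega> a w - \<omega> b w" if "a \<in> W" "b \<in> W" "w \<in> W" for a b w
    using bilinear_onD(1)[OF \<omega>, of a "(-1) *\<^sub>R b" w] bilinear_onD(3)[OF \<omega>, of b w "-1"] that sW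
    by (simp add: subspace_neg)
  have pr_in: "pr w \<in> W" if "w \<in> W" for w
    unfolding pr_def using that sum_in sW by (intro subspace_diff)
  have pr_orth: "\<omega> (pr w) (s j) = 0" "\<omega> (pr w) (t j) = 0" if w: "w \<in> W" and j: "j < l" for w j
    unfolding pr_def diff[OF w sum_in D(1)[OF j]] diff[OF w sum_in D(2)[OF j]]
      symplectic_system_combination[OF \<omega> sW sys j] by simp_all
  have pr0: "pr w = 0" if w: "w \<in> W" for w
  proof (rule ccontr)
    assume "pr w \<noteq> 0"
    then obtain u where u: "u \<in> W" "\<omega> (pr w) u \<noteq> 0" using nondeg[OF pr_in[OF w]] by blast
    have "\<omega> (pr w) (u - pr u) = 0"
    proof -
      define z where "z i = \<omega> u (t i) *\<^sub>R s i + (- \<omega> u (s i)) *\<^sub>R t i" for i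
      have z: "z i \<in> W" if "i \<in> {..<l}" for i
        unfolding z_def using D(1,2) that sW by (intro subspace_add subspace_scale) auto
      have uz: "u - pr u = (\<Sum>i<l. z i)" unfolding pr_def z_def by simp
      have "\<omega> (pr w) (u - pr u) = - \<omega> (u - pr u) (pr w)"
        using skew[OF pr_in[OF w]] u(1) pr_in[OF u(1)] sW by (simp add: subspace_diff)
      also have "\<omega> (u - pr u) (pr w) = (\<Sum>i<l. \<omega> (z i) (pr w))"
        unfolding uz by (rule bilinear_on_sum_left[OF \<omega> sW sW pr_in[OF w] z])
      also have "(\<Sum>i<l. \<omega> (z i) (pr w)) = 0"
      proof (rule sum.neutral, rule ballI)
        fix i assume "i \<in> {..<l}"
        then have i: "i < l" by simp
        note si = D(1)[OF i] and ti = D(2)[OF i]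
        have "\<omega> (s i) (pr w) = 0" "\<omega> (t i) (pr w) = 0"
          using skew[OF si pr_in[OF w]] skew[OF ti pr_in[OF w]] pr_orth[OF w i] by auto
        then show "\<omega> (z i) (pr w) = 0"
          unfolding z_def
            bilinear_onD(1)[OF \<omega> subspace_scale[OF sW si] subspace_scale[OF sW ti] pr_in[OF w]]
            bilinear_onD(3)[OF \<omega> si pr_in[OF w]] bilinear_onD(3)[OF \<omega> ti pr_in[OF w]] by simp
      qed
      finally show ?thesis by simp
    qed
    moreover have "\<omega> (pr w) u = \<omega> (pr w) (u - pr u) + \<omega> (pr w) (pr u)"
      using bilinear_onD(2)[OF \<omega> pr_in[OF w], of "u - pr u" "pr u"] u(1) pr_in[OF u(1)] sW
      by (simp add: subspace_diff)
    ultimately have nz: "\<omega> (pr w) (pr u) \<noteq> 0" using u(2) by simp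
    define v where "v = (1 / \<omega> (pr w) (pr u)) *\<^sub>R pr u"
    have v: "v \<in> W" unfolding v_def using pr_in[OF u(1)] sW by (simp add: subspace_scale)
    have wv: "\<omega> (pr w) v = 1"
      unfolding v_def using bilinear_onD(4)[OF \<omega> pr_in[OF w] pr_in[OF u(1)]] nz by simp
    have vs: "\<omega> v (s j) = 0" "\<omega> v (t j) = 0" if "j < l" for j
      unfolding v_def using bilinear_onD(3)[OF \<omega> pr_in[OF u(1)]] pr_orth[OF u(1) that] D(1,2)[OF
          that] by simp_all
    have self: "\<omega> x x = 0" if "x \<in> W" for x using skew[OF that that] by simp
    have "symplectic_system W \<omega> (Suc l) (s(l := pr w)) (t(l := v))"
      unfolding symplectic_system_def
    proof (intro conjI allI impI)
      fix i j assume ij: "i < Suc l" "j < Suc l"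
      note facts = D vs pr_orth[OF w] wv self[OF v] self[OF pr_in[OF w]] skew[OF D(1) v] skew[OF
          D(2) v]
        skew[OF D(1) pr_in[OF w]] skew[OF D(2) pr_in[OF w]] skew[OF v pr_in[OF w]]
      show "\<omega> ((s(l := pr w)) i) ((s(l := pr w)) j) = 0"
        "\<omega> ((t(l := v)) i) ((t(l := v)) j) = 0"
        "\<omega> ((s(l := pr w)) i) ((t(l := v)) j) = (if i = j then 1 else 0)"
        "\<omega> ((t(l := v)) i) ((s(l := pr w)) j) = (if i = j then - 1 else 0)"
        using ij facts by (cases "i = l"; cases "j = l"; simp add: less_Suc_eq)+
    qed (use D(1,2) v pr_in[OF w] in \<open>auto simp: less_Suc_eq\<close>)
    then have "Suc l \<le> l" using l(2) by blast
    then show False by simp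
  qed
  then have dec: "w = (\<Sum>i<l. \<omega> w (t i) *\<^sub>R s i - \<omega> w (s i) *\<^sub>R t i)" if "w \<in> W" for w
    using that unfolding pr_def by simp
  let ?B = "(\<lambda>(a, i). if a then s i else t i) ` (UNIV \<times> {..<l})"
  note B = symplectic_system_independent[OF \<omega> sW sys]
  have "W \<subseteq> span ?B"
  proof
    fix w assume "w \<in> W"
    moreover have "s i \<in> span ?B" "t i \<in> span ?B" if i: "i < l" for i
    proof -
      show "s i \<in> span ?B" by (rule span_base, rule image_eqI[of _ _ "(True, i)"]) (use i in auto)
      show "t i \<in> span ?B" by (rule span_base, rule image_eqI[of _ _ "(False, i)"]) (use i in auto)
    qed
    ultimately show "w \<in> span ?B"
      by (subst dec) (auto intro!: span_sum span_diff span_scale)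
  qed
  then have "dim W = 2 * l" using dim_unique[OF B(3) _ B(1,2)] by blast
  then show thesis using that sys dec by blast
qed

section \<open>Clifford modules over a line\<close>

lemma dim_trivial: "dim ({0} :: 'a::real_vector set) = 0"
  using dim_span[of "{} :: 'a set"] by (simp add: dim_eq_card_independent[OF independent_empty])

text \<open>
  The union of bases of the summands of a direct sum is a basis of the sum.
\<close>

lemma dim_independent_family:
  fixes n :: nat and S :: "nat \<Rightarrow> 'b::real_vector set"
  assumes ind: "independent_family {..<n} S" and fd: "\<And>i. i < n \<Longrightarrow> fd_subspace (S i)"
  shows "fd_subspace (span (\<Union>i<n. S i))" "dim (span (\<Union>i<n. S i)) = (\<Sum>i<n. dim (S i))"
proof -
  have "\<exists>B. finite B \<and> independent B \<and> span B = S i" if i: "i < n" for i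
    by (rule fd_subspace_basis[OF fd[OF i]]) blast
  then obtain B where B: "\<And>i. i < n \<Longrightarrow> finite (B i)" "\<And>i. i < n \<Longrightarrow> independent (B i)"
    "\<And>i. i < n \<Longrightarrow> span (B i) = S i" by metis
  have BS: "x \<in> S i" if "i < n" "x \<in> B i" for i x using B(3)[OF that(1)] that(2) span_base by blast
  have disj: "B i \<inter> B j = {}" if ij: "i < n" "j < n" "i \<noteq> j" for i j
  proof (rule ccontr)
    assume "B i \<inter> B j \<noteq> {}"
    then obtain x where x: "x \<in> B i" "x \<in> B j" by blast
    define z where "z k = (if k = i then x else - x)" for k
    have "z k \<in> S k" if "k \<in> {i, j}" for k
      using that BS[OF ij(1) x(1)] BS[OF ij(2) x(2)] ij fd_subspace_imp_subspace[OF fd[OF ij(2)]]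
      by (auto simp: z_def subspace_neg)
    moreover have "(\<Sum>k\<in>{i, j}. z k) = 0" using ij by (simp add: z_def)
    ultimately have "z i = 0" using independent_familyD[OF ind, of "{i, j}" z i] ij by auto
    then show False using B(2)[OF ij(1)] x(1) dependent_zero[of "B i"] by (auto simp: z_def)
  qed
  let ?U = "\<Union>i<n. B i"
  have "independent ?U"
  proof
    assume "dependent ?U"
    then obtain r where r: "\<exists>x\<in>?U. r x \<noteq> 0" "(\<Sum>x\<in>?U. r x *\<^sub>R x) = 0"
      using B(1) by (auto simp: dependent_finite)
    have "(\<Sum>i<n. \<Sum>x\<in>B i. r x *\<^sub>R x) = 0"
      using r(2) B(1) disj by (subst (asm) sum.UNION_disjoint) auto
    moreover have "(\<Sum>x\<in>B i. r x *\<^sub>R x) \<in> S i" if "i \<in> {..<n}" for i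
      using that BS fd_subspace_imp_subspace[OF fd] by (intro subspace_sum subspace_scale) auto
    ultimately have 0: "(\<Sum>x\<in>B i. r x *\<^sub>R x) = 0" if "i < n" for i
      using independent_familyD[OF ind, of "{..<n}" "\<lambda>i. \<Sum>x\<in>B i. r x *\<^sub>R x" i] that by simp
    have "r x = 0" if "i < n" "x \<in> B i" for i x
      using independentD[OF B(2)[OF that(1)] B(1)[OF that(1)] order_refl 0[OF that(1)] that(2)] .
    then show False using r(1) by auto
  qed
  moreover have sp: "span ?U = span (\<Union>i<n. S i)"
  proof (rule subset_antisym)
    show "span ?U \<subseteq> span (\<Union>i<n. S i)" using BS by (intro span_mono) blast
    have "S i \<subseteq> span ?U" if "i < n" for i
      unfolding B(3)[OF that, symmetric] using that by (intro span_mono) blast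
    then show "span (\<Union>i<n. S i) \<subseteq> span ?U" by (intro span_minimal) auto
  qed
  ultimately have "dim (span (\<Union>i<n. S i)) = card ?U" using dim_span_eq_card_independent by metis
  also have "\<dots> = (\<Sum>i<n. card (B i))" using B(1) disj by (intro card_UN_disjoint) auto
  also have "\<dots> = (\<Sum>i<n. dim (S i))"
  proof (rule sum.cong)
    fix i assume "i \<in> {..<n}"
    then show "card (B i) = dim (S i)" using dim_span_eq_card_independent[OF B(2)[of i]] B(3)[of
        i] by simp
  qed simp
  finally show "dim (span (\<Union>i<n. S i)) = (\<Sum>i<n. dim (S i))" .
  show "fd_subspace (span (\<Union>i<n. S i))"
    unfolding fd_subspace_def using B(1) sp by (intro exI[of _ ?U]) auto
qed

lemma independent_family_extend:
  assumes ind: "independent_family {..<n} S" and sub: "\<And>i. i < n \<Longrightarrow> subspace (S i)" "subspace T"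
    and disj: "span (\<Union>i<n. S i) \<inter> T \<subseteq> {0}"
  shows "independent_family {..<Suc n} (S(n := T))"
  unfolding independent_family_def
proof (intro allI impI)
  fix J x assume J: "finite J" "J \<subseteq> {..<Suc n}" "\<forall>i\<in>J. x i \<in> (S(n := T)) i" "(\<Sum>i\<in>J. x i) = 0"
  have rest: "x i \<in> S i" if "i \<in> J - {n}" for i using J(3) that by auto
  have sub': "J - {n} \<subseteq> {..<n}" using J(2) by (auto simp: less_Suc_eq)
  have xn: "x n = 0" if n: "n \<in> J"
  proof -
    have "x n = - (\<Sum>i\<in>J - {n}. x i)"
      using J(1,4) n by (simp add: sum.remove eq_neg_iff_add_eq_0)
    moreover have "(\<Sum>i\<in>J - {n}. x i) \<in> span (\<Union>i<n. S i)"
      using rest sub' by (intro span_sum span_base) blast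
    ultimately have "x n \<in> span (\<Union>i<n. S i)" by (simp add: span_neg)
    moreover have "x n \<in> T" using J(3) n by auto
    ultimately show ?thesis using disj by auto
  qed
  then have "(\<Sum>i\<in>J - {n}. x i) = 0"
    using J(1,4) by (cases "n \<in> J") (simp_all add: sum.remove)
  then have "x i = 0" if "i \<in> J - {n}" for i
    using independent_familyD[OF ind _ sub' rest] J(1) that by blast
  then show "\<forall>i\<in>J. x i = 0" using xn by blast
qed

text \<open>
  By the lower bound, submodules of dimension \<open>k\<close> are irreducible; conversely, an irreducible
      submodule
  contains one of dimension \<open>k\<close> by \<open>minimal\<close> with \<open>U = 0\<close>. As long as an independent family of
  them does not span \<open>W\<close>, \<open>minimal\<close> provides another one outside the span. A family of maximal
      length
  is therefore a decomposition, and comparing dimensions shows that all decompositions have the same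
  length.
\<close>

lemma num_irreducible_components_uniform:
  fixes W :: "'w::real_vector set"
  assumes W: "fd_subspace W" and Wsub: "clifford_submodule V c W W" and k: "0 < k"
    and lower: "\<And>T. clifford_submodule V c W T \<Longrightarrow> T \<noteq> {0} \<Longrightarrow> k \<le> dim T"
    and minimal: "\<And>s U. s \<in> W \<Longrightarrow> clifford_submodule V c W U \<Longrightarrow> s \<notin> U \<Longrightarrow>
      \<exists>T. clifford_submodule V c W T \<and> dim T = k \<and> \<not> T \<subseteq> U \<and>
        (\<forall>S. clifford_submodule V c W S \<longrightarrow> s \<in> S \<longrightarrow> T \<subseteq> S)"
    and add: "\<And>v s t. v \<in> V \<Longrightarrow> s \<in> W \<Longrightarrow> t \<in> W \<Longrightarrow> c v (s + t) = c v s + c v t"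
    and scale: "\<And>v r s. v \<in> V \<Longrightarrow> s \<in> W \<Longrightarrow> c v (r *\<^sub>R s) = r *\<^sub>R c v s"
  shows "num_irreducible_components V c W * k = dim W"
proof -
  have sW: "subspace W" using W by (rule fd_subspace_imp_subspace)
  have fd: "fd_subspace T" if "clifford_submodule V c W T" for T
    using that fd_subspace_subset[OF W] unfolding clifford_submodule_def by blast
  have sub0: "clifford_submodule V c W {0}"
    unfolding clifford_submodule_def using sW scale[of _ 0 0] by (auto simp: subspace_0)
  have irr: "irreducible_submodule V c W S" if S: "clifford_submodule V c W S" and d: "dim S = k"
      for S
    unfolding irreducible_submodule_def
  proof (intro conjI allI impI S)
    show "S \<noteq> {0}" using d k by (auto simp: dim_trivial)
    fix T assume T: "clifford_submodule V c W T" "T \<subseteq> S"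
    have "id ` T = S" if "T \<noteq> {0}"
      using dim_le_of_inj(2)[OF fd[OF S] linear_id, of T] T lower[OF T(1) that] d
      unfolding clifford_submodule_def by auto
    then show "T = {0} \<or> T = S" by auto
  qed
  have irr_dim: "dim S = k" if S: "irreducible_submodule V c W S" for S
  proof -
    have S': "clifford_submodule V c W S" "S \<noteq> {0}" using S unfolding irreducible_submodule_def
        by auto
    then obtain s where s: "s \<in> S" "s \<noteq> 0"
      unfolding clifford_submodule_def using subspace_0 by blast
    then have "s \<in> W" "s \<notin> {0}" using S'(1) unfolding clifford_submodule_def by auto
    from minimal[OF this(1) sub0 this(2)] obtain T
        where T: "clifford_submodule V c W T" "dim T = k" "\<not> T \<subseteq> {0}" "T \<subseteq> S"
      using S'(1) s(1) by blast
    then show ?thesis using S unfolding irreducible_submodule_def by auto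
  qed
  let ?Q = "\<lambda>(n::nat) S. (\<forall>i<n. irreducible_submodule V c W (S i)) \<and> independent_family {..<n} S"
  have sub_irr: "clifford_submodule V c W (S i)" if "?Q n S" "i < n" for n :: nat and S i
    using that unfolding irreducible_submodule_def by auto
  have dims: "fd_subspace (span (\<Union>i<n. S i)) \<and> dim (span (\<Union>i<n. S i)) = n * k" if Q: "?Q n S"
      for n S
    using dim_independent_family[of n S] Q fd[OF sub_irr[OF Q]] irr_dim by simp
  have in_W: "span (\<Union>i<n. S i) \<subseteq> W" if Q: "?Q n S" for n S
    by (rule span_minimal) (use sub_irr[OF Q] sW in \<open>auto simp: clifford_submodule_def\<close>)
  have stable: "clifford_submodule V c W (span (\<Union>i<n. S i))" if Q: "?Q n S" for n S
    unfolding clifford_submodule_def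
  proof (intro conjI ballI in_W[OF Q])
    fix v s assume v: "v \<in> V" and s: "s \<in> span (\<Union>i<n. S i)"
    have "span (\<Union>i<n. S i) \<subseteq> {s \<in> W. c v s \<in> span (\<Union>i<n. S i)}"
    proof (rule span_minimal)
      show "(\<Union>i<n. S i) \<subseteq> {s \<in> W. c v s \<in> span (\<Union>i<n. S i)}"
      proof clarsimp
        fix i s assume "i < n" "s \<in> S i"
        then show "s \<in> W \<and> c v s \<in> span (\<Union>i<n. S i)"
          using sub_irr[OF Q, of i] v unfolding clifford_submodule_def by (auto intro!: span_base)
      qed
      show "subspace {s \<in> W. c v s \<in> span (\<Union>i<n. S i)}"
        unfolding subspace_def using sW v scale[OF v, of 0 0]
        by (auto simp: subspace_0 subspace_add subspace_scale add scale span_0 span_add span_scale)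
    qed
    then show "c v s \<in> span (\<Union>i<n. S i)" using s by blast
  qed simp
  have "\<exists>S. ?Q 0 S" by (simp add: independent_family_def)
  moreover have "n \<le> dim W" if "\<exists>S. ?Q n S" for n
  proof -
    obtain S where S: "?Q n S" using \<open>\<exists>S. ?Q n S\<close> by blast
    obtain B where B: "finite B" "independent B" "span B = span (\<Union>i<n. S i)" "B \<subseteq> span (\<Union>i<n. S i)"
      using dims[OF S] fd_subspace_basis by metis
    then have "n * k = card B" using dims[OF S] dim_span_eq_card_independent[OF B(2)] by simp
    also have "\<dots> \<le> dim W" using card_independent_le_dim(2)[OF W _ B(2)] B(4) in_W[OF S] by blast
    finally have "n * k \<le> dim W" .
    moreover have "n \<le> n * k" using k by (cases k) auto
    ultimately show ?thesis by (rule order_trans[rotated])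
  qed
  ultimately have "\<exists>n. (\<exists>S. ?Q n S) \<and> (\<forall>m. (\<exists>S. ?Q m S) \<longrightarrow> m \<le> n)"
    by (intro Nat.ex_has_greatest_nat[of "\<lambda>n. \<exists>S. ?Q n S" 0 "dim W"]) simp_all
  then obtain n where n: "\<exists>S. ?Q n S" "\<forall>m. (\<exists>S. ?Q m S) \<longrightarrow> m \<le> n" by blast
  then obtain S where S: "?Q n S" by blast
  have full: "span (\<Union>i<n. S i) = W"
  proof (rule ccontr)
    assume "span (\<Union>i<n. S i) \<noteq> W"
    then obtain s where s: "s \<in> W" "s \<notin> span (\<Union>i<n. S i)" using in_W[OF S] by blast
    obtain T where T: "clifford_submodule V c W T" "dim T = k" "\<not> T \<subseteq> span (\<Union>i<n. S i)"
      using minimal[OF s(1) stable[OF S] s(2)] by blast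
    have "clifford_submodule V c W (span (\<Union>i<n. S i) \<inter> T)"
      using T(1) stable[OF S] unfolding clifford_submodule_def by (auto intro: subspace_inter)
    then have "span (\<Union>i<n. S i) \<inter> T = {0}"
      using irr[OF T(1,2)] T(3) unfolding irreducible_submodule_def by blast
    then have "independent_family {..<Suc n} (S(n := T))"
      using S sub_irr[OF S] T(1) unfolding clifford_submodule_def
      by (intro independent_family_extend) auto
    then have "?Q (Suc n) (S(n := T))" using S irr[OF T(1,2)] by (auto simp: less_Suc_eq)
    then have "Suc n \<le> n" using n(2) by blast
    then show False by simp
  qed
  have "num_irreducible_components V c W = n"
    unfolding num_irreducible_components_def
  proof (rule the_equality)
    show "\<exists>S. (\<forall>i<n. irreducible_submodule V c W (S i)) \<and> independent_family {..<n} S \<and> span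
        (\<Union>i<n. S i) = W"
      using S full by blast
    fix m :: nat assume "\<exists>S. (\<forall>i<m. irreducible_submodule V c W
        (S i)) \<and> independent_family {..<m} S \<and> span (\<Union>i<m. S i) = W"
    then obtain S' where S': "?Q m S'" "span (\<Union>i<m. S' i) = W" by blast
    have "m * k = n * k" using dims[OF S'(1)] dims[OF S] full S'(2) by simp
    then show "m = n" using k by simp
  qed
  then show ?thesis using dims[OF S] full by simp
qed

text \<open>
  The generator \<open>e\<close> squares to \<open>- b e e\<close>. If this is negative and \<open>s \<noteq> 0\<close>, then \<open>s\<close>
      and \<open>c e s\<close> are independent,
  and they span the submodule generated by \<open>s\<close>. If it is positive, the submodule generated by \<open>s\<close>
  contains the two components of \<open>s\<close> along the eigenspaces of \<open>e\<close>, each of which spans a submodule.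
\<close>

lemma num_irreducible_components_line:
  fixes W :: "'w::real_vector set"
  assumes V: "V = span {e}" and W: "fd_subspace W" and cl: "clifford_module V b W c"
      and e: "b e e \<noteq> 0"
  shows "num_irreducible_components V c W * (if 0 < b e e then 2 else 1) = dim W"
proof -
  have sW: "subspace W" using W by (rule fd_subspace_imp_subspace)
  have eV: "e \<in> V" using V by (simp add: span_base)
  note bil = bilinear_onD[of V W c]
  have cb: "bilinear_on V W c" and cW: "\<And>v s. v \<in> V \<Longrightarrow> s \<in> W \<Longrightarrow> c v s \<in> W"
    using cl unfolding clifford_module_def by auto
  have sq: "c e (c e s) = - b e e *\<^sub>R s" if "s \<in> W" for s
  proof -
    have "c e (c e s) + c e (c e s) = (- 2 * b e e) *\<^sub>R s"
        using cl eV that unfolding clifford_module_def by blast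
    then have "2 *\<^sub>R c e (c e s) = 2 *\<^sub>R (- b e e *\<^sub>R s)" by (simp add: scaleR_2)
    then show ?thesis by (simp only: scaleR_cancel_left) simp
  qed
  have submod: "clifford_submodule V c W T" if T: "subspace T" "T \<subseteq> W" "\<And>s. s \<in> T \<Longrightarrow> c e s \<in> T" for T
    unfolding clifford_submodule_def
  proof (intro conjI ballI T(1,2))
    fix v s assume "v \<in> V" and s: "s \<in> T"
    then obtain r where "v = r *\<^sub>R e" using V by (auto simp: span_singleton)
    then have "c v s = r *\<^sub>R c e s" using bil(3)[OF cb eV, of s r] s T(2) by auto
    then show "c v s \<in> T" using T(1,3) s by (simp add: subspace_scale)
  qed
  have submodD: "subspace T" "T \<subseteq> W" "s \<in> T \<Longrightarrow> c e s \<in> T" if "clifford_submodule V c W T" for T s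
    using that eV unfolding clifford_submodule_def by auto
  have span_sub: "clifford_submodule V c W (span A)" if A: "A \<subseteq> W" "\<And>s. s \<in> A \<Longrightarrow> c e s \<in> span A"
      for A
  proof (rule submod)
    show AW: "span A \<subseteq> W" using A(1) sW by (rule span_minimal)
    have "span A \<subseteq> {s \<in> W. c e s \<in> span A}"
    proof (rule span_minimal)
      show "A \<subseteq> {s \<in> W. c e s \<in> span A}" using A by auto
      show "subspace {s \<in> W. c e s \<in> span A}"
        unfolding subspace_def using sW bil(2,4)[OF cb eV] bil(4)[OF cb eV, of 0 0]
        by (auto simp: subspace_0 subspace_add subspace_scale span_0 span_add span_scale)
    qed
    then show "c e s \<in> span A" if "s \<in> span A" for s using that by blast
  qed simp
  show ?thesis
  proof (rule num_irreducible_components_uniform[OF W])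
    show "clifford_submodule V c W W" by (rule submod[OF sW]) (use cW[OF eV] in auto)
    show "c v (s + t) = c v s + c v t" if "v \<in> V" "s \<in> W" "t \<in> W" for v s t
        using bil(2)[OF cb that] .
    show "c v (r *\<^sub>R s) = r *\<^sub>R c v s" if "v \<in> V" "s \<in> W" for v r s using bil(4)[OF cb that] .
    have pair: "independent {s, c e s} \<and> s \<noteq> c e s" if s: "s \<in> W" "s \<noteq> 0" and pos: "0 < b e e" for s
    proof -
      have no: "c e s \<noteq> r *\<^sub>R s" for r
      proof
        assume r: "c e s = r *\<^sub>R s"
        have "c e (c e s) = (r * r) *\<^sub>R s" using bil(4)[OF cb eV s(1), of r] r by simp
        then have "(r * r) *\<^sub>R s = (- b e e) *\<^sub>R s" using sq[OF s(1)] by simp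
        then have "r * r = - b e e" using s(2) by (simp only: scaleR_cancel_right) simp
        moreover have "0 \<le> r * r" by simp
        ultimately show False using pos by linarith
      qed
      from no have "c e s \<notin> span {s}" by (auto simp: span_singleton)
      then have "independent {c e s, s}" using s(2) by (simp add: independent_insert)
      moreover have "s \<noteq> c e s" using no[of 1] by auto
      ultimately show ?thesis by (simp add: insert_commute)
    qed
    show "(if 0 < b e e then 2 else 1) \<le> dim T" if T: "clifford_submodule V c W T" "T \<noteq> {0}" for T
    proof -
      have fdT: "fd_subspace T" using fd_subspace_subset[OF W] submodD[OF T(1)] by blast
      obtain s where s: "s \<in> T" "s \<noteq> 0" using T(2) submodD(1)[OF T(1)] subspace_0 by blast
      then have sW: "s \<in> W" using submodD(2)[OF T(1)] by blast
      show ?thesis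
      proof (cases "0 < b e e")
        case True
        have "card {s, c e s} \<le> dim T"
          using card_independent_le_dim(2)[OF fdT, of
              "{s, c e s}"] pair[OF sW s(2) True] s(1) submodD(3)[OF T(1)] by auto
        then show ?thesis using pair[OF sW s(2) True] True by simp
      next
        case False
        have "card {s} \<le> dim T"
          using card_independent_le_dim(2)[OF fdT, of "{s}"] s by simp
        then show ?thesis using False by simp
      qed
    qed
    show "\<exists>T. clifford_submodule V c W T \<and> dim T = (if 0 < b e e then 2 else 1) \<and> \<not> T \<subseteq> U \<and>
        (\<forall>S. clifford_submodule V c W S \<longrightarrow> s \<in> S \<longrightarrow> T \<subseteq> S)"
      if s: "s \<in> W" and U: "clifford_submodule V c W U" "s \<notin> U" for s U
    proof (cases "0 < b e e")
      case True
      have s0: "s \<noteq> 0" using U subspace_0 submodD(1) by blast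
      note p = pair[OF s s0 True]
      have "clifford_submodule V c W (span {s, c e s})"
      proof (rule span_sub)
        show "{s, c e s} \<subseteq> W" using s cW[OF eV] by auto
        show "c e u \<in> span {s, c e s}" if "u \<in> {s, c e s}" for u
        proof -
          have "u = s \<or> u = c e s" using that by blast
          moreover have "(- b e e) *\<^sub>R s \<in> span {s, c e s}" by (intro span_scale span_base) simp
          moreover have "c e s \<in> span {s, c e s}" by (intro span_base) simp
          ultimately show ?thesis using sq[OF s] by metis
        qed
      qed
      moreover have "dim (span {s, c e s}) = 2" using p dim_span_eq_card_independent by fastforce
      moreover have "\<not> span {s, c e s} \<subseteq> U" using U(2) span_base[of s "{s, c e s}"] by blast
      moreover have "span {s, c e s} \<subseteq> S" if "clifford_submodule V c W S" "s \<in> S" for S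
        by (rule span_minimal) (use submodD[OF that(1)] that(2) in auto)
      ultimately show ?thesis
        using True by (intro exI[of _ "span {s, c e s}"]) (simp del: dim_span)
    next
      case False
      then have neg: "b e e < 0" using e by simp
      define \<mu> where "\<mu> = sqrt (- b e e)"
      have \<mu>: "\<mu> > 0" "\<mu> * \<mu> = - b e e" unfolding \<mu>_def using neg by simp_all
      \<comment> \<open>The action of \<open>e\<close> is diagonalizable with eigenvalues \<open>\<mu>\<close> and \<open>- \<mu>\<close>.\<close>
      have eig: "\<exists>T. clifford_submodule V c W T \<and> dim T = 1 \<and> \<not> T \<subseteq> U \<and>
          (\<forall>S. clifford_submodule V c W S \<longrightarrow> s \<in> S \<longrightarrow> T \<subseteq> S)"
        if \<sigma>: "\<sigma> * \<sigma> = \<mu> * \<mu>" and u: "\<sigma> *\<^sub>R s + c e s \<notin> U" for \<sigma>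
      proof -
        define u where "u = \<sigma> *\<^sub>R s + c e s"
        have uW: "u \<in> W" unfolding u_def using s cW[OF eV] sW
            by (simp add: subspace_add subspace_scale)
        have u0: "u \<noteq> 0" using u subspace_0[OF submodD(1)[OF U(1)]] unfolding u_def by auto
        have "c e u = \<sigma> *\<^sub>R c e s + c e (c e s)"
          unfolding u_def using bil(2,4)[OF cb eV] s cW[OF eV s] sW by (simp add: subspace_scale)
        also have "\<dots> = \<sigma> *\<^sub>R u"
          unfolding u_def sq[OF s] \<mu>(2)[symmetric] \<sigma>[symmetric] by (simp add: scaleR_add_right)
        finally have cu: "c e u = \<sigma> *\<^sub>R u" .
        have "clifford_submodule V c W (span {u})"
          by (rule span_sub) (use uW cu in \<open>auto intro: span_scale span_base\<close>)
        moreover have "dim (span {u}) = 1" using u0 dim_span_eq_card_independent[of "{u}"] by simp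
        moreover have "\<not> span {u} \<subseteq> U" using u span_base[of u "{u}"] unfolding u_def by blast
        moreover have "span {u} \<subseteq> S" if "clifford_submodule V c W S" "s \<in> S" for S
          using submodD[OF that(1)] that(2) unfolding u_def
          by (intro span_minimal) (auto simp: subspace_add subspace_scale)
        ultimately show ?thesis by blast
      qed
      have "\<mu> *\<^sub>R s + c e s \<notin> U \<or> (- \<mu>) *\<^sub>R s + c e s \<notin> U"
      proof (rule ccontr)
        assume "\<not> ?thesis"
        then have "(1 / (2 * \<mu>)) *\<^sub>R ((\<mu> *\<^sub>R s + c e s) - ((- \<mu>) *\<^sub>R s + c e s)) \<in> U"
          using submodD(1)[OF U(1)] by (intro subspace_scale subspace_diff) auto
        moreover have "(1 / (2 * \<mu>)) *\<^sub>R ((\<mu> *\<^sub>R s + c e s) - ((- \<mu>) *\<^sub>R s + c e s)) = s"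
        proof -
          have "(\<mu> *\<^sub>R s + c e s) - ((- \<mu>) *\<^sub>R s + c e s) = (2 * \<mu>) *\<^sub>R s"
              by (simp add: scaleR_add_left[symmetric])
          then show ?thesis using \<mu>(1) by simp
        qed
        ultimately show False using U(2) by simp
      qed
      then show ?thesis using eig[of \<mu>] eig[of "- \<mu>"] False by auto
    qed
  qed simp
qed

lemma line_basis:
  assumes "pseudo_euclidean V b" "dim V = 1"
  obtains e where "V = span {e}" "b e e \<noteq> 0"
proof -
  have V: "fd_subspace V" "bilinear_on V V b" "nondegenerate_on V b"
    using assms(1) unfolding pseudo_euclidean_def by auto
  obtain B where B: "finite B" "independent B" "span B = V" "B \<subseteq> V"
      by (rule fd_subspace_basis[OF V(1)])
  have "card B = 1" using assms(2) dim_span_eq_card_independent[OF B(2)] B(3) by simp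
  then obtain e where e: "B = {e}" by (auto simp: card_1_singleton_iff)
  have eV: "e \<in> V" using B(4) e by simp
  have "b e e \<noteq> 0"
  proof
    assume 0: "b e e = 0"
    have "b e v = 0" if v: "v \<in> V" for v
    proof -
      obtain r where "v = r *\<^sub>R e" using v B(3) e by (auto simp: span_singleton)
      then show ?thesis using bilinear_onD(4)[OF V(2) eV eV, of r] 0 by simp
    qed
    then have "e = 0" using V(3) eV unfolding nondegenerate_on_def by blast
    then show False using B(2) e by (simp add: dependent_zero)
  qed
  then show thesis using that B(3) e by blast
qed

lemma signature_line:
  assumes V: "V = span {e}" and b: "bilinear_on V V b" and e: "b e e \<noteq> 0"
  shows "has_signature V b pq \<longleftrightarrow> pq = (if 0 < b e e then (1, 0) else (0, 1))"
proof
  have eV: "e \<in> V" using V by (simp add: span_base)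
  have e0: "e \<noteq> 0" using e bilinear_onD(3)[OF b eV eV, of 0] by auto
  have line: "card {x \<in> {f}. 0 < b x x} = (if 0 < b e e then 1 else 0)"
    "card {x \<in> {f}. b x x < 0} = (if 0 < b e e then 0 else 1)" if f: "f \<in> V" "b f f \<noteq> 0" for f
  proof -
    obtain r where r: "f = r *\<^sub>R e" using f(1) V by (auto simp: span_singleton)
    have "b f f = r * r * b e e"
      using bilinear_onD(3)[OF b eV f(1), of r] bilinear_onD(4)[OF b eV eV, of r] r by simp
    moreover have "0 < r * r" using f(2) calculation
        by (cases "r = 0") (auto simp: zero_less_mult_iff)
    ultimately have "0 < b f f \<longleftrightarrow> 0 < b e e" by (simp add: zero_less_mult_iff)
    then have "{x \<in> {f}. 0 < b x x} = (if 0 < b e e then {f} else {})"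
      "{x \<in> {f}. b x x < 0} = (if 0 < b e e then {} else {f})" using f(2) by auto
    then show "card {x \<in> {f}. 0 < b x x} = (if 0 < b e e then 1 else 0)"
      "card {x \<in> {f}. b x x < 0} = (if 0 < b e e then 0 else 1)" by simp_all
  qed
  show "pq = (if 0 < b e e then (1, 0) else (0, 1))" if sig: "has_signature V b pq"
  proof -
    obtain B where B: "independent B" "span B = V" "\<forall>e\<in>B. b e e \<noteq> 0"
      "card {e \<in> B. 0 < b e e} = fst pq" "card {e \<in> B. b e e < 0} = snd pq"
      using sig unfolding has_signature_def by (elim exE conjE) (rule that)
    have "card B = card {e}"
      using dim_span_eq_card_independent[OF B(1)] dim_span_eq_card_independent[of "{e}"] B(2) V e0
          by simp
    then obtain f where f: "B = {f}" by (auto simp: card_1_singleton_iff)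
    then have "f \<in> V" "b f f \<noteq> 0" using B(2,3) span_base by auto
    from line[OF this] B(4,5) show ?thesis unfolding f by (auto simp: prod_eq_iff split: if_splits)
  qed
  show "has_signature V b pq" if "pq = (if 0 < b e e then (1, 0) else (0, 1))"
    unfolding has_signature_def
    by (rule exI[of _ "{e}"]) (use that V e e0 line[OF eV e] in auto)
qed

section \<open>Extended translation algebras over a line\<close>

locale translation_line =
  fixes V :: "'v::real_vector set" and b and W :: "'w::real_vector set" and c \<beta> e
  assumes data: "extended_translation_data V b W c \<beta>" and V: "V = span {e}" and e: "b e e \<noteq> 0"
begin

definition form :: "'w \<Rightarrow> 'w \<Rightarrow> real"
  where "form s t = \<beta> (c e s) t / b e e"

abbreviation (input) m
  where "m \<equiv> extended_translation_algebra V b W c \<beta>"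

lemma fd_subspace_W: "fd_subspace W" and W_nontrivial: "W \<noteq> {0}" and bilinear_b: "bilinear_on V V b"
  and clifford: "clifford_module V b W c" and bilinear_beta: "bilinear_on W W \<beta>"
  using data unfolding extended_translation_data_def pseudo_euclidean_def by auto

lemma subspace_W: "subspace W"
  using fd_subspace_W by (rule fd_subspace_imp_subspace)

lemma e_in_V: "e \<in> V"
  using V by (simp add: span_base)

lemma bilinear_c: "bilinear_on V W c" and action_closed: "v \<in> V \<Longrightarrow> s \<in> W \<Longrightarrow> c v s \<in> W"
  using clifford unfolding clifford_module_def by auto

lemma e_nonzero: "e \<noteq> 0"
  using e bilinear_onD(3)[OF bilinear_b e_in_V e_in_V, of 0] by auto

lemma bilinear_form: "bilinear_on W W form"
  using bilinear_onD[OF bilinear_beta] bilinear_onD(2,4)[OF bilinear_c e_in_V] action_closed[OF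
      e_in_V]
  unfolding bilinear_on_def form_def by (simp add: add_divide_distrib)

text \<open>
  Moving \<open>e\<close> to the other argument contributes the sign \<open>\<epsilon>\<close> and exchanging the arguments the sign
  \<open>- \<epsilon>\<close>.
\<close>

lemma form_skew:
  assumes "s \<in> W" "t \<in> W" shows "form s t = - form t s"
proof -
  obtain \<epsilon> :: real where \<epsilon>: "\<epsilon> = -1 \<and> (\<forall>s\<in>W. \<forall>t\<in>W. \<beta> s t = \<beta> t s) \<or>
      \<epsilon> = 1 \<and> (\<forall>s\<in>W. \<forall>t\<in>W. \<beta> s t = - \<beta> t s)"
    and adj: "\<forall>v\<in>V. \<forall>s\<in>W. \<forall>t\<in>W. \<beta> (c v s) t = \<epsilon> * \<beta> s (c v t)"
    using data unfolding extended_translation_data_def by blast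
  have "\<beta> (c e s) t = \<epsilon> * \<beta> s (c e t)" using adj e_in_V assms by blast
  also have "\<dots> = - \<beta> (c e t) s"
    using \<epsilon>
  proof (elim disjE conjE)
    assume "\<epsilon> = -1" "\<forall>s\<in>W. \<forall>t\<in>W. \<beta> s t = \<beta> t s"
    then show ?thesis using bspec[OF bspec[OF _ assms(1)] action_closed[OF e_in_V assms(2)]] by simp
  next
    assume "\<epsilon> = 1" "\<forall>s\<in>W. \<forall>t\<in>W. \<beta> s t = - \<beta> t s"
    then show ?thesis using bspec[OF bspec[OF _ assms(1)] action_closed[OF e_in_V assms(2)]] by simp
  qed
  finally show ?thesis by (simp add: form_def)
qed

lemma form_nondegenerate:
  assumes s: "s \<in> W" and 0: "\<And>t. t \<in> W \<Longrightarrow> form s t = 0"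
  shows "s = 0"
proof -
  have "\<forall>t\<in>W. \<beta> (c e s) t = 0" using 0 e by (simp add: form_def)
  then have ces: "c e s = 0"
    using data action_closed[OF e_in_V s] unfolding extended_translation_data_def
        nondegenerate_on_def by blast
  have "c e 0 = 0" using bilinear_onD(4)[OF bilinear_c e_in_V, of 0 0] subspace_W
      by (simp add: subspace_0)
  then have "(- 2 * b e e) *\<^sub>R s = 0"
    using clifford e_in_V s ces unfolding clifford_module_def by (metis add.right_neutral)
  then show ?thesis using e by simp
qed

lemma translation_bracket_eq:
  assumes s: "s \<in> W" and t: "t \<in> W"
  shows "translation_bracket V b c \<beta> s t = form s t *\<^sub>R e"
  unfolding translation_bracket_def
proof (rule the_equality)
  have pair: "b (x *\<^sub>R e) (y *\<^sub>R e) = x * y * b e e" for x y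
    using bilinear_onD(3)[OF bilinear_b e_in_V, of
        "y *\<^sub>R e" x] bilinear_onD(4)[OF bilinear_b e_in_V e_in_V, of y] V
    by (simp add: span_base span_scale)
  have act: "\<beta> (c (y *\<^sub>R e) s) t = y * \<beta> (c e s) t" for y
    using bilinear_onD(3)[OF bilinear_c e_in_V s, of y] bilinear_onD(3)[OF bilinear_beta
        action_closed[OF e_in_V s] t, of y] by simp
  show "form s t *\<^sub>R e \<in> V \<and> (\<forall>v\<in>V. b (form s t *\<^sub>R e) v = \<beta> (c v s) t)"
    using V e by (auto simp: span_singleton pair act form_def)
  fix x assume x: "x \<in> V \<and> (\<forall>v\<in>V. b x v = \<beta> (c v s) t)"
  then obtain r where r: "x = r *\<^sub>R e" using V by (auto simp: span_singleton)
  have "b x e = \<beta> (c e s) t" using x e_in_V by blast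
  then have "r * b e e = \<beta> (c e s) t" using pair[of r 1] r by simp
  then have "r = form s t" using e by (simp add: form_def eq_divide_eq)
  then show "x = form s t *\<^sub>R e" using r by simp
qed

lemma grade_m: "grade m p = (if p = -2 then V \<times> {0} else if p = -1 then {0} \<times> W else {0})"
  by (simp add: extended_translation_algebra_def)

lemma lie_br_m: "snd x \<in> W \<Longrightarrow> snd y \<in> W \<Longrightarrow> lie_br m x y = (form (snd x) (snd y) *\<^sub>R e, 0)"
  by (simp add: extended_translation_algebra_def translation_bracket_eq)

lemma subspace_grade_m: "subspace (grade m p)"
  unfolding grade_m using V subspace_W by (auto intro!: subspace_Times)

lemma independent_grade_m: "independent_family UNIV (grade m)"
proof (rule independent_family_eigenspaces[where E = "\<lambda>x. (- 2 *\<^sub>R fst x, - snd x)"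
    and ev = real_of_int])
  show "linear (\<lambda>x :: 'v \<times> 'w. (- 2 *\<^sub>R fst x, - snd x))"
    by (rule linearI) (simp_all add: scaleR_add_right)
  show "subspace (grade m p)" for p by (rule subspace_grade_m)
  show "(- 2 *\<^sub>R fst x, - snd x) = real_of_int p *\<^sub>R x" if "x \<in> grade m p" for p x
    using that by (auto simp: grade_m zero_prod_def split: if_splits)
  show "inj_on real_of_int UNIV" by (simp add: inj_on_def)
qed

lemma lie_space_m: "lie_space m \<subseteq> V \<times> W"
  unfolding lie_space_def
proof (rule span_minimal)
  show "subspace (V \<times> W)" using V subspace_W by (auto intro: subspace_Times)
  have "0 \<in> V" "0 \<in> W" using V subspace_W by (simp_all add: subspace_0 span_0)
  then show "(\<Union>p. grade m p) \<subseteq> V \<times> W"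
    unfolding grade_m by (auto simp: zero_prod_def split: if_splits)
qed

lemma bilinear_m: "bilinear_on (lie_space m) (lie_space m) (lie_br m)"
proof -
  have mem: "snd x \<in> W" if "x \<in> lie_space m" for x using that lie_space_m by auto
  show ?thesis
    unfolding bilinear_on_def
    using mem bilinear_onD[OF bilinear_form] subspace_W
    by (simp add: lie_br_m subspace_add subspace_scale scaleR_add_left)
qed

end

locale translation_line_basis = translation_line V b W c \<beta> e
  for V :: "'v::real_vector set" and b and W :: "'w::real_vector set" and c \<beta> e +
  fixes l :: nat and s t :: "nat \<Rightarrow> 'w"
  assumes sys: "symplectic_system W form l s t" and dimW: "dim W = 2 * l"
    and dec: "\<And>w. w \<in> W \<Longrightarrow> w = (\<Sum>i<l. form w (t i) *\<^sub>R s i - form w (s i) *\<^sub>R t i)"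
begin

text \<open>
  Translations are determined by their value at the origin, which identifies the Heisenberg algebra
  of fields with the abstract one.
\<close>

definition value_at_origin :: "vfield \<Rightarrow> 'v \<times> 'w"
  where "value_at_origin X = (X Cz 0 *\<^sub>R e, \<Sum>i<l. X (Cx i) 0 *\<^sub>R s i + X (Cy i) 0 *\<^sub>R t i)"

lemma linear_value: "linear value_at_origin"
  by (rule linearI)
    (simp_all add: value_at_origin_def scaleR_add_left sum.distrib scaleR_sum_right
        scaleR_add_right)

lemma value_translation:
  "i < l \<Longrightarrow> value_at_origin (translation_field (Cx i)) = (0, s i)"
  "i < l \<Longrightarrow> value_at_origin (translation_field (Cy i)) = (0, t i)"
  "value_at_origin (translation_field Cz) = (e, 0)"
proof -
  assume i: "i < l"
  have "(\<Sum>j<l. translation_field (Cx i) (Cx j) 0 *\<^sub>R s j + translation_field (Cx i)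
      (Cy j) 0 *\<^sub>R t j)
      = (\<Sum>j<l. if j = i then s i else 0)"
    by (rule sum.cong) (auto simp: comp_field_apply)
  then show "value_at_origin (translation_field (Cx i)) = (0, s i)"
    using i unfolding value_at_origin_def by (simp add: comp_field_apply)
  have "(\<Sum>j<l. translation_field (Cy i) (Cx j) 0 *\<^sub>R s j + translation_field (Cy i)
      (Cy j) 0 *\<^sub>R t j)
      = (\<Sum>j<l. if j = i then t i else 0)"
    by (rule sum.cong) (auto simp: comp_field_apply)
  then show "value_at_origin (translation_field (Cy i)) = (0, t i)"
    using i unfolding value_at_origin_def by (simp add: comp_field_apply)
next
  show "value_at_origin (translation_field Cz) = (e, 0)"
    unfolding value_at_origin_def by (simp add: comp_field_apply)
qed

lemma value_minus_one:
  "value_at_origin (\<Sum>i<l. x i *\<^sub>R translation_field (Cx i) + y i *\<^sub>R translation_field (Cy i))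
    = (0, \<Sum>i<l. x i *\<^sub>R s i + y i *\<^sub>R t i)"
proof -
  have "value_at_origin (\<Sum>i<l. x i *\<^sub>R translation_field (Cx i) + y i *\<^sub>R translation_field (Cy i))
      = (\<Sum>i<l. (0, x i *\<^sub>R s i + y i *\<^sub>R t i))"
    unfolding linear_sum[OF linear_value]
    by (rule sum.cong)
      (simp_all add: linear_add[OF linear_value] linear_scale[OF linear_value] value_translation
        del: translation_field.simps)
  also have "\<dots> = (0, \<Sum>i<l. x i *\<^sub>R s i + y i *\<^sub>R t i)" by (simp add: sum_prod)
  finally show ?thesis .
qed

lemmas basis = symplectic_systemD[OF sys]

lemma value_grade: "value_at_origin ` grade (heisenberg_algebra l) p = grade m p"
proof -
  have sub: "subspace (grade (contact_algebra l) q)" for q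
    using fd_subspace_imp_subspace[OF fd_subspace_contact_grade] .
  have v0: "value_at_origin 0 = 0" using linear_0[OF linear_value] .
  have one: "value_at_origin ` grade (contact_algebra l) (-1) = {0} \<times> W"
  proof (rule subset_antisym)
    have "value_at_origin X \<in> {0} \<times> W" if X: "X \<in> grade (contact_algebra l) (-1)" for X
    proof -
      have "(\<Sum>i<l. X (Cx i) 0 *\<^sub>R s i + X (Cy i) 0 *\<^sub>R t i) \<in> W"
        using basis(1,2) subspace_W by (intro subspace_sum subspace_add subspace_scale) auto
      then show ?thesis by (subst contact_grade_minus_one[OF X])
          (simp add: value_minus_one del: translation_field.simps)
    qed
    then show "value_at_origin ` grade (contact_algebra l) (-1) \<subseteq> {0} \<times> W" by blast
    have "(0, w) \<in> value_at_origin ` grade (contact_algebra l) (-1)" if w: "w \<in> W" for w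
    proof (rule image_eqI)
      let ?X = "\<Sum>i<l. form w (t i) *\<^sub>R translation_field (Cx i) + (- form w
          (s i)) *\<^sub>R translation_field (Cy i)"
      show "(0, w) = value_at_origin ?X"
        unfolding value_minus_one using dec[OF w] by simp
      show "?X \<in> grade (contact_algebra l) (-1)"
        using translation_field_grade[of "Cx _" l] translation_field_grade[of "Cy _" l] sub[of "-1"]
        by (intro subspace_sum subspace_add subspace_scale) auto
    qed
    then show "{0} \<times> W \<subseteq> value_at_origin ` grade (contact_algebra l) (-1)" by auto
  qed
  have two: "value_at_origin ` grade (contact_algebra l) (-2) = V \<times> {0}"
  proof (rule subset_antisym)
    have val: "value_at_origin (r *\<^sub>R translation_field Cz) = (r *\<^sub>R e, 0)" for r
      using linear_scale[OF linear_value, of r "translation_field Cz"] value_translation(3) by simp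
    have "value_at_origin X \<in> V \<times> {0}" if X: "X \<in> grade (contact_algebra l) (-2)" for X
      by (subst contact_grade_minus_two[OF X]) (use val V in \<open>auto simp: span_singleton\<close>)
    then show "value_at_origin ` grade (contact_algebra l) (-2) \<subseteq> V \<times> {0}" by blast
    have "(r *\<^sub>R e, 0) \<in> value_at_origin ` grade (contact_algebra l) (-2)" for r
    proof (rule image_eqI)
      show "(r *\<^sub>R e, 0) = value_at_origin (r *\<^sub>R translation_field Cz)" using val by simp
      show "r *\<^sub>R translation_field Cz \<in> grade (contact_algebra l) (-2)"
        using translation_field_grade[of Cz l] sub[of "-2"] by (intro subspace_scale) auto
    qed
    then show "V \<times> {0} \<subseteq> value_at_origin ` grade (contact_algebra l) (-2)"
      using V by (auto simp: span_singleton)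
  qed
  have below: "grade (contact_algebra l) p = {0}" if "p < -2"
    using contact_grade_below[OF that] subspace_0[OF sub] by blast
  consider "p = -1" | "p = -2" | "p < -2" | "p \<ge> 0" by linarith
  then show ?thesis
    using one two below v0 unfolding heisenberg_algebra_def negative_part_simps(1) grade_m
    by cases auto
qed

lemma value_inj_grade:
  assumes X: "X \<in> grade (heisenberg_algebra l) p" and 0: "value_at_origin X = 0"
  shows "X = 0"
proof -
  have X': "p < 0 \<and> X \<in> grade (contact_algebra l) p \<or> X = 0"
    using X unfolding heisenberg_algebra_def negative_part_simps(1) by (auto split: if_splits)
  consider "p = -1" | "p = -2" | "p < -2" | "p \<ge> 0" by linarith
  then show ?thesis
  proof cases
    case 1
    have sum0: "(\<Sum>i<l. X (Cx i) 0 *\<^sub>R s i + X (Cy i) 0 *\<^sub>R t i) = 0"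
      using 0 unfolding value_at_origin_def by (simp add: zero_prod_def)
    have "X (Cx i) 0 = 0 \<and> X (Cy i) 0 = 0" if i: "i < l" for i
      using symplectic_system_combination[OF bilinear_form subspace_W sys i, of "\<lambda>i. X (Cx i) 0"
          "\<lambda>i. X (Cy i) 0"]
        bilinear_on_zero(1)[OF bilinear_form subspace_W subspace_W basis(1)[OF i]]
        bilinear_on_zero(1)[OF bilinear_form subspace_W subspace_W basis(2)[OF i]]
      unfolding sum0 by simp
    then have "X = 0" if "X \<in> grade (contact_algebra l) (-1)"
      by (subst contact_grade_minus_one[OF that]) simp
    then show ?thesis using X' 1 by auto
  next
    case 2
    have "X Cz 0 = 0" using 0 e_nonzero unfolding value_at_origin_def by (simp add: zero_prod_def)
    then have "X = 0" if "X \<in> grade (contact_algebra l) (-2)"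
      by (subst contact_grade_minus_two[OF that]) simp
    then show ?thesis using X' 2 by auto
  next
    case 3
    then show ?thesis using X' contact_grade_below[OF 3, of X l] by blast
  next
    case 4
    then show ?thesis using X' by simp
  qed
qed

lemma graded_lie_algebra_heisenberg: "graded_lie_algebra (heisenberg_algebra l)"
  unfolding heisenberg_algebra_def by (rule graded_lie_algebra_negative_part[OF
      graded_lie_algebra_contact])

lemma translation_fields_span: "span (translation_field ` coords l)
    = lie_space (heisenberg_algebra l)"
proof (rule subset_antisym)
  have "translation_field k \<in> grade (heisenberg_algebra l) (- int (weight k))" if "k \<in> coords l"
      for k
    using translation_field_grade[OF that] weight_pos[of k] unfolding heisenberg_algebra_def by simp
  then show "span (translation_field ` coords l) \<subseteq> lie_space (heisenberg_algebra l)"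
    by (intro span_minimal) (auto intro: grade_subset_lie_space)
  have "X \<in> span (translation_field ` coords l)" if X: "X \<in> grade (heisenberg_algebra l) p" for X p
  proof (cases "p < 0")
    case True
    then have "X \<in> span (translation_field ` {k \<in> coords l. - int (weight k) = p})"
      using X by (intro contact_grade_negative_span) (simp_all add: heisenberg_algebra_def)
    then show ?thesis by (rule span_mono[THEN subsetD, rotated]) blast
  next
    case False
    then show ?thesis using X unfolding heisenberg_algebra_def by (simp add: span_0)
  qed
  then show "lie_space (heisenberg_algebra l) \<subseteq> span (translation_field ` coords l)"
    unfolding lie_space_def by (intro span_minimal) auto
qed

lemma value_bracket:
  assumes j: "j \<in> coords l" and k: "k \<in> coords l"
  shows "value_at_origin (field_bracket l (translation_field j) (translation_field k))
    = lie_br m (value_at_origin (translation_field j)) (value_at_origin (translation_field k))"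
proof -
  have lhs: "value_at_origin (field_bracket l (translation_field j) (translation_field k))
      = (heisenberg_coeff j k *\<^sub>R e, 0)"
    unfolding translation_field_bracket[OF j k] linear_scale[OF linear_value] value_translation
        by simp
  have z: "form 0 w = 0" "form w 0 = 0" if "w \<in> W" for w
    using bilinear_on_zero[OF bilinear_form subspace_W subspace_W] that by auto
  have z0: "0 \<in> W" using subspace_W by (rule subspace_0)
  have "lie_br m (value_at_origin (translation_field j)) (value_at_origin (translation_field k))
      = (heisenberg_coeff j k *\<^sub>R e, 0)"
    using j k
    by (cases j; cases k)
      (auto simp: value_translation lie_br_m basis z z0 heisenberg_coeff_def simp del:
          translation_field.simps)
  with lhs show ?thesis by simp
qed

lemma heisenberg_iso_m: "graded_lie_iso (heisenberg_algebra l) m"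
  and m_iso_heisenberg: "graded_lie_iso m (heisenberg_algebra l)"
proof -
  note L = graded_lie_algebra_heisenberg
  have sub: "value_at_origin ` grade (heisenberg_algebra l) p \<subseteq> grade m p" for p
    using value_grade[of p] by simp
  have hom: "graded_lie_hom (heisenberg_algebra l) m value_at_origin"
  proof (rule graded_lie_homI[OF L bilinear_m linear_value sub translation_fields_span])
    fix x y assume "x \<in> translation_field ` coords l" "y \<in> translation_field ` coords l"
    then show "value_at_origin (lie_br (heisenberg_algebra l) x y)
        = lie_br m (value_at_origin x) (value_at_origin y)"
      using value_bracket unfolding heisenberg_algebra_def by auto
  qed
  have inj: "inj_on value_at_origin (lie_space (heisenberg_algebra l))"
    by (rule graded_linear_map_inj[OF L independent_grade_m subspace_grade_m linear_value sub
        value_inj_grade])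
  show "graded_lie_iso (heisenberg_algebra l) m" by (rule graded_lie_isoI[OF hom inj value_grade])
  show "graded_lie_iso m (heisenberg_algebra l)"
      by (rule graded_lie_iso_inverse[OF hom inj value_grade L])
qed

lemma rank_pos: "0 < l"
proof (rule ccontr)
  assume "\<not> 0 < l"
  then have "w = 0" if "w \<in> W" for w using dec[OF that] by simp
  then have "W = {0}" using subspace_0[OF subspace_W] by auto
  then show False using W_nontrivial by simp
qed

lemma contact_transitive_prolongation: "transitive_prolongation m (contact_algebra l)"
  unfolding transitive_prolongation_def
  using graded_lie_algebra_contact fd_subspace_contact_grade heisenberg_iso_m[unfolded
      heisenberg_algebra_def]
    transitive_contact_algebra[OF rank_pos] unfolding transitive_grading_def by blast

lemma prolongation_embeds:
  assumes "transitive_prolongation m g"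
  shows "\<exists>\<phi>. graded_lie_hom g (contact_algebra l) \<phi> \<and> inj_on \<phi> (lie_space g)"
proof (rule transitive_embedding)
  show "graded_lie_iso (negative_part g) (negative_part (contact_algebra l))"
    using assms m_iso_heisenberg graded_lie_iso_trans
    unfolding transitive_prolongation_def heisenberg_algebra_def by blast
  show "graded_lie_algebra g" "transitive_grading g"
    using assms unfolding transitive_prolongation_def transitive_grading_def by blast+
qed (rule graded_lie_algebra_contact transitive_contact_algebra[OF rank_pos]
    contact_derivations_inner)+

lemma contact_maximal: "maximal_transitive_prolongation m (contact_algebra l)"
  unfolding maximal_transitive_prolongation_def
  using contact_transitive_prolongation prolongation_embeds by blast

text \<open>
  Maximality yields the embedding of the contact algebra, by way of its copy in the space of
  sequences.
\<close>

lemma maximal_iso_contact: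
  fixes g :: "'g::real_vector graded_lie"
  assumes max: "maximal_transitive_prolongation m g"
  shows "graded_lie_iso g (contact_algebra l)"
proof -
  have g: "transitive_prolongation m g" using max unfolding maximal_transitive_prolongation_def
      by blast
  then have gL: "graded_lie_algebra g" "\<And>p. fd_subspace (grade g p)"
      unfolding transitive_prolongation_def by auto
  obtain \<phi> where \<phi>: "graded_lie_hom g (contact_algebra l) \<phi>" "inj_on \<phi> (lie_space g)"
    using prolongation_embeds[OF g] by blast
  obtain g' :: "(nat \<Rightarrow> real) graded_lie" and \<psi>
    where g': "transitive_prolongation m g'" and \<psi>: "linear \<psi>"
        "inj_on \<psi> (lie_space (contact_algebra l))"
      "\<And>p. grade g' p = \<psi> ` grade (contact_algebra l) p"
    by (rule transitive_prolongation_sequence_copy[OF contact_transitive_prolongation]) blast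
  obtain \<eta> where \<eta>: "graded_lie_hom g' g \<eta>" "inj_on \<eta> (lie_space g')"
    using max g' unfolding maximal_transitive_prolongation_def by blast
  show ?thesis
  proof (rule graded_lie_iso_of_mutual_embeddings[OF gL fd_subspace_contact_grade \<phi>])
    show "linear (\<eta> \<circ> \<psi>)" using \<psi>(1) \<eta>(1) linear_compose unfolding graded_lie_hom_def by blast
    show "(\<eta> \<circ> \<psi>) ` grade (contact_algebra l) p \<subseteq> grade g p" for p
      using \<eta>(1) \<psi>(3)[of p] unfolding graded_lie_hom_def image_comp[symmetric] by metis
    show "inj_on (\<eta> \<circ> \<psi>) (grade (contact_algebra l) p)" for p
    proof (rule comp_inj_on)
      show "inj_on \<psi> (grade (contact_algebra l) p)"
        using \<psi>(2) by (rule inj_on_subset) (auto intro: grade_subset_lie_space simp del: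
            contact_algebra_simps)
      show "inj_on \<eta> (\<psi> ` grade (contact_algebra l) p)"
        unfolding \<psi>(3)[symmetric] using \<eta>(2) by (rule inj_on_subset)
            (auto intro: grade_subset_lie_space)
    qed
  qed
qed

lemma num_components: "num_irreducible_components V c W * (if 0 < b e e then 2 else 1) = 2 * l"
  using num_irreducible_components_line[OF V fd_subspace_W clifford e] dimW by simp

end

lemma (in translation_line) symplectic_basis:
  obtains l s t where "translation_line_basis V b W c \<beta> e l s t"
proof -
  obtain l s t where "symplectic_system W form l s t" "dim W = 2 * l"
    "\<forall>w\<in>W. w = (\<Sum>i<l. form w (t i) *\<^sub>R s i - form w (s i) *\<^sub>R t i)"
    by (rule symplectic_basis_exists[OF fd_subspace_W bilinear_form form_skew form_nondegenerate])
  then have "translation_line_basis V b W c \<beta> e l s t"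
    by unfold_locales blast+
  then show thesis by (rule that)
qed

lemma extended_translation_data_line:
  assumes "extended_translation_data V b W c \<beta>" "dim V = 1"
  obtains e l s t where "translation_line_basis V b W c \<beta> e l s t"
proof -
  have "pseudo_euclidean V b" using assms(1) unfolding extended_translation_data_def by blast
  then obtain e where e: "V = span {e}" "b e e \<noteq> 0" using assms(2) by (rule line_basis)
  interpret translation_line V b W c \<beta> e by (rule translation_line.intro[OF assms(1) e])
  obtain l s t where "translation_line_basis V b W c \<beta> e l s t" by (rule symplectic_basis)
  then show thesis by (rule that)
qed

section \<open>Every number of components occurs\<close>

definition unit_seq :: "nat \<Rightarrow> nat \<Rightarrow> real"
  where "unit_seq i = (\<lambda>j. if j = i then 1 else 0)"

definition rotation :: "nat \<Rightarrow> (nat \<Rightarrow> real) \<Rightarrow> nat \<Rightarrow> real"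
  where "rotation n s = (\<lambda>i. if i < n then - s (n + i) else if i < 2 * n then s (i - n) else 0)"

definition dot :: "nat \<Rightarrow> (nat \<Rightarrow> real) \<Rightarrow> (nat \<Rightarrow> real) \<Rightarrow> real"
  where "dot n s t = (\<Sum>i<n. s i * t i + s (n + i) * t (n + i))"

lemma coordinate_space_span: "{s :: nat \<Rightarrow> real. \<forall>i\<ge>m. s i = 0} = span (unit_seq ` {..<m})"
proof (rule subset_antisym)
  show "span (unit_seq ` {..<m}) \<subseteq> {s. \<forall>i\<ge>m. s i = 0}"
    by (rule span_minimal) (auto simp: unit_seq_def subspace_def)
  have "s \<in> span (unit_seq ` {..<m})" if s: "\<forall>i\<ge>m. s i = 0" for s :: "nat \<Rightarrow> real"
  proof -
    have "s = (\<Sum>i<m. s i *\<^sub>R unit_seq i)"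
    proof
      fix j
      have "(\<Sum>i<m. s i *\<^sub>R unit_seq i) j = (\<Sum>i<m. (s i *\<^sub>R unit_seq i) j)" by (rule sum_fun_apply)
      also have "\<dots> = (\<Sum>i<m. if i = j then s j else 0)"
        by (rule sum.cong) (auto simp: unit_seq_def)
      also have "\<dots> = s j" using s by simp
      finally show "s j = (\<Sum>i<m. s i *\<^sub>R unit_seq i) j" by simp
    qed
    moreover have "(\<Sum>i<m. s i *\<^sub>R unit_seq i) \<in> span (unit_seq ` {..<m})"
      by (intro span_sum span_scale span_base) auto
    ultimately show ?thesis by simp
  qed
  then show "{s. \<forall>i\<ge>m. s i = 0} \<subseteq> span (unit_seq ` {..<m})" by blast
qed

lemma unit_seq_independent: "inj_on unit_seq A" "independent (unit_seq ` {..<m})"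
proof -
  show "inj_on unit_seq A"
    by (rule inj_onI) (auto simp: unit_seq_def fun_eq_iff split: if_splits)
  show "independent (unit_seq ` {..<m})"
  proof (rule biorthogonal_independent(2)[where W = UNIV and v = unit_seq and k = "\<lambda>_. 1"
        and \<omega> = "\<lambda>s t. \<Sum>i<m. s i * t i"])
    show "bilinear_on UNIV UNIV (\<lambda>s t :: nat \<Rightarrow> real. \<Sum>i<m. s i * t i)"
      by (simp add: bilinear_on_def distrib_left distrib_right sum.distrib sum_distrib_left
          algebra_simps)
    fix i j assume ij: "i \<in> {..<m}" "j \<in> {..<m}"
    have "(\<Sum>k<m. unit_seq i k * unit_seq j k) = (\<Sum>k<m.
        if k = i then (if i = j then 1 else 0) else 0)"
      by (rule sum.cong) (auto simp: unit_seq_def)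
    then show "(\<Sum>k<m. unit_seq i k * unit_seq j k) = (if i = j then 1 else 0)" using ij by simp
  qed auto
qed

text \<open>
  This is \<open>\<complex>\<^sup>n\<close> as a real space, with \<open>e\<close> acting as multiplication by \<open>\<i>\<close>, which is skew for the
  Euclidean inner product.
\<close>

lemma standard_translation_data:
  fixes n :: nat
  assumes n: "1 \<le> n"
  defines "V \<equiv> span {unit_seq 0}" and "b \<equiv> \<lambda>u v :: nat \<Rightarrow> real. u 0 * v 0"
    and "W \<equiv> {s :: nat \<Rightarrow> real. \<forall>i\<ge>2 * n. s i = 0}" and "c \<equiv> \<lambda>v s. v 0 *\<^sub>R rotation n s"
  shows "extended_translation_data V b W c (dot n)" "dim V = 1" "dim W = 2 * n"
proof -
  have u0: "unit_seq 0 \<noteq> 0" by (auto simp: unit_seq_def fun_eq_iff)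
  show dimV: "dim V = 1" unfolding V_def using u0 dim_span_eq_card_independent[of "{unit_seq 0}"]
      by simp
  have Wspan: "W = span (unit_seq ` {..<2 * n})" unfolding W_def by (rule coordinate_space_span)
  show dimW: "dim W = 2 * n"
    unfolding Wspan dim_span_eq_card_independent[OF unit_seq_independent(2)]
    by (simp add: card_image unit_seq_independent(1))
  have fd_subspace_W: "fd_subspace W" unfolding fd_subspace_def Wspan by blast
  have subspace_W: "subspace W" using fd_subspace_W by (rule fd_subspace_imp_subspace)
  have W_nontrivial: "W \<noteq> {0}" using dimW n by (auto simp: dim_trivial)
  have V_eq: "v = v 0 *\<^sub>R unit_seq 0" if "v \<in> V" for v
    using that unfolding V_def by (auto simp: span_singleton unit_seq_def)
  have bil_b: "bilinear_on V V b" unfolding bilinear_on_def b_def by (simp add: algebra_simps)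
  have nd_b: "nondegenerate_on V b"
  proof -
    have u: "unit_seq 0 \<in> V" unfolding V_def by (simp add: span_base)
    have "v = 0" if v: "v \<in> V" "v 0 = 0" for v using V_eq[OF v(1)] v(2) by simp
    moreover have "unit_seq 0 0 = 1" by (simp add: unit_seq_def)
    ultimately show ?thesis
      unfolding nondegenerate_on_def b_def using u by force
  qed
  have pe: "pseudo_euclidean V b"
    unfolding pseudo_euclidean_def
  proof (intro conjI bil_b nd_b)
    show "fd_subspace V" unfolding fd_subspace_def V_def by blast
    show "V \<noteq> {0}" using dimV by (auto simp: dim_trivial)
    show "\<forall>v\<in>V. \<forall>u\<in>V. b v u = b u v" by (simp add: b_def mult.commute)
  qed
  have rot_add: "rotation n (s + t) = rotation n s + rotation n t" for s t
    by (simp add: rotation_def fun_eq_iff)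
  have rot_scale: "rotation n (r *\<^sub>R s) = r *\<^sub>R rotation n s" for r s
    by (simp add: rotation_def fun_eq_iff)
  have rot_W: "rotation n s \<in> W" for s
    unfolding W_def rotation_def by simp
  have rot_rot: "rotation n (rotation n s) = - s" if "s \<in> W" for s
    using that unfolding W_def by (auto simp: rotation_def fun_eq_iff)
  have bil_c: "bilinear_on V W c"
    unfolding bilinear_on_def c_def by (simp add: rot_add rot_scale scaleR_add_left
        scaleR_add_right mult.commute)
  have clifford: "clifford_module V b W c"
    unfolding clifford_module_def
  proof (intro conjI ballI subspace_W bil_c)
    show "c v s \<in> W" for v s unfolding c_def using rot_W subspace_W by (simp add: subspace_scale)
    show "c v (c u s) + c u (c v s) = (- 2 * b v u) *\<^sub>R s" if "s \<in> W" for v u s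
      unfolding c_def b_def by (simp add: rot_scale rot_rot[OF that] fun_eq_iff)
  qed
  have bil_dot: "bilinear_on W W (dot n)"
    unfolding bilinear_on_def dot_def
    by (simp add: algebra_simps sum.distrib sum_distrib_left)
  have dot_sym: "dot n s t = dot n t s" for s t unfolding dot_def by (simp add: mult.commute)
  have dot_pos: "s = 0" if s: "s \<in> W" "dot n s s = 0" for s
  proof -
    have "\<forall>i\<in>{..<n}. s i * s i + s (n + i) * s (n + i) = 0"
      using s(2) unfolding dot_def by (subst (asm) sum_nonneg_eq_0_iff) auto
    then have z: "s i = 0" "s (n + i) = 0" if "i < n" for i
      using that by (auto simp: sum_squares_eq_zero_iff)
    have "s i = 0" for i
    proof -
      consider "i < n" | "n \<le> i" "i < 2 * n" | "2 * n \<le> i" by linarith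
      then show ?thesis
        using z(1)[of i] z(2)[of "i - n"] s(1) unfolding W_def by cases auto
    qed
    then show ?thesis by (simp add: fun_eq_iff)
  qed
  have nd_dot: "nondegenerate_on W (dot n)" unfolding nondegenerate_on_def using dot_pos by blast
  have dot_rot: "dot n (rotation n s) t = (\<Sum>i<n. s i * t (n + i) - s (n + i) * t i)" for s t
    unfolding dot_def by (rule sum.cong) (auto simp: rotation_def)
  have adj: "dot n (rotation n s) t = - dot n s (rotation n t)" for s t
    unfolding dot_sym[of s] dot_rot by (simp add: sum_negf[symmetric] mult.commute)
  have dot_scale: "dot n (r *\<^sub>R s) t = r * dot n s t" "dot n s (r *\<^sub>R t) = r * dot n s t" for r s t
    unfolding dot_def by (simp_all add: sum_distrib_left algebra_simps)
  have inv: "so_invariant V W c (dot n)"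
  proof -
    have "spin_act c v u s = 0" for v u s
      unfolding spin_act_def c_def by (simp add: rot_scale mult.commute)
    moreover have "dot n 0 s = 0" "dot n s 0 = 0" for s unfolding dot_def by simp_all
    ultimately show ?thesis unfolding so_invariant_def by simp
  qed
  have "\<forall>v\<in>V. \<forall>s\<in>W. \<forall>t\<in>W. dot n (c v s) t = (-1) * dot n s (c v t)"
    unfolding c_def by (simp add: dot_scale adj)
  then show "extended_translation_data V b W c (dot n)"
    unfolding extended_translation_data_def
    using pe fd_subspace_W W_nontrivial clifford bil_dot nd_dot inv dot_sym by blast
qed

section \<open>Prolongations over a line\<close>

theorem proposition4p5:
  shows "(\<forall>(V :: 'v::real_vector set) b (W :: 'w::real_vector set) c \<beta> (g :: 'g::real_vector graded_lie) m N.
      extended_translation_data V b W c \<beta> \<longrightarrow> dim V = 1 \<longrightarrow>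
      m = extended_translation_algebra V b W c \<beta> \<longrightarrow>
      maximal_transitive_prolongation m g \<longrightarrow>
      N = num_irreducible_components V c W \<longrightarrow>
        (has_signature V b (1, 0) \<longleftrightarrow> \<not> has_signature V b (0, 1)) \<and>
        (has_signature V b (1, 0) \<longrightarrow>
          N \<ge> 1 \<and> graded_lie_iso m (heisenberg_algebra N) \<and>
          graded_lie_iso g (contact_algebra N)) \<and>
        (has_signature V b (0, 1) \<longrightarrow>
          N \<ge> 1 \<and> even N \<and> graded_lie_iso m (heisenberg_algebra (N div 2)) \<and>
          graded_lie_iso g (contact_algebra (N div 2)))) \<and>
    (\<forall>n\<ge>1. \<exists>(V :: (nat \<Rightarrow> real) set) b (W :: (nat \<Rightarrow> real) set) c \<beta> (g :: vfield graded_lie).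
      extended_translation_data V b W c \<beta> \<and> dim V = 1 \<and> has_signature V b (1, 0) \<and>
      maximal_transitive_prolongation (extended_translation_algebra V b W c \<beta>) g \<and>
      num_irreducible_components V c W = n)"
proof (intro conjI allI impI)
  fix V :: "'v set" and b and W :: "'w set" and c \<beta> and g :: "'g graded_lie" and m N
  assume data: "extended_translation_data V b W c \<beta>" "dim V = 1"
    and m: "m = extended_translation_algebra V b W c \<beta>"
    and max: "maximal_transitive_prolongation m g"
    and N: "N = num_irreducible_components V c W"
  obtain e l s t where "translation_line_basis V b W c \<beta> e l s t"
    by (rule extended_translation_data_line[OF data])
  then interpret translation_line_basis V b W c \<beta> e l s t .
  note sig = signature_line[OF V bilinear_b e]
  note isos = m_iso_heisenberg maximal_iso_contact[OF max[unfolded m]]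
  show "has_signature V b (1, 0) \<longleftrightarrow> \<not> has_signature V b (0, 1)" unfolding sig by simp
  {
    assume "has_signature V b (1, 0)"
    then have "N = l" using num_components N unfolding sig by (simp split: if_splits)
    then show "N \<ge> 1" "graded_lie_iso m (heisenberg_algebra N)"
        "graded_lie_iso g (contact_algebra N)"
      using rank_pos isos m by simp_all
  next
    assume "has_signature V b (0, 1)"
    then have "N = 2 * l" using num_components N unfolding sig by (simp split: if_splits)
    then show "N \<ge> 1" "even N" "graded_lie_iso m (heisenberg_algebra (N div 2))"
      "graded_lie_iso g (contact_algebra (N div 2))"
      using rank_pos isos m by simp_all
  }
next
  fix n :: nat assume n: "1 \<le> n"
  let ?V = "span {unit_seq 0}" and ?b = "\<lambda>u v :: nat \<Rightarrow> real. u 0 * v 0"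
    and ?W = "{s :: nat \<Rightarrow> real. \<forall>i\<ge>2 * n. s i = 0}" and ?c = "\<lambda>v s. v 0 *\<^sub>R rotation n s"
  note std = standard_translation_data[OF n]
  have u: "?b (unit_seq 0) (unit_seq 0) = 1" by (simp add: unit_seq_def)
  interpret translation_line ?V ?b ?W ?c "dot n" "unit_seq 0"
    by (rule translation_line.intro[OF std(1)]) (simp_all add: unit_seq_def)
  obtain l s t where "translation_line_basis ?V ?b ?W ?c (dot n) (unit_seq 0) l s t"
    by (rule symplectic_basis)
  then interpret translation_line_basis ?V ?b ?W ?c "dot n" "unit_seq 0" l s t .
  have "num_irreducible_components ?V ?c ?W = n" using num_components std(3) dimW u by simp
  moreover have "has_signature ?V ?b (1, 0)"
      using signature_line[of ?V "unit_seq 0" ?b, OF V bilinear_b] u by simp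
  ultimately show "\<exists>(V :: (nat \<Rightarrow> real) set) b (W :: (nat \<Rightarrow> real) set) c \<beta> (g :: vfield graded_lie).
      extended_translation_data V b W c \<beta> \<and> dim V = 1 \<and> has_signature V b (1, 0) \<and>
      maximal_transitive_prolongation (extended_translation_algebra V b W c \<beta>) g \<and>
      num_irreducible_components V c W = n"
    using std(1,2) contact_maximal by blast
qed

end
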